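(* Let $\mathscr E=(\mathbb E,\mathtt{A},\otimes,I,u_l,u_r,aso)$ be a liberal surmonoidal surcategory over a category $\mathbb G$ such that for every object $B$ of $\mathbb G$ the object $I(B)$ is initial in the fiber $\mathbb E_B$, and for every arrow $b$ of $\mathbb G$ the object $I(b)$ is initial in the fiber $\mathbb E_b$. Then the forgetful surfunctor $U:(/\mathrm{Mon}(\mathbb E,\mathtt{A}),\mathtt{A})\to(\mathbb E,\mathtt{A})$, $(C,m,e;C_0)\mapsto C$, has a left suradjoint $M\dashv U$ and it is surmonadic.
   Context: A surcategory over $\mathbb G$ is a pair $(\mathscr C,\mathtt{A})$ with $\mathtt{A}:\mathscr C\to\mathbb G$ a functor (an object of the 2-category $\mathrm{Cat}/\mathbb G$). A surfunctor is a functor commuting with the arity functors. A suradjunction (resp. surmonad) is an adjunction (resp. monad) in $\mathrm{Cat}/\mathbb G$; in particular all 2-cells have components sent to identities by the arity functors. For a surmonad $S$ on $(\mathscr X,\mathtt{A})$ the Eilenberg–Moore category $\mathscr X^S$ is a surcategory with arity $(x,h)\mapsto\mathtt{A}(x)$. A right suradjoint surfunctor is surmonadic if the comparison surfunctor to the surcategory of Eilenberg–Moore algebras of the induced surmonad is an isomorphism in $\mathrm{Cat}/\mathbb G$. For an object $B$ of $\mathbb G$, the fiber $\mathbb E_B$ has as objects the $x\in\mathbb E$ with $\mathtt{A}(x)=B$ and as arrows the $f$ with $\mathtt{A}(f)=1_B$. For an arrow $b$ of $\mathbb G$, the fiber $\mathbb E_b$ has as objects the arrows $f$ of $\mathbb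 E$ with $\mathtt{A}(f)=b$, and as morphisms $f\to f'$ the pairs $(p,q)$ of arrows sent by $\mathtt{A}$ to identities with $qf=f'p$. A surmonoidal surcategory over $\mathbb G$ is a monoidal object of $\mathrm{Cat}/\mathbb G$: a tuple $(\mathbb E,\mathtt{A},\otimes,I,u_l,u_r,aso)$ with $\mathtt{A}:\mathbb E\to\mathbb G$ a functor, $\otimes:\mathbb E\times_{\mathbb G}\mathbb E\to\mathbb E$ a surfunctor, $I:\mathbb G\to\mathbb E$ a functor with $\mathtt{A}I=1_{\mathbb G}$, and natural isomorphisms (2-cells of $\mathrm{Cat}/\mathbb G$) $u_r:\otimes(1_{\mathbb E},I\mathtt{A})\to1_{\mathbb E}$, $u_l:\otimes(I\mathtt{A},1_{\mathbb E})\to1_{\mathbb E}$, $aso:\otimes(\otimes\times1_{\mathbb E})\to\otimes(1_{\mathbb E}\times\otimes)$ satisfying the usual coherence axioms of monoidal categories. Each fiber $\mathbb E_B$ is then a monoidal category with unit $I(B)$. Let $\vec{\mathbb N}$ be the ordered set of non-negative integers viewed as a category. A monoidal category $\mathbb V$ is liberal if: $\mathbb V$ has $\vec{\mathbb N}$-colimits and coequalizers; for every object $X$, $(-)\otimes X$ and $X\otimes(-)$ preserve $\vec{\mathbb N}$-colimits; and for every $X$, $(-)\otimes X$ preserves coequalizers. A surmonoidal surcategory is liberal if every fiber $\mathbb E_B$ is a liberal monoidal category and every inclusion $\mathbb E_B\hookrightarrow\mathbb E$ preserves coequalizers and $\vec{\mathbb N}$-colimits. A surmonoid $(C,m,e;C_0)$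 in $\mathscr E$ is an object $C_0$ of $\mathbb G$ with a monoid $(C,m,e)$ ($m$ multiplication, $e$ unit) in $\mathbb E_{C_0}$. A morphism $(C,m,e;C_0)\to(C',m',e';C_0')$ is a pair $(f,f_0)$, $f_0:C_0\to C_0'$ in $\mathbb G$, $f:C\to C'$ in $\mathbb E$, with $\mathtt{A}(f)=f_0$, $fm=m'(f\otimes f)$, $fe=e'I(f_0)$. $/\mathrm{Mon}(\mathbb E,\mathtt{A})$ is the category of surmonoids; its arity functor sends $(C,m,e;C_0)$ to $C_0$ and $(f,f_0)$ to $f_0$. *)

theory Defs
  imports Main
begin

section \<open>Categories, functors, natural transformations\<close>

text \<open>
  A category has a set of objects and a set of arrows, both inside types; \<open>g \<cdot>\<^bsub>C\<^esub> f\<close> is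
  ``\<open>g\<close> after \<open>f\<close>''.  Operations are unconstrained outside these sets, so functors and
  transformations are compared on objects and arrows only.
\<close>

record ('o, 'a) cat =
  Obj :: "'o set"
  Arr :: "'a set"
  Dom :: "'a \<Rightarrow> 'o"
  Cod :: "'a \<Rightarrow> 'o"
  Ide :: "'o \<Rightarrow> 'a"
  Cmp :: "'a \<Rightarrow> 'a \<Rightarrow> 'a"  (infixr "\<cdot>\<index>" 70)

definition hom :: "('o, 'a, 'z) cat_scheme \<Rightarrow> 'o \<Rightarrow> 'o \<Rightarrow> 'a set" where
  "hom C x y = {f \<in> Arr C. Dom C f = x \<and> Cod C f = y}"

locale category =
  fixes C :: "('o, 'a, 'z) cat_scheme" (structure)
  assumes dom_obj: "f \<in> Arr C \<Longrightarrow> Dom C f \<in> Obj C"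
    and cod_obj: "f \<in> Arr C \<Longrightarrow> Cod C f \<in> Obj C"
    and ide_hom: "x \<in> Obj C \<Longrightarrow> Ide C x \<in> hom C x x"
    and cmp_hom: "\<lbrakk>f \<in> hom C x y; g \<in> hom C y z\<rbrakk> \<Longrightarrow> g \<cdot> f \<in> hom C x z"
    and cmp_ide_left: "f \<in> hom C x y \<Longrightarrow> Ide C y \<cdot> f = f"
    and cmp_ide_right: "f \<in> hom C x y \<Longrightarrow> f \<cdot> Ide C x = f"
    and cmp_assoc: "\<lbrakk>f \<in> hom C w x; g \<in> hom C x y; h \<in> hom C y z\<rbrakk>
          \<Longrightarrow> (h \<cdot> g) \<cdot> f = h \<cdot> (g \<cdot> f)"

definition is_iso :: "('o, 'a, 'z) cat_scheme \<Rightarrow> 'a \<Rightarrow> bool" where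
  "is_iso C f \<longleftrightarrow> f \<in> Arr C \<and>
     (\<exists>g \<in> hom C (Cod C f) (Dom C f).
        g \<cdot>\<^bsub>C\<^esub> f = Ide C (Dom C f) \<and> f \<cdot>\<^bsub>C\<^esub> g = Ide C (Cod C f))"

definition is_initial :: "('o, 'a, 'z) cat_scheme \<Rightarrow> 'o \<Rightarrow> bool" where
  "is_initial C x \<longleftrightarrow> x \<in> Obj C \<and> (\<forall>y \<in> Obj C. \<exists>!f. f \<in> hom C x y)"

record ('o, 'a, 'p, 'b) ftor =
  Fob :: "'o \<Rightarrow> 'p"
  Far :: "'a \<Rightarrow> 'b"

locale is_functor = C: category C + D: category D
  for C :: "('o, 'a, 'y) cat_scheme" and D :: "('p, 'b, 'z) cat_scheme" +
  fixes F :: "('o, 'a, 'p, 'b) ftor"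
  assumes fob_obj: "x \<in> Obj C \<Longrightarrow> Fob F x \<in> Obj D"
    and far_hom: "f \<in> hom C x y \<Longrightarrow> Far F f \<in> hom D (Fob F x) (Fob F y)"
    and far_ide: "x \<in> Obj C \<Longrightarrow> Far F (Ide C x) = Ide D (Fob F x)"
    and far_cmp: "\<lbrakk>f \<in> hom C x y; g \<in> hom C y z\<rbrakk>
          \<Longrightarrow> Far F (g \<cdot>\<^bsub>C\<^esub> f) = Far F g \<cdot>\<^bsub>D\<^esub> Far F f"

definition id_ftor :: "('o, 'a, 'o, 'a) ftor" where
  "id_ftor = \<lparr>Fob = (\<lambda>x. x), Far = (\<lambda>f. f)\<rparr>"

definition comp_ftor ::
  "('p, 'b, 'q, 'c) ftor \<Rightarrow> ('o, 'a, 'p, 'b) ftor \<Rightarrow> ('o, 'a, 'q, 'c) ftor"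
  (infixr "\<circ>\<^sub>F" 55) where
  "G \<circ>\<^sub>F F = \<lparr>Fob = (\<lambda>x. Fob G (Fob F x)), Far = (\<lambda>f. Far G (Far F f))\<rparr>"

definition pair_ftor ::
  "('o, 'a, 'p, 'b) ftor \<Rightarrow> ('o, 'a, 'q, 'c) ftor \<Rightarrow> ('o, 'a, 'p \<times> 'q, 'b \<times> 'c) ftor" where
  "pair_ftor F G = \<lparr>Fob = (\<lambda>x. (Fob F x, Fob G x)), Far = (\<lambda>f. (Far F f, Far G f))\<rparr>"

definition prod_ftor ::
  "('o, 'a, 'p, 'b) ftor \<Rightarrow> ('q, 'c, 'r, 'd) ftor \<Rightarrow> ('o \<times> 'q, 'a \<times> 'c, 'p \<times> 'r, 'b \<times> 'd) ftor" where
  "prod_ftor F G = \<lparr>Fob = map_prod (Fob F) (Fob G), Far = map_prod (Far F) (Far G)\<rparr>"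

definition reassoc_ftor ::
  "(('o \<times> 'p) \<times> 'q, ('a \<times> 'b) \<times> 'c, 'o \<times> 'p \<times> 'q, 'a \<times> 'b \<times> 'c) ftor" where
  "reassoc_ftor = \<lparr>Fob = (\<lambda>((x, y), z). (x, y, z)), Far = (\<lambda>((f, g), h). (f, g, h))\<rparr>"

definition ftor_eq ::
  "('o, 'a, 'z) cat_scheme \<Rightarrow> ('o, 'a, 'p, 'b) ftor \<Rightarrow> ('o, 'a, 'p, 'b) ftor \<Rightarrow> bool" where
  "ftor_eq C F G \<longleftrightarrow> (\<forall>x \<in> Obj C. Fob F x = Fob G x) \<and> (\<forall>f \<in> Arr C. Far F f = Far G f)"

definition nat_trans ::
  "('o, 'a, 'y) cat_scheme \<Rightarrow> ('p, 'b, 'z) cat_scheme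
   \<Rightarrow> ('o, 'a, 'p, 'b) ftor \<Rightarrow> ('o, 'a, 'p, 'b) ftor \<Rightarrow> ('o \<Rightarrow> 'b) \<Rightarrow> bool" where
  "nat_trans C D F G \<tau> \<longleftrightarrow> is_functor C D F \<and> is_functor C D G \<and>
     (\<forall>x \<in> Obj C. \<tau> x \<in> hom D (Fob F x) (Fob G x)) \<and>
     (\<forall>f \<in> Arr C. Far G f \<cdot>\<^bsub>D\<^esub> \<tau> (Dom C f) = \<tau> (Cod C f) \<cdot>\<^bsub>D\<^esub> Far F f)"

definition nat_iso ::
  "('o, 'a, 'y) cat_scheme \<Rightarrow> ('p, 'b, 'z) cat_scheme
   \<Rightarrow> ('o, 'a, 'p, 'b) ftor \<Rightarrow> ('o, 'a, 'p, 'b) ftor \<Rightarrow> ('o \<Rightarrow> 'b) \<Rightarrow> bool" where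
  "nat_iso C D F G \<tau> \<longleftrightarrow> nat_trans C D F G \<tau> \<and> (\<forall>x \<in> Obj C. is_iso D (\<tau> x))"

definition prod_cat ::
  "('o, 'a, 'y) cat_scheme \<Rightarrow> ('p, 'b, 'z) cat_scheme \<Rightarrow> ('o \<times> 'p, 'a \<times> 'b) cat" where
  "prod_cat C D = \<lparr>
     Obj = Obj C \<times> Obj D,
     Arr = Arr C \<times> Arr D,
     Dom = map_prod (Dom C) (Dom D),
     Cod = map_prod (Cod C) (Cod D),
     Ide = map_prod (Ide C) (Ide D),
     Cmp = (\<lambda>(g, g') (f, f'). (g \<cdot>\<^bsub>C\<^esub> f, g' \<cdot>\<^bsub>D\<^esub> f'))\<rparr>"


section \<open>Colimits\<close>

definition is_cocone ::
  "('j, 'u, 'y) cat_scheme \<Rightarrow> ('o, 'a, 'z) cat_scheme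
   \<Rightarrow> ('j, 'u, 'o, 'a) ftor \<Rightarrow> 'o \<Rightarrow> ('j \<Rightarrow> 'a) \<Rightarrow> bool" where
  "is_cocone J C D c \<kappa> \<longleftrightarrow> is_functor J C D \<and> c \<in> Obj C \<and>
     (\<forall>j \<in> Obj J. \<kappa> j \<in> hom C (Fob D j) c) \<and>
     (\<forall>u \<in> Arr J. \<kappa> (Cod J u) \<cdot>\<^bsub>C\<^esub> Far D u = \<kappa> (Dom J u))"

definition is_colimit ::
  "('j, 'u, 'y) cat_scheme \<Rightarrow> ('o, 'a, 'z) cat_scheme
   \<Rightarrow> ('j, 'u, 'o, 'a) ftor \<Rightarrow> 'o \<Rightarrow> ('j \<Rightarrow> 'a) \<Rightarrow> bool" where
  "is_colimit J C D c \<kappa> \<longleftrightarrow> is_cocone J C D c \<kappa> \<and>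
     (\<forall>c' \<kappa>'. is_cocone J C D c' \<kappa>' \<longrightarrow>
        (\<exists>!f. f \<in> hom C c c' \<and> (\<forall>j \<in> Obj J. f \<cdot>\<^bsub>C\<^esub> \<kappa> j = \<kappa>' j)))"

definition has_colimits :: "('j, 'u, 'y) cat_scheme \<Rightarrow> ('o, 'a, 'z) cat_scheme \<Rightarrow> bool" where
  "has_colimits J C \<longleftrightarrow> (\<forall>D. is_functor J C D \<longrightarrow> (\<exists>c \<kappa>. is_colimit J C D c \<kappa>))"

definition preserves_colimits ::
  "('j, 'u, 'x) cat_scheme \<Rightarrow> ('o, 'a, 'y) cat_scheme \<Rightarrow> ('p, 'b, 'z) cat_scheme
   \<Rightarrow> ('o, 'a, 'p, 'b) ftor \<Rightarrow> bool" where
  "preserves_colimits J C C' F \<longleftrightarrow>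
     (\<forall>D c \<kappa>. is_colimit J C D c \<kappa> \<longrightarrow>
        is_colimit J C' (F \<circ>\<^sub>F D) (Fob F c) (\<lambda>j. Far F (\<kappa> j)))"

definition nat_cat :: "(nat, nat \<times> nat) cat" where
  "nat_cat = \<lparr>
     Obj = UNIV,
     Arr = {(m, n). m \<le> n},
     Dom = fst,
     Cod = snd,
     Ide = (\<lambda>n. (n, n)),
     Cmp = (\<lambda>g f. (fst f, snd g))\<rparr>"

definition cofork ::
  "('o, 'a, 'z) cat_scheme \<Rightarrow> 'a \<Rightarrow> 'a \<Rightarrow> 'a \<Rightarrow> bool" where
  "cofork C f g q \<longleftrightarrow> (\<exists>x y. f \<in> hom C x y \<and> g \<in> hom C x y \<and> q \<in> Arr C \<and> Dom C q = y) \<and>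
     q \<cdot>\<^bsub>C\<^esub> f = q \<cdot>\<^bsub>C\<^esub> g"

definition is_coequalizer ::
  "('o, 'a, 'z) cat_scheme \<Rightarrow> 'a \<Rightarrow> 'a \<Rightarrow> 'a \<Rightarrow> bool" where
  "is_coequalizer C f g q \<longleftrightarrow> cofork C f g q \<and>
     (\<forall>h. cofork C f g h \<longrightarrow> (\<exists>!k. k \<in> hom C (Cod C q) (Cod C h) \<and> k \<cdot>\<^bsub>C\<^esub> q = h))"

definition has_coequalizers :: "('o, 'a, 'z) cat_scheme \<Rightarrow> bool" where
  "has_coequalizers C \<longleftrightarrow>
     (\<forall>x y. \<forall>f \<in> hom C x y. \<forall>g \<in> hom C x y. \<exists>q. is_coequalizer C f g q)"

definition preserves_coequalizers ::
  "('o, 'a, 'y) cat_scheme \<Rightarrow> ('p, 'b, 'z) cat_scheme \<Rightarrow> ('o, 'a, 'p, 'b) ftor \<Rightarrow> bool" where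
  "preserves_coequalizers C C' F \<longleftrightarrow>
     (\<forall>f g q. is_coequalizer C f g q \<longrightarrow> is_coequalizer C' (Far F f) (Far F g) (Far F q))"


section \<open>Monoidal categories and monoids\<close>

abbreviation ten_ob :: "('o \<times> 'o, 'a \<times> 'a, 'o, 'a) ftor \<Rightarrow> 'o \<Rightarrow> 'o \<Rightarrow> 'o" (infixr "\<otimes>\<index>" 75) where
  "x \<otimes>\<^bsub>T\<^esub> y \<equiv> Fob T (x, y)"

abbreviation ten_ar :: "('o \<times> 'o, 'a \<times> 'a, 'o, 'a) ftor \<Rightarrow> 'a \<Rightarrow> 'a \<Rightarrow> 'a" (infixr "\<odot>\<index>" 75) where
  "f \<odot>\<^bsub>T\<^esub> g \<equiv> Far T (f, g)"

record ('o, 'a) moncat = "('o, 'a) cat" +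
  tensor :: "('o \<times> 'o, 'a \<times> 'a, 'o, 'a) ftor"
  unity :: "'o"
  lunit :: "'o \<Rightarrow> 'a"
  runit :: "'o \<Rightarrow> 'a"
  assctr :: "'o \<Rightarrow> 'o \<Rightarrow> 'o \<Rightarrow> 'a"

definition tensor_with_right ::
  "('o, 'a, 'z) moncat_scheme \<Rightarrow> 'o \<Rightarrow> ('o, 'a, 'o, 'a) ftor" where
  "tensor_with_right V x =
     \<lparr>Fob = (\<lambda>y. y \<otimes>\<^bsub>tensor V\<^esub> x), Far = (\<lambda>f. f \<odot>\<^bsub>tensor V\<^esub> Ide V x)\<rparr>"

definition tensor_with_left ::
  "('o, 'a, 'z) moncat_scheme \<Rightarrow> 'o \<Rightarrow> ('o, 'a, 'o, 'a) ftor" where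
  "tensor_with_left V x =
     \<lparr>Fob = (\<lambda>y. x \<otimes>\<^bsub>tensor V\<^esub> y), Far = (\<lambda>f. Ide V x \<odot>\<^bsub>tensor V\<^esub> f)\<rparr>"

locale monoidal_category =
  fixes V :: "('o, 'a, 'z) moncat_scheme" (structure) and T
  defines "T \<equiv> tensor V"
  assumes category: "category V"
    and tensor_functor: "is_functor (prod_cat V V) V T"
    and unity_obj: "unity V \<in> Obj V"
    and runit_iso: "nat_iso V V (tensor_with_right V (unity V)) id_ftor (runit V)"
    and lunit_iso: "nat_iso V V (tensor_with_left V (unity V)) id_ftor (lunit V)"
    and assctr_iso: "nat_iso (prod_cat (prod_cat V V) V) V
          (T \<circ>\<^sub>F prod_ftor T id_ftor)
          (T \<circ>\<^sub>F prod_ftor id_ftor T \<circ>\<^sub>F reassoc_ftor)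
          (\<lambda>((x, y), z). assctr V x y z)"
    and triangle: "\<lbrakk>x \<in> Obj V; y \<in> Obj V\<rbrakk> \<Longrightarrow>
          (Ide V x \<odot>\<^bsub>T\<^esub> lunit V y) \<cdot> assctr V x (unity V) y = runit V x \<odot>\<^bsub>T\<^esub> Ide V y"
    and pentagon: "\<lbrakk>w \<in> Obj V; x \<in> Obj V; y \<in> Obj V; z \<in> Obj V\<rbrakk> \<Longrightarrow>
          assctr V w x (y \<otimes>\<^bsub>T\<^esub> z) \<cdot> assctr V (w \<otimes>\<^bsub>T\<^esub> x) y z =
          (Ide V w \<odot>\<^bsub>T\<^esub> assctr V x y z) \<cdot> assctr V w (x \<otimes>\<^bsub>T\<^esub> y) z \<cdot>
            (assctr V w x y \<odot>\<^bsub>T\<^esub> Ide V z)"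

definition is_monoid ::
  "('o, 'a, 'z) moncat_scheme \<Rightarrow> 'o \<Rightarrow> 'a \<Rightarrow> 'a \<Rightarrow> bool" where
  "is_monoid V c m e \<longleftrightarrow> (let T = tensor V in
     c \<in> Obj V \<and> m \<in> hom V (c \<otimes>\<^bsub>T\<^esub> c) c \<and> e \<in> hom V (unity V) c \<and>
     m \<cdot>\<^bsub>V\<^esub> (m \<odot>\<^bsub>T\<^esub> Ide V c) = m \<cdot>\<^bsub>V\<^esub> (Ide V c \<odot>\<^bsub>T\<^esub> m) \<cdot>\<^bsub>V\<^esub> assctr V c c c \<and>
     m \<cdot>\<^bsub>V\<^esub> (e \<odot>\<^bsub>T\<^esub> Ide V c) = lunit V c \<and>
     m \<cdot>\<^bsub>V\<^esub> (Ide V c \<odot>\<^bsub>T\<^esub> e) = runit V c)"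

definition liberal_monoidal :: "('o, 'a, 'z) moncat_scheme \<Rightarrow> bool" where
  "liberal_monoidal V \<longleftrightarrow> monoidal_category V \<and>
     has_colimits nat_cat V \<and> has_coequalizers V \<and>
     (\<forall>x \<in> Obj V. preserves_colimits nat_cat V V (tensor_with_right V x) \<and>
        preserves_colimits nat_cat V V (tensor_with_left V x) \<and>
        preserves_coequalizers V V (tensor_with_right V x))"


section \<open>Surcategories\<close>

record ('o, 'a, 'go, 'ga) surcat = "('o, 'a) cat" +
  Arity :: "('o, 'a, 'go, 'ga) ftor"

definition surcategory ::
  "('go, 'ga, 'y) cat_scheme \<Rightarrow> ('o, 'a, 'go, 'ga, 'z) surcat_scheme \<Rightarrow> bool" where
  "surcategory G X \<longleftrightarrow> is_functor X G (Arity X)"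

definition surfunctor ::
  "('go, 'ga, 'x) cat_scheme \<Rightarrow> ('o, 'a, 'go, 'ga, 'y) surcat_scheme
   \<Rightarrow> ('p, 'b, 'go, 'ga, 'z) surcat_scheme \<Rightarrow> ('o, 'a, 'p, 'b) ftor \<Rightarrow> bool" where
  "surfunctor G X Y F \<longleftrightarrow> surcategory G X \<and> surcategory G Y \<and> is_functor X Y F \<and>
     ftor_eq X (Arity Y \<circ>\<^sub>F F) (Arity X)"

definition sur_trans ::
  "('go, 'ga, 'x) cat_scheme \<Rightarrow> ('o, 'a, 'go, 'ga, 'y) surcat_scheme
   \<Rightarrow> ('p, 'b, 'go, 'ga, 'z) surcat_scheme
   \<Rightarrow> ('o, 'a, 'p, 'b) ftor \<Rightarrow> ('o, 'a, 'p, 'b) ftor \<Rightarrow> ('o \<Rightarrow> 'b) \<Rightarrow> bool" where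
  "sur_trans G X Y F H \<tau> \<longleftrightarrow> surfunctor G X Y F \<and> surfunctor G X Y H \<and> nat_trans X Y F H \<tau> \<and>
     (\<forall>x \<in> Obj X. Far (Arity Y) (\<tau> x) = Ide G (Fob (Arity X) x))"

definition sur_trans_iso ::
  "('go, 'ga, 'x) cat_scheme \<Rightarrow> ('o, 'a, 'go, 'ga, 'y) surcat_scheme
   \<Rightarrow> ('p, 'b, 'go, 'ga, 'z) surcat_scheme
   \<Rightarrow> ('o, 'a, 'p, 'b) ftor \<Rightarrow> ('o, 'a, 'p, 'b) ftor \<Rightarrow> ('o \<Rightarrow> 'b) \<Rightarrow> bool" where
  "sur_trans_iso G X Y F H \<tau> \<longleftrightarrow> sur_trans G X Y F H \<tau> \<and> (\<forall>x \<in> Obj X. is_iso Y (\<tau> x))"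

definition sur_isomorphism ::
  "('go, 'ga, 'x) cat_scheme \<Rightarrow> ('o, 'a, 'go, 'ga, 'y) surcat_scheme
   \<Rightarrow> ('p, 'b, 'go, 'ga, 'z) surcat_scheme \<Rightarrow> ('o, 'a, 'p, 'b) ftor \<Rightarrow> bool" where
  "sur_isomorphism G X Y K \<longleftrightarrow> surfunctor G X Y K \<and>
     (\<exists>L. surfunctor G Y X L \<and> ftor_eq X (L \<circ>\<^sub>F K) id_ftor \<and> ftor_eq Y (K \<circ>\<^sub>F L) id_ftor)"

text \<open>The product in \<open>Cat/G\<close>, i.e. the pullback over \<open>G\<close>.\<close>

definition sur_prod ::
  "('o, 'a, 'go, 'ga, 'y) surcat_scheme \<Rightarrow> ('p, 'b, 'go, 'ga, 'z) surcat_scheme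
   \<Rightarrow> ('o \<times> 'p, 'a \<times> 'b, 'go, 'ga) surcat" where
  "sur_prod X Y = \<lparr>
     Obj = {(x, y). x \<in> Obj X \<and> y \<in> Obj Y \<and> Fob (Arity X) x = Fob (Arity Y) y},
     Arr = {(f, g). f \<in> Arr X \<and> g \<in> Arr Y \<and> Far (Arity X) f = Far (Arity Y) g},
     Dom = map_prod (Dom X) (Dom Y),
     Cod = map_prod (Cod X) (Cod Y),
     Ide = map_prod (Ide X) (Ide Y),
     Cmp = (\<lambda>(g, g') (f, f'). (g \<cdot>\<^bsub>X\<^esub> f, g' \<cdot>\<^bsub>Y\<^esub> f')),
     Arity = \<lparr>Fob = (\<lambda>(x, y). Fob (Arity X) x), Far = (\<lambda>(f, g). Far (Arity X) f)\<rparr>\<rparr>"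

definition fiber ::
  "('go, 'ga, 'y) cat_scheme \<Rightarrow> ('o, 'a, 'go, 'ga, 'z) surcat_scheme \<Rightarrow> 'go \<Rightarrow> ('o, 'a) cat" where
  "fiber G X B = \<lparr>
     Obj = {x \<in> Obj X. Fob (Arity X) x = B},
     Arr = {f \<in> Arr X. Far (Arity X) f = Ide G B},
     Dom = Dom X, Cod = Cod X, Ide = Ide X, Cmp = Cmp X\<rparr>"

text \<open>
  A morphism \<open>f \<rightarrow> f'\<close> of the fiber over an arrow \<open>b\<close> is a pair \<open>(p, q)\<close>; it is stored as
  \<open>(f, (p, q), f')\<close> because \<open>(p, q)\<close> alone does not determine its source and target.
\<close>

definition arrow_fiber ::
  "('go, 'ga, 'y) cat_scheme \<Rightarrow> ('o, 'a, 'go, 'ga, 'z) surcat_scheme \<Rightarrow> 'ga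
   \<Rightarrow> ('a, 'a \<times> ('a \<times> 'a) \<times> 'a) cat" where
  "arrow_fiber G X b = \<lparr>
     Obj = {f \<in> Arr X. Far (Arity X) f = b},
     Arr = {(f, (p, q), f').
       f \<in> Arr X \<and> Far (Arity X) f = b \<and> f' \<in> Arr X \<and> Far (Arity X) f' = b \<and>
       p \<in> hom X (Dom X f) (Dom X f') \<and> Far (Arity X) p = Ide G (Dom G b) \<and>
       q \<in> hom X (Cod X f) (Cod X f') \<and> Far (Arity X) q = Ide G (Cod G b) \<and>
       q \<cdot>\<^bsub>X\<^esub> f = f' \<cdot>\<^bsub>X\<^esub> p},
     Dom = (\<lambda>(f, (p, q), f'). f),
     Cod = (\<lambda>(f, (p, q), f'). f'),
     Ide = (\<lambda>f. (f, (Ide X (Dom X f), Ide X (Cod X f)), f)),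
     Cmp = (\<lambda>(f', (p', q'), f'') (f, (p, q), _). (f, (p' \<cdot>\<^bsub>X\<^esub> p, q' \<cdot>\<^bsub>X\<^esub> q), f''))\<rparr>"


section \<open>Suradjunctions and surmonadicity\<close>

definition suradjunction ::
  "('go, 'ga, 'x) cat_scheme \<Rightarrow> ('o, 'a, 'go, 'ga, 'y) surcat_scheme
   \<Rightarrow> ('p, 'b, 'go, 'ga, 'z) surcat_scheme
   \<Rightarrow> ('o, 'a, 'p, 'b) ftor \<Rightarrow> ('p, 'b, 'o, 'a) ftor \<Rightarrow> ('o \<Rightarrow> 'a) \<Rightarrow> ('p \<Rightarrow> 'b) \<Rightarrow> bool" where
  "suradjunction G X Y F U \<eta> \<epsilon> \<longleftrightarrow>
     surfunctor G X Y F \<and> surfunctor G Y X U \<and>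
     sur_trans G X X id_ftor (U \<circ>\<^sub>F F) \<eta> \<and>
     sur_trans G Y Y (F \<circ>\<^sub>F U) id_ftor \<epsilon> \<and>
     (\<forall>x \<in> Obj X. \<epsilon> (Fob F x) \<cdot>\<^bsub>Y\<^esub> Far F (\<eta> x) = Ide Y (Fob F x)) \<and>
     (\<forall>y \<in> Obj Y. Far U (\<epsilon> y) \<cdot>\<^bsub>X\<^esub> \<eta> (Fob U y) = Ide X (Fob U y))"

record ('o, 'a) monad =
  endo :: "('o, 'a, 'o, 'a) ftor"
  munit :: "'o \<Rightarrow> 'a"
  mmult :: "'o \<Rightarrow> 'a"

definition surmonad ::
  "('go, 'ga, 'y) cat_scheme \<Rightarrow> ('o, 'a, 'go, 'ga, 'z) surcat_scheme \<Rightarrow> ('o, 'a) monad \<Rightarrow> bool" where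
  "surmonad G X S \<longleftrightarrow>
     surfunctor G X X (endo S) \<and>
     sur_trans G X X id_ftor (endo S) (munit S) \<and>
     sur_trans G X X (endo S \<circ>\<^sub>F endo S) (endo S) (mmult S) \<and>
     (\<forall>x \<in> Obj X.
        mmult S x \<cdot>\<^bsub>X\<^esub> Far (endo S) (munit S x) = Ide X (Fob (endo S) x) \<and>
        mmult S x \<cdot>\<^bsub>X\<^esub> munit S (Fob (endo S) x) = Ide X (Fob (endo S) x) \<and>
        mmult S x \<cdot>\<^bsub>X\<^esub> Far (endo S) (mmult S x) = mmult S x \<cdot>\<^bsub>X\<^esub> mmult S (Fob (endo S) x))"

text \<open>
  Eilenberg--Moore algebras.  A morphism \<open>f\<close> is stored with its source and target algebra.
  The structure map \<open>h\<close> of an algebra of a surmonad has identity arity by the unit law.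
\<close>

definition EM ::
  "('o, 'a, 'go, 'ga, 'z) surcat_scheme \<Rightarrow> ('o, 'a) monad
   \<Rightarrow> ('o \<times> 'a, ('o \<times> 'a) \<times> 'a \<times> ('o \<times> 'a), 'go, 'ga) surcat" where
  "EM X S = (let
     Alg = {(x, h). x \<in> Obj X \<and> h \<in> hom X (Fob (endo S) x) x \<and>
       h \<cdot>\<^bsub>X\<^esub> munit S x = Ide X x \<and>
       h \<cdot>\<^bsub>X\<^esub> Far (endo S) h = h \<cdot>\<^bsub>X\<^esub> mmult S x}
   in \<lparr>
     Obj = Alg,
     Arr = {((x, h), f, (x', h')). (x, h) \<in> Alg \<and> (x', h') \<in> Alg \<and>
       f \<in> hom X x x' \<and> f \<cdot>\<^bsub>X\<^esub> h = h' \<cdot>\<^bsub>X\<^esub> Far (endo S) f},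
     Dom = (\<lambda>(s, f, t). s),
     Cod = (\<lambda>(s, f, t). t),
     Ide = (\<lambda>(x, h). ((x, h), Ide X x, (x, h))),
     Cmp = (\<lambda>(_, g, u) (s, f, _). (s, g \<cdot>\<^bsub>X\<^esub> f, u)),
     Arity = \<lparr>Fob = (\<lambda>(x, h). Fob (Arity X) x), Far = (\<lambda>(s, f, t). Far (Arity X) f)\<rparr>\<rparr>)"

definition induced_monad ::
  "('o, 'a, 'p, 'b) ftor \<Rightarrow> ('p, 'b, 'o, 'a) ftor \<Rightarrow> ('o \<Rightarrow> 'a) \<Rightarrow> ('p \<Rightarrow> 'b) \<Rightarrow> ('o, 'a) monad" where
  "induced_monad F U \<eta> \<epsilon> =
     \<lparr>endo = U \<circ>\<^sub>F F, munit = \<eta>, mmult = (\<lambda>x. Far U (\<epsilon> (Fob F x)))\<rparr>"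

definition comparison ::
  "('p, 'b, 'z) cat_scheme \<Rightarrow> ('p, 'b, 'o, 'a) ftor \<Rightarrow> ('p \<Rightarrow> 'b)
   \<Rightarrow> ('p, 'b, 'o \<times> 'a, ('o \<times> 'a) \<times> 'a \<times> ('o \<times> 'a)) ftor" where
  "comparison Y U \<epsilon> = (let alg = (\<lambda>y. (Fob U y, Far U (\<epsilon> y))) in
     \<lparr>Fob = alg, Far = (\<lambda>g. (alg (Dom Y g), Far U g, alg (Cod Y g)))\<rparr>)"

lemma functorD:
  assumes "is_functor C D F"
  shows "category C" "category D"
    "x \<in> Obj C \<Longrightarrow> Fob F x \<in> Obj D"
    "f \<in> hom C x y \<Longrightarrow> Far F f \<in> hom D (Fob F x) (Fob F y)"
    "x \<in> Obj C \<Longrightarrow> Far F (Ide C x) = Ide D (Fob F x)"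
    "\<lbrakk>f \<in> hom C x y; g \<in> hom C y z\<rbrakk> \<Longrightarrow> Far F (g \<cdot>\<^bsub>C\<^esub> f) = Far F g \<cdot>\<^bsub>D\<^esub> Far F f"
  using assms unfolding is_functor_def is_functor_axioms_def by blast+

lemma functor_comp: "is_functor C D F \<Longrightarrow> is_functor D K H \<Longrightarrow> is_functor C K (H \<circ>\<^sub>F F)"
  unfolding is_functor_def[of C K] is_functor_axioms_def comp_ftor_def by (simp add: functorD) (metis functorD(4,6))

lemma arr_hom: "f \<in> Arr C \<Longrightarrow> f \<in> hom C (Dom C f) (Cod C f)" by (auto simp: hom_def)

lemma surmonad_induced:
  assumes A: "suradjunction G X Y F U \<eta> \<epsilon>"
  shows "surmonad G X (induced_monad F U \<eta> \<epsilon>)"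
proof -
  have F: "surfunctor G X Y F" and U: "surfunctor G Y X U"
    and e: "sur_trans G X X id_ftor (U \<circ>\<^sub>F F) \<eta>"
    and k: "sur_trans G Y Y (F \<circ>\<^sub>F U) id_ftor \<epsilon>"
    and t1: "\<And>x. x \<in> Obj X \<Longrightarrow> \<epsilon> (Fob F x) \<cdot>\<^bsub>Y\<^esub> Far F (\<eta> x) = Ide Y (Fob F x)"
    and t2: "\<And>y. y \<in> Obj Y \<Longrightarrow> Far U (\<epsilon> y) \<cdot>\<^bsub>X\<^esub> \<eta> (Fob U y) = Ide X (Fob U y)"
    using A by (auto simp: suradjunction_def)
  have UF: "surfunctor G X X (U \<circ>\<^sub>F F)" using e by (auto simp: sur_trans_def)
  have f: "is_functor X Y F" and u: "is_functor Y X U" using F U by (auto simp: surfunctor_def)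
  have uf: "is_functor X X (U \<circ>\<^sub>F F)" using UF by (auto simp: surfunctor_def)
  note [simp] = comp_ftor_def id_ftor_def
  have eh: "\<And>x. x \<in> Obj X \<Longrightarrow> \<eta> x \<in> hom X x (Fob U (Fob F x))" using e by (auto simp: sur_trans_def nat_trans_def)
  have kh: "\<And>y. y \<in> Obj Y \<Longrightarrow> \<epsilon> y \<in> hom Y (Fob F (Fob U y)) y" using k by (auto simp: sur_trans_def nat_trans_def)
  have kn: "\<And>g. g \<in> Arr Y \<Longrightarrow> g \<cdot>\<^bsub>Y\<^esub> \<epsilon> (Dom Y g) = \<epsilon> (Cod Y g) \<cdot>\<^bsub>Y\<^esub> Far F (Far U g)" using k by (auto simp: sur_trans_def nat_trans_def)
  have SS: "is_functor X X ((U \<circ>\<^sub>F F) \<circ>\<^sub>F (U \<circ>\<^sub>F F))"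
    by (rule functor_comp uf)+
  have arr: "\<And>f. f \<in> Arr X \<Longrightarrow> Far F f \<in> Arr Y \<and> Dom Y (Far F f) = Fob F (Dom X f) \<and> Cod Y (Far F f) = Fob F (Cod X f)"
    using functorD(4)[OF f arr_hom] by (auto simp: hom_def)
  have arru: "\<And>f. f \<in> Arr Y \<Longrightarrow> Far U f \<in> Arr X \<and> Dom X (Far U f) = Fob U (Dom Y f) \<and> Cod X (Far U f) = Fob U (Cod Y f)"
    using functorD(4)[OF u arr_hom] by (auto simp: hom_def)
  have cX: "category X" "category Y" using functorD[OF f] by auto
  have ob: "\<And>f. f \<in> Arr X \<Longrightarrow> Dom X f \<in> Obj X \<and> Cod X f \<in> Obj X" using cX(1) by (auto simp: category_def)
  have mun: "Far U (Far F f) \<cdot>\<^bsub>X\<^esub> Far U (\<epsilon> (Fob F (Dom X f))) = Far U (\<epsilon> (Fob F (Cod X f))) \<cdot>\<^bsub>X\<^esub> Far U (Far F (Far U (Far F f)))" if "f \<in> Arr X" for f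
  proof -
    have a: "Far F f \<in> hom Y (Fob F (Dom X f)) (Fob F (Cod X f))" using arr[OF that] by (auto simp: hom_def)
    show ?thesis
      using kn[of "Far F f"] arr[OF that] ob[OF that] functorD(6)[OF u kh[of "Fob F (Dom X f)"] a]
       functorD(6)[OF u _ kh[of "Fob F (Cod X f)"], of "Far F (Far U (Far F f))"] functorD(3,4)[OF f] functorD(4)[OF u a]
      by force
  qed
  have mh: "\<And>x. x \<in> Obj X \<Longrightarrow> Far U (\<epsilon> (Fob F x)) \<in> hom X (Fob U (Fob F (Fob U (Fob F x)))) (Fob U (Fob F x))"
    using kh functorD(3)[OF f] functorD(4)[OF u] by auto
  have ar: "\<And>x. x \<in> Obj X \<Longrightarrow> Fob (Arity Y) (Fob F x) = Fob (Arity X) x" using F by (auto simp: surfunctor_def ftor_eq_def)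
  have ar2: "\<And>f. f \<in> Arr Y \<Longrightarrow> Far (Arity X) (Far U f) = Far (Arity Y) f" using U by (auto simp: surfunctor_def ftor_eq_def)
  have ar3: "\<And>y. y \<in> Obj Y \<Longrightarrow> Far (Arity Y) (\<epsilon> y) = Ide G (Fob (Arity Y) y)" using k by (auto simp: sur_trans_def)
  have ka: "Far (Arity X) (Far U (\<epsilon> (Fob F x))) = Ide G (Fob (Arity X) x)" if "x \<in> Obj X" for x
    using ar2[of "\<epsilon> (Fob F x)"] ar3[of "Fob F x"] ar[OF that] kh[of "Fob F x"] functorD(3)[OF f that] by (auto simp: hom_def)
  have SSs: "surfunctor G X X ((U \<circ>\<^sub>F F) \<circ>\<^sub>F (U \<circ>\<^sub>F F))"
    using UF SS functorD(3)[OF uf] functorD(4)[OF uf arr_hom] by (force simp: surfunctor_def ftor_eq_def hom_def)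
  have mu: "sur_trans G X X ((U \<circ>\<^sub>F F) \<circ>\<^sub>F (U \<circ>\<^sub>F F)) (U \<circ>\<^sub>F F) (\<lambda>x. Far U (\<epsilon> (Fob F x)))"
    unfolding sur_trans_def nat_trans_def using SSs UF SS uf mun mh ka
    by auto
  show ?thesis unfolding surmonad_def induced_monad_def using UF e mu
    apply simp
    apply (intro ballI conjI)
    subgoal for x using functorD(6)[OF u functorD(4)[OF f eh[of x]] kh[of "Fob F x"]] t1 functorD(3,5)[OF f] functorD(5)[OF u] by simp
    subgoal for x using t2 functorD(3)[OF f] by simp
    subgoal for x using functorD(6)[OF u _ kh[of "Fob F x"]] functorD(3)[OF f] functorD(3)[OF u] kh mh functorD(4)[OF f] kn[of "\<epsilon> (Fob F x)"]
      by (smt (verit, best) hom_def mem_Collect_eq)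
    done
qed

text \<open>
  Left suradjoints are unique only up to isomorphism; the comparison is required to be an
  isomorphism for every choice of left suradjoint, unit and counit.
\<close>

definition surmonadic ::
  "('go, 'ga, 'x) cat_scheme \<Rightarrow> ('o, 'a, 'go, 'ga, 'y) surcat_scheme
   \<Rightarrow> ('p, 'b, 'go, 'ga, 'z) surcat_scheme \<Rightarrow> ('p, 'b, 'o, 'a) ftor \<Rightarrow> bool" where
  "surmonadic G X Y U \<longleftrightarrow>
     (\<exists>F \<eta> \<epsilon>. suradjunction G X Y F U \<eta> \<epsilon>) \<and>
     (\<forall>F \<eta> \<epsilon>. suradjunction G X Y F U \<eta> \<epsilon> \<longrightarrow>
        sur_isomorphism G Y (EM X (induced_monad F U \<eta> \<epsilon>)) (comparison Y U \<epsilon>))"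


section \<open>Surmonoidal surcategories\<close>

record ('o, 'a, 'go, 'ga) surmoncat = "('o, 'a, 'go, 'ga) surcat" +
  Tensor :: "('o \<times> 'o, 'a \<times> 'a, 'o, 'a) ftor"
  Unit :: "('go, 'ga, 'o, 'a) ftor"
  ul :: "'o \<Rightarrow> 'a"
  ur :: "'o \<Rightarrow> 'a"
  aso :: "'o \<Rightarrow> 'o \<Rightarrow> 'o \<Rightarrow> 'a"

locale surmonoidal_surcategory =
  fixes G :: "('go, 'ga, 'y) cat_scheme"
    and E :: "('o, 'a, 'go, 'ga, 'z) surmoncat_scheme" (structure)
    and T and I and A
  defines "T \<equiv> Tensor E" and "I \<equiv> Unit E" and "A \<equiv> Arity E"
  assumes surcategory: "surcategory G E"
    and tensor_surfunctor: "surfunctor G (sur_prod E E) E T"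
    and unit_functor: "is_functor G E I"
    and unit_section: "ftor_eq G (A \<circ>\<^sub>F I) id_ftor"
    and ur_iso: "sur_trans_iso G E E (T \<circ>\<^sub>F pair_ftor id_ftor (I \<circ>\<^sub>F A)) id_ftor (ur E)"
    and ul_iso: "sur_trans_iso G E E (T \<circ>\<^sub>F pair_ftor (I \<circ>\<^sub>F A) id_ftor) id_ftor (ul E)"
    and aso_iso: "sur_trans_iso G (sur_prod (sur_prod E E) E) E
          (T \<circ>\<^sub>F prod_ftor T id_ftor)
          (T \<circ>\<^sub>F prod_ftor id_ftor T \<circ>\<^sub>F reassoc_ftor)
          (\<lambda>((x, y), z). aso E x y z)"
    and triangle: "\<lbrakk>x \<in> Obj E; y \<in> Obj E; Fob A x = B; Fob A y = B\<rbrakk> \<Longrightarrow>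
          (Ide E x \<odot>\<^bsub>T\<^esub> ul E y) \<cdot> aso E x (Fob I B) y = ur E x \<odot>\<^bsub>T\<^esub> Ide E y"
    and pentagon: "\<lbrakk>w \<in> Obj E; x \<in> Obj E; y \<in> Obj E; z \<in> Obj E;
            Fob A w = B; Fob A x = B; Fob A y = B; Fob A z = B\<rbrakk> \<Longrightarrow>
          aso E w x (y \<otimes>\<^bsub>T\<^esub> z) \<cdot> aso E (w \<otimes>\<^bsub>T\<^esub> x) y z =
          (Ide E w \<odot>\<^bsub>T\<^esub> aso E x y z) \<cdot> aso E w (x \<otimes>\<^bsub>T\<^esub> y) z \<cdot> (aso E w x y \<odot>\<^bsub>T\<^esub> Ide E z)"

definition fiber_moncat ::
  "('go, 'ga, 'y) cat_scheme \<Rightarrow> ('o, 'a, 'go, 'ga, 'z) surmoncat_scheme \<Rightarrow> 'go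
   \<Rightarrow> ('o, 'a) moncat" where
  "fiber_moncat G E B = cat.extend (fiber G E B)
     (moncat.fields (Tensor E) (Fob (Unit E) B) (ul E) (ur E) (aso E))"

definition liberal_surmonoidal ::
  "('go, 'ga, 'y) cat_scheme \<Rightarrow> ('o, 'a, 'go, 'ga, 'z) surmoncat_scheme \<Rightarrow> bool" where
  "liberal_surmonoidal G E \<longleftrightarrow> surmonoidal_surcategory G E \<and>
     (\<forall>B \<in> Obj G. liberal_monoidal (fiber_moncat G E B) \<and>
        preserves_coequalizers (fiber G E B) E id_ftor \<and>
        preserves_colimits nat_cat (fiber G E B) E id_ftor)"

text \<open>
  Surmonoids \<open>(c, m, e, c\<^sub>0)\<close>.  A morphism \<open>(f, f\<^sub>0)\<close> is stored with its source and target.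
\<close>

definition surmonoids ::
  "('go, 'ga, 'y) cat_scheme \<Rightarrow> ('o, 'a, 'go, 'ga, 'z) surmoncat_scheme
   \<Rightarrow> ('o \<times> 'a \<times> 'a \<times> 'go) set" where
  "surmonoids G E =
     {(c, m, e, c\<^sub>0). c\<^sub>0 \<in> Obj G \<and> is_monoid (fiber_moncat G E c\<^sub>0) c m e}"

definition Mon ::
  "('go, 'ga, 'y) cat_scheme \<Rightarrow> ('o, 'a, 'go, 'ga, 'z) surmoncat_scheme
   \<Rightarrow> ('o \<times> 'a \<times> 'a \<times> 'go,
       ('o \<times> 'a \<times> 'a \<times> 'go) \<times> ('a \<times> 'ga) \<times> ('o \<times> 'a \<times> 'a \<times> 'go), 'go, 'ga) surcat" where
  "Mon G E = \<lparr>
     Obj = surmonoids G E,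
     Arr = {((c, m, e, c\<^sub>0), (f, f\<^sub>0), (c', m', e', c\<^sub>0')).
       (c, m, e, c\<^sub>0) \<in> surmonoids G E \<and> (c', m', e', c\<^sub>0') \<in> surmonoids G E \<and>
       f\<^sub>0 \<in> hom G c\<^sub>0 c\<^sub>0' \<and> f \<in> hom E c c' \<and> Far (Arity E) f = f\<^sub>0 \<and>
       f \<cdot>\<^bsub>E\<^esub> m = m' \<cdot>\<^bsub>E\<^esub> (f \<odot>\<^bsub>Tensor E\<^esub> f) \<and>
       f \<cdot>\<^bsub>E\<^esub> e = e' \<cdot>\<^bsub>E\<^esub> Far (Unit E) f\<^sub>0},
     Dom = (\<lambda>(s, f, t). s),
     Cod = (\<lambda>(s, f, t). t),
     Ide = (\<lambda>(c, m, e, c\<^sub>0). ((c, m, e, c\<^sub>0), (Ide E c, Ide G c\<^sub>0), (c, m, e, c\<^sub>0))),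
     Cmp = (\<lambda>(_, (g, g\<^sub>0), u) (s, (f, f\<^sub>0), _). (s, (g \<cdot>\<^bsub>E\<^esub> f, g\<^sub>0 \<cdot>\<^bsub>G\<^esub> f\<^sub>0), u)),
     Arity = \<lparr>Fob = (\<lambda>(c, m, e, c\<^sub>0). c\<^sub>0), Far = (\<lambda>(s, (f, f\<^sub>0), t). f\<^sub>0)\<rparr>\<rparr>"

definition Mon_forget ::
  "('o \<times> 'a \<times> 'a \<times> 'go,
    ('o \<times> 'a \<times> 'a \<times> 'go) \<times> ('a \<times> 'ga) \<times> ('o \<times> 'a \<times> 'a \<times> 'go), 'o, 'a) ftor" where
  "Mon_forget = \<lparr>Fob = (\<lambda>(c, m, e, c\<^sub>0). c), Far = (\<lambda>(s, (f, f\<^sub>0), t). f)\<rparr>"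

end

theory Submission
  imports Defs
begin

text \<open>
  Let \<open>X\<close> be an object over \<open>B\<close>.  Since \<open>I B\<close> is initial in the fiber, \<open>X\<close> has a unique point \<open>u : I B \<rightarrow> X\<close>, and
  every monoid is a pointed object by its unit; so the free monoid on \<open>X\<close> is the free monoid on a pointed
  object.  Kelly's construction produces it from a chain \<open>P 0 \<rightarrow> P 1 \<rightarrow> \<dots>\<close> with \<open>P 0 = I B\<close>, \<open>P 1 = X \<otimes> I B\<close>, in
  which \<open>P (n + 2)\<close> is the quotient of \<open>X \<otimes> P (n + 1)\<close> by the coequalizer of the two arrows from \<open>X \<otimes> P n\<close> that
  insert a point in front or after the first letter.  The colimit \<open>C\<close> carries an action \<open>\<alpha> : X \<otimes> C \<rightarrow> C\<close> for
  which the point acts as the identity, because \<open>X \<otimes> -\<close> preserves the colimit of the chain.  As \<open>- \<otimes> Y\<close>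
  preserves the coequalizers and the colimit, \<open>C \<otimes> Y\<close> is the free such action on \<open>Y\<close>, for every \<open>Y\<close>
  (\<open>free_action_exists\<close>).

  The inclusions of the fibers preserve these colimits too, so that the universal property also concerns
  arrows over any \<open>b : B \<rightarrow> B'\<close> of the base into actions in the fiber of \<open>B'\<close>.  For this the points of objects in
  different fibers must match: that \<open>I b\<close> is initial in the fiber of \<open>b\<close> says that every arrow over
  \<open>b\<close> commutes with the points up to \<open>I b\<close> (\<open>u_nat\<close>).

  Freeness of \<open>C \<otimes> Y\<close> with \<open>Y = C\<close> yields the multiplication of \<open>C\<close>, as the equivariant extension of the identity,
  and uniqueness of extensions with \<open>Y = I\<close>, \<open>C\<close> and \<open>C \<otimes> C\<close> yields the monoid laws and the universal property
  (\<open>free_monoid_universal\<close>).  Besides the axioms this takes the two derived coherence laws \<open>l_tensor\<close> and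
  \<open>r_tensor\<close>.  The universal arrows \<open>X \<rightarrow> C\<close> have identity arity, hence assemble to a suradjunction
  (\<open>suradjunction_of_universal_arrows\<close>).

  Surmonadicity holds for any left suradjoint.  The structure map \<open>h : T x \<rightarrow> x\<close> of an algebra is split by the
  unit \<open>\<eta> x\<close>, and so is every tensor power of it.  Hence at most one monoid structure on \<open>x\<close> makes \<open>h\<close> a
  morphism of monoids, with multiplication \<open>h m (\<eta> x \<otimes> \<eta> x)\<close> for the multiplication \<open>m\<close> of \<open>T x\<close>; the
  associative law of the algebra makes \<open>h\<close> multiplicative for it (\<open>alg_preserves_mult\<close>), and the monoid laws
  descend along the split epimorphisms.  The counit at the resulting monoid is \<open>h\<close> itself
  (\<open>alg_is_counit\<close>), so the comparison is bijective on objects, and likewise on arrows.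
\<close>

section \<open>Arrows with explicit source and target\<close>

lemma (in category) cmp_arr:
  assumes "f \<in> Arr C" "g \<in> Arr C" "Dom C g = Cod C f"
  shows "g \<cdot> f \<in> Arr C" "Dom C (g \<cdot> f) = Dom C f" "Cod C (g \<cdot> f) = Cod C g"
  using cmp_hom[of f "Dom C f" "Cod C f" g "Cod C g"] assms by (auto simp: hom_def)

lemma (in category) ide_arr:
  assumes "x \<in> Obj C"
  shows "Ide C x \<in> Arr C" "Dom C (Ide C x) = x" "Cod C (Ide C x) = x"
  using ide_hom[OF assms] by (auto simp: hom_def)

lemma (in category) unit_law:
  "f \<in> Arr C \<Longrightarrow> Cod C f = y \<Longrightarrow> Ide C y \<cdot> f = f"
  "f \<in> Arr C \<Longrightarrow> Dom C f = x \<Longrightarrow> f \<cdot> Ide C x = f"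
  using cmp_ide_left[of f "Dom C f" y] cmp_ide_right[of f x "Cod C f"] by (auto simp: hom_def)

lemma (in category) assoc_law:
  "\<lbrakk>f \<in> Arr C; g \<in> Arr C; h \<in> Arr C; Dom C g = Cod C f; Dom C h = Cod C g\<rbrakk>
   \<Longrightarrow> (h \<cdot> g) \<cdot> f = h \<cdot> (g \<cdot> f)"
  using cmp_assoc[of f "Dom C f" "Cod C f" g "Cod C g" h "Cod C h"] by (auto simp: hom_def)

lemma (in is_functor) far_arr:
  assumes "f \<in> Arr C"
  shows "Far F f \<in> Arr D" "Dom D (Far F f) = Fob F (Dom C f)" "Cod D (Far F f) = Fob F (Cod C f)"
  using far_hom[of f "Dom C f" "Cod C f"] assms by (auto simp: hom_def)

lemma (in is_functor) far_cmp_arr: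
  "\<lbrakk>f \<in> Arr C; g \<in> Arr C; Dom C g = Cod C f\<rbrakk> \<Longrightarrow> Far F (g \<cdot>\<^bsub>C\<^esub> f) = Far F g \<cdot>\<^bsub>D\<^esub> Far F f"
  using far_cmp[of f "Dom C f" "Cod C f" g "Cod C g"] by (auto simp: hom_def)

lemma nat_transD:
  assumes "nat_trans C D F H \<tau>"
  shows "x \<in> Obj C \<Longrightarrow> \<tau> x \<in> Arr D" "x \<in> Obj C \<Longrightarrow> Dom D (\<tau> x) = Fob F x"
    "x \<in> Obj C \<Longrightarrow> Cod D (\<tau> x) = Fob H x"
    "f \<in> Arr C \<Longrightarrow> \<tau> (Cod C f) \<cdot>\<^bsub>D\<^esub> Far F f = Far H f \<cdot>\<^bsub>D\<^esub> \<tau> (Dom C f)"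
  using assms by (auto simp: nat_trans_def hom_def)

text \<open>
  Invertibility is given by an existence statement, so an inverse has to be chosen; it is only used
  at isomorphisms.
\<close>

definition inverse_arr :: "('o, 'a, 'z) cat_scheme \<Rightarrow> 'a \<Rightarrow> 'a" where
  "inverse_arr C f = (SOME g. g \<in> hom C (Cod C f) (Dom C f) \<and>
     g \<cdot>\<^bsub>C\<^esub> f = Ide C (Dom C f) \<and> f \<cdot>\<^bsub>C\<^esub> g = Ide C (Cod C f))"

lemma inverse_arr:
  assumes "is_iso C f"
  shows "inverse_arr C f \<in> Arr C" "Dom C (inverse_arr C f) = Cod C f"
    "Cod C (inverse_arr C f) = Dom C f"
    "inverse_arr C f \<cdot>\<^bsub>C\<^esub> f = Ide C (Dom C f)" "f \<cdot>\<^bsub>C\<^esub> inverse_arr C f = Ide C (Cod C f)"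
proof -
  have "\<exists>g. g \<in> hom C (Cod C f) (Dom C f) \<and>
     g \<cdot>\<^bsub>C\<^esub> f = Ide C (Dom C f) \<and> f \<cdot>\<^bsub>C\<^esub> g = Ide C (Cod C f)"
    using assms by (auto simp: is_iso_def)
  from someI_ex[OF this, folded inverse_arr_def] show "inverse_arr C f \<in> Arr C" "Dom C (inverse_arr C f) = Cod C f"
    "Cod C (inverse_arr C f) = Dom C f"
    "inverse_arr C f \<cdot>\<^bsub>C\<^esub> f = Ide C (Dom C f)" "f \<cdot>\<^bsub>C\<^esub> inverse_arr C f = Ide C (Cod C f)"
    by (auto simp: hom_def)
qed

section \<open>Calculus in a surmonoidal surcategory\<close>

text \<open>
  The facts declared for the simplifier below compute source, target and arity of any well-typed
  expression, so that composability side conditions are discharged automatically.  Composites are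
  kept nested to the right.
\<close>

locale surmonoidal =
  fixes G :: "('go, 'ga, 'y) cat_scheme"
    and E :: "('o, 'a, 'go, 'ga, 'z) surmoncat_scheme" (structure)
  assumes surmonoidal: "surmonoidal_surcategory G E"
begin

abbreviation ten_obj (infixr "\<boxtimes>" 75) where "x \<boxtimes> y \<equiv> Fob (Tensor E) (x, y)"
abbreviation ten_arr (infixr "\<boxdot>" 75) where "f \<boxdot> g \<equiv> Far (Tensor E) (f, g)"
abbreviation ao where "ao \<equiv> Fob (Arity E)"
abbreviation ar where "ar \<equiv> Far (Arity E)"
abbreviation Io where "Io \<equiv> Fob (Unit E)"
abbreviation Ia where "Ia \<equiv> Far (Unit E)"
abbreviation id where "id \<equiv> Ide E"

abbreviation l where "l \<equiv> ul E"
abbreviation r where "r \<equiv> ur E"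
abbreviation as where "as \<equiv> aso E"
definition li where "li x = inverse_arr E (ul E x)"
definition ri where "ri x = inverse_arr E (ur E x)"
definition asi where "asi x y z = inverse_arr E (aso E x y z)"

lemma arity_functor: "is_functor E G (Arity E)"
  using surmonoidal by (auto simp: surmonoidal_surcategory_def surcategory_def)

lemma tensor_functor: "is_functor (sur_prod E E) E (Tensor E)"
  and unit_functor: "is_functor G E (Unit E)"
  using surmonoidal by (auto simp: surmonoidal_surcategory_def surfunctor_def)

sublocale Ar: is_functor E G "Arity E" by (rule arity_functor)
sublocale Te: is_functor "sur_prod E E" E "Tensor E" by (rule tensor_functor)
sublocale Un: is_functor G E "Unit E" by (rule unit_functor)

lemmas obj [simp] = Ar.C.dom_obj Ar.C.cod_obj Ar.D.dom_obj Ar.D.cod_obj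
lemmas cmp [simp] = Ar.C.cmp_arr Ar.D.cmp_arr
lemmas ide [simp] = Ar.C.ide_arr Ar.D.ide_arr
lemmas unit_laws [simp] = Ar.C.unit_law Ar.D.unit_law
lemmas assoc [simp] = Ar.C.assoc_law
lemmas arity [simp] = Ar.fob_obj Ar.far_arr Ar.far_ide Ar.far_cmp_arr
lemmas unit [simp] = Un.fob_obj Un.far_arr
lemmas unit_cmp = Un.far_ide Un.far_cmp_arr

lemma unit_arity [simp]:
  "B \<in> Obj G \<Longrightarrow> ao (Io B) = B" "b \<in> Arr G \<Longrightarrow> ar (Ia b) = b"
  using surmonoidal
  by (auto simp: surmonoidal_surcategory_def ftor_eq_def comp_ftor_def id_ftor_def)

lemma ten_ob [simp]:
  assumes "x \<in> Obj E" "y \<in> Obj E" "ao x = ao y"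
  shows "x \<boxtimes> y \<in> Obj E" "ao (x \<boxtimes> y) = ao y"
  using surmonoidal Te.fob_obj[of "(x, y)"] assms
  by (auto simp: surmonoidal_surcategory_def surfunctor_def ftor_eq_def comp_ftor_def sur_prod_def)

lemma ten_ar [simp]:
  assumes "f \<in> Arr E" "g \<in> Arr E" "ar f = ar g"
  shows "f \<boxdot> g \<in> Arr E" "Dom E (f \<boxdot> g) = Dom E f \<boxtimes> Dom E g"
    "Cod E (f \<boxdot> g) = Cod E f \<boxtimes> Cod E g" "ar (f \<boxdot> g) = ar g"
  using surmonoidal Te.far_arr[of "(f, g)"] assms
  by (auto simp: surmonoidal_surcategory_def surfunctor_def ftor_eq_def comp_ftor_def sur_prod_def)

lemma ten_ide [simp]:
  "\<lbrakk>x \<in> Obj E; y \<in> Obj E; ao x = ao y\<rbrakk> \<Longrightarrow> id x \<boxdot> id y = id (x \<boxtimes> y)"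
  using Te.far_ide[of "(x, y)"] by (auto simp: sur_prod_def)

lemma ten_cmp:
  assumes "f \<in> Arr E" "g \<in> Arr E" "Dom E g = Cod E f"
    "f' \<in> Arr E" "g' \<in> Arr E" "Dom E g' = Cod E f'" "ar f = ar f'" "ar g = ar g'"
  shows "(g \<boxdot> g') \<cdot> (f \<boxdot> f') = (g \<cdot> f) \<boxdot> (g' \<cdot> f')"
  using Te.far_cmp_arr[of "(f, f')" "(g, g')"] assms by (auto simp: sur_prod_def)

lemma is_iso_constraint:
  "x \<in> Obj E \<Longrightarrow> is_iso E (ul E x)" "x \<in> Obj E \<Longrightarrow> is_iso E (ur E x)"
  "\<lbrakk>x \<in> Obj E; y \<in> Obj E; z \<in> Obj E; ao x = ao y; ao y = ao z\<rbrakk> \<Longrightarrow> is_iso E (aso E x y z)"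
  using surmonoidal
  by (auto simp: surmonoidal_surcategory_def sur_trans_iso_def sur_prod_def)

lemma constraint_trans:
  "sur_trans G E E (Tensor E \<circ>\<^sub>F pair_ftor (Unit E \<circ>\<^sub>F Arity E) id_ftor) id_ftor (ul E)"
  "sur_trans G E E (Tensor E \<circ>\<^sub>F pair_ftor id_ftor (Unit E \<circ>\<^sub>F Arity E)) id_ftor (ur E)"
  "sur_trans G (sur_prod (sur_prod E E) E) E
          (Tensor E \<circ>\<^sub>F prod_ftor (Tensor E) id_ftor)
          (Tensor E \<circ>\<^sub>F prod_ftor id_ftor (Tensor E) \<circ>\<^sub>F reassoc_ftor)
          (\<lambda>((x, y), z). aso E x y z)"
  using surmonoidal by (auto simp: surmonoidal_surcategory_def sur_trans_iso_def)

lemma constraint_nat: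
  "nat_trans E E (Tensor E \<circ>\<^sub>F pair_ftor (Unit E \<circ>\<^sub>F Arity E) id_ftor) id_ftor l"
  "nat_trans E E (Tensor E \<circ>\<^sub>F pair_ftor id_ftor (Unit E \<circ>\<^sub>F Arity E)) id_ftor r"
  "nat_trans (sur_prod (sur_prod E E) E) E
          (Tensor E \<circ>\<^sub>F prod_ftor (Tensor E) id_ftor)
          (Tensor E \<circ>\<^sub>F prod_ftor id_ftor (Tensor E) \<circ>\<^sub>F reassoc_ftor)
          (\<lambda>((x, y), z). as x y z)"
  using constraint_trans by (auto simp: sur_trans_def)

lemma constraint_arity:
  "x \<in> Obj E \<Longrightarrow> ar (l x) = Ide G (ao x)"
  "x \<in> Obj E \<Longrightarrow> ar (r x) = Ide G (ao x)"
  "\<lbrakk>x \<in> Obj E; y \<in> Obj E; z \<in> Obj E; ao x = ao y; ao y = ao z\<rbrakk> \<Longrightarrow> ar (as x y z) = Ide G (ao z)"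
  using constraint_trans by (auto simp: sur_trans_def sur_prod_def)

lemmas ftor_simps = comp_ftor_def pair_ftor_def prod_ftor_def id_ftor_def reassoc_ftor_def sur_prod_def

lemma l_arr [simp]:
  assumes "x \<in> Obj E"
  shows "l x \<in> Arr E" "Dom E (l x) = Io (ao x) \<boxtimes> x" "Cod E (l x) = x" "ar (l x) = Ide G (ao x)"
  using nat_transD(1-3)[OF constraint_nat(1) assms] constraint_arity(1)[OF assms]
  by (auto simp: ftor_simps)

lemma r_arr [simp]:
  assumes "x \<in> Obj E"
  shows "r x \<in> Arr E" "Dom E (r x) = x \<boxtimes> Io (ao x)" "Cod E (r x) = x" "ar (r x) = Ide G (ao x)"
  using nat_transD(1-3)[OF constraint_nat(2) assms] constraint_arity(2)[OF assms]
  by (auto simp: ftor_simps)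

lemma as_arr [simp]:
  assumes "x \<in> Obj E" "y \<in> Obj E" "z \<in> Obj E" "ao x = ao y" "ao y = ao z"
  shows "as x y z \<in> Arr E" "Dom E (as x y z) = (x \<boxtimes> y) \<boxtimes> z" "Cod E (as x y z) = x \<boxtimes> y \<boxtimes> z"
    "ar (as x y z) = Ide G (ao z)"
  using nat_transD(1-3)[OF constraint_nat(3), of "((x, y), z)"] constraint_arity(3)[OF assms] assms
  by (auto simp: ftor_simps)

lemma l_nat: "f \<in> Arr E \<Longrightarrow> l (Cod E f) \<cdot> (Ia (ar f) \<boxdot> f) = f \<cdot> l (Dom E f)"
  using nat_transD(4)[OF constraint_nat(1)] by (auto simp: ftor_simps)

lemma r_nat: "f \<in> Arr E \<Longrightarrow> r (Cod E f) \<cdot> (f \<boxdot> Ia (ar f)) = f \<cdot> r (Dom E f)"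
  using nat_transD(4)[OF constraint_nat(2)] by (auto simp: ftor_simps)

lemma as_nat:
  assumes "f \<in> Arr E" "g \<in> Arr E" "h \<in> Arr E" "ar f = ar g" "ar g = ar h"
  shows "as (Cod E f) (Cod E g) (Cod E h) \<cdot> ((f \<boxdot> g) \<boxdot> h) =
    (f \<boxdot> g \<boxdot> h) \<cdot> as (Dom E f) (Dom E g) (Dom E h)"
  using assms nat_transD(4)[OF constraint_nat(3), of "((f, g), h)"] by (auto simp: ftor_simps)

lemma inverse_arity:
  assumes "is_iso E f" "ar f = Ide G B" "B \<in> Obj G"
  shows "ar (inverse_arr E f) = Ide G B"
proof -
  have f: "f \<in> Arr E" using assms by (simp add: is_iso_def)
  have D: "ao (Dom E f) = B" "ao (Cod E f) = B"
    using Ar.far_arr(2,3)[OF f] assms by auto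
  have "ar (inverse_arr E f \<cdot> f) = ar (inverse_arr E f) \<cdot>\<^bsub>G\<^esub> ar f"
    by (rule Ar.far_cmp_arr) (simp_all add: f inverse_arr[OF assms(1)])
  also have "\<dots> = ar (inverse_arr E f)"
    using inverse_arr[OF assms(1)] f assms D by simp
  finally show ?thesis using inverse_arr[OF assms(1)] f D by simp
qed

lemma li_arr [simp]:
  assumes "x \<in> Obj E"
  shows "li x \<in> Arr E" "Cod E (li x) = Io (ao x) \<boxtimes> x" "Dom E (li x) = x" "ar (li x) = Ide G (ao x)"
    "li x \<cdot> l x = id (Io (ao x) \<boxtimes> x)" "l x \<cdot> li x = id x"
  using inverse_arr[OF is_iso_constraint(1)[OF assms]] l_arr[OF assms]
    inverse_arity[OF is_iso_constraint(1)[OF assms]] assms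
  by (auto simp: li_def)

lemma ri_arr [simp]:
  assumes "x \<in> Obj E"
  shows "ri x \<in> Arr E" "Cod E (ri x) = x \<boxtimes> Io (ao x)" "Dom E (ri x) = x" "ar (ri x) = Ide G (ao x)"
    "ri x \<cdot> r x = id (x \<boxtimes> Io (ao x))" "r x \<cdot> ri x = id x"
  using inverse_arr[OF is_iso_constraint(2)[OF assms]] r_arr[OF assms]
    inverse_arity[OF is_iso_constraint(2)[OF assms]] assms
  by (auto simp: ri_def)

lemma asi_arr [simp]:
  assumes "x \<in> Obj E" "y \<in> Obj E" "z \<in> Obj E" "ao x = ao y" "ao y = ao z"
  shows "asi x y z \<in> Arr E" "Cod E (asi x y z) = (x \<boxtimes> y) \<boxtimes> z" "Dom E (asi x y z) = x \<boxtimes> y \<boxtimes> z"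
    "ar (asi x y z) = Ide G (ao z)"
    "asi x y z \<cdot> as x y z = id ((x \<boxtimes> y) \<boxtimes> z)" "as x y z \<cdot> asi x y z = id (x \<boxtimes> y \<boxtimes> z)"
  using inverse_arr[OF is_iso_constraint(3)[OF assms]] as_arr[OF assms]
    inverse_arity[OF is_iso_constraint(3)[OF assms]] assms
  by (auto simp: asi_def)

lemma triangle:
  assumes "x \<in> Obj E" "y \<in> Obj E" "ao x = ao y"
  shows "(id x \<boxdot> l y) \<cdot> as x (Io (ao y)) y = r x \<boxdot> id y"
  using surmonoidal assms by (auto simp: surmonoidal_surcategory_def)

lemma pentagon:
  assumes "w \<in> Obj E" "x \<in> Obj E" "y \<in> Obj E" "z \<in> Obj E" "ao w = ao x" "ao x = ao y" "ao y = ao z"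
  shows "as w x (y \<boxtimes> z) \<cdot> as (w \<boxtimes> x) y z = (id w \<boxdot> as x y z) \<cdot> as w (x \<boxtimes> y) z \<cdot> (as w x y \<boxdot> id z)"
  using surmonoidal assms by (auto simp: surmonoidal_surcategory_def)

text \<open>
  Isomorphisms are cancelled through a one-sided inverse only; in the discussion of algebras the
  same rule is used for arrows that are merely split.
\<close>

lemma split_epi_cancel:
  assumes "g \<cdot> e = h \<cdot> e" "e \<cdot> e' = id x"
    "g \<in> Arr E" "h \<in> Arr E" "e \<in> Arr E" "e' \<in> Arr E"
    "Dom E g = x" "Dom E h = x" "Cod E e = x" "Cod E e' = Dom E e"
  shows "g = h"
proof -
  have "g = (g \<cdot> e) \<cdot> e'" using assms(2-) by (simp del: assms(1))
  also have "\<dots> = (h \<cdot> e) \<cdot> e'" by (simp only: assms(1))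
  also have "\<dots> = h" using assms(2-) by simp
  finally show ?thesis .
qed

lemma split_mono_cancel:
  assumes "e \<cdot> g = e \<cdot> h" "e' \<cdot> e = id x"
    "g \<in> Arr E" "h \<in> Arr E" "e \<in> Arr E" "e' \<in> Arr E"
    "Cod E g = x" "Cod E h = x" "Dom E e = x" "Dom E e' = Cod E e"
  shows "g = h"
proof -
  have "g = (e' \<cdot> e) \<cdot> g" using assms(2-) by (simp del: assoc)
  also have "\<dots> = e' \<cdot> (e \<cdot> g)" using assms(3-) by (intro assoc(1)) simp_all
  also have "\<dots> = e' \<cdot> (e \<cdot> h)" by (simp only: assms(1))
  also have "\<dots> = (e' \<cdot> e) \<cdot> h" using assms(3-) by (intro assoc(1)[symmetric]) simp_all
  also have "\<dots> = h" using assms(2-) by (simp del: assoc)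
  finally show ?thesis .
qed

text \<open>
  The interchange law in the middle of a composite nested to the right.
\<close>

lemma ten_cmp_tail:
  assumes "f \<in> Arr E" "g \<in> Arr E" "Dom E g = Cod E f"
    "f' \<in> Arr E" "g' \<in> Arr E" "Dom E g' = Cod E f'" "ar f = ar f'" "ar g = ar g'"
    "k \<in> Arr E" "Cod E k = Dom E f \<boxtimes> Dom E f'"
  shows "(g \<boxdot> g') \<cdot> (f \<boxdot> f') \<cdot> k = ((g \<cdot> f) \<boxdot> (g' \<cdot> f')) \<cdot> k"
  using assms assoc(1)[of k "f \<boxdot> f'" "g \<boxdot> g'"] by (simp add: ten_cmp)

text \<open>
  Tensoring with the unit is faithful because the unit constraint is a natural isomorphism.  This
  is how the two coherence laws for the unit that are not axioms are reached: the axioms only yield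
  them after tensoring with the unit.
\<close>

lemma unit_ten_cancel:
  assumes "Ia b \<boxdot> f = Ia b \<boxdot> g" "f \<in> Arr E" "g \<in> Arr E" "Dom E f = Dom E g" "Cod E f = Cod E g"
    "ar f = b" "ar g = b"
  shows "f = g"
proof (rule split_epi_cancel[where e = "l (Dom E f)" and e' = "li (Dom E f)" and x = "Dom E f"])
  show "f \<cdot> l (Dom E f) = g \<cdot> l (Dom E f)"
    using l_nat[of f] l_nat[of g] assms by simp
qed (use assms in auto)

lemma ten_unit_cancel:
  assumes "f \<boxdot> Ia b = g \<boxdot> Ia b" "f \<in> Arr E" "g \<in> Arr E" "Dom E f = Dom E g" "Cod E f = Cod E g"
    "ar f = b" "ar g = b"
  shows "f = g"
proof (rule split_epi_cancel[where e = "r (Dom E f)" and e' = "ri (Dom E f)" and x = "Dom E f"])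
  show "f \<cdot> r (Dom E f) = g \<cdot> r (Dom E f)"
    using r_nat[of f] r_nat[of g] assms by simp
qed (use assms in auto)

lemma l_tensor:
  assumes xy: "x \<in> Obj E" "y \<in> Obj E" "ao x = B" "ao y = B"
  shows "l (x \<boxtimes> y) \<cdot> as (Io B) x y = l x \<boxdot> id y"
proof -
  define J where "J = Io B"
  have B: "B \<in> Obj G" using xy Ar.fob_obj by auto
  have J [simp]: "J \<in> Obj E" "ao J = B" "Io B = J" "Ia (Ide G B) = id J"
    using B by (simp_all add: J_def unit_cmp)
  note xy [simp] B [simp]
  have "(id J \<boxdot> l (x \<boxtimes> y)) \<cdot> as J J (x \<boxtimes> y) \<cdot> as (J \<boxtimes> J) x y
      = ((id J \<boxdot> l (x \<boxtimes> y)) \<cdot> as J J (x \<boxtimes> y)) \<cdot> as (J \<boxtimes> J) x y" by simp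
  also have "\<dots> = (r J \<boxdot> id (x \<boxtimes> y)) \<cdot> as (J \<boxtimes> J) x y"
    using triangle[of J "x \<boxtimes> y"] by (simp del: assoc)
  also have "\<dots> = as J x y \<cdot> ((r J \<boxdot> id x) \<boxdot> id y)"
    using as_nat[of "r J" "id x" "id y"] by simp
  also have "\<dots> = as J x y \<cdot> ((id J \<boxdot> l x) \<boxdot> id y) \<cdot> (as J J x \<boxdot> id y)"
    using triangle[of J x] by (simp add: ten_cmp)
  also have "\<dots> = (as J x y \<cdot> ((id J \<boxdot> l x) \<boxdot> id y)) \<cdot> (as J J x \<boxdot> id y)" by simp
  also have "\<dots> = (id J \<boxdot> (l x \<boxdot> id y)) \<cdot> as J (J \<boxtimes> x) y \<cdot> (as J J x \<boxdot> id y)"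
    using as_nat[of "id J" "l x" "id y"] by simp
  \<comment> \<open>The pentagon for \<open>J, J, x, y\<close> turns the left-hand side into the same shape; the common tail is invertible.\<close>
  finally have "(id J \<boxdot> (l (x \<boxtimes> y) \<cdot> as J x y)) \<cdot> as J (J \<boxtimes> x) y \<cdot> (as J J x \<boxdot> id y)
    = (id J \<boxdot> (l x \<boxdot> id y)) \<cdot> as J (J \<boxtimes> x) y \<cdot> (as J J x \<boxdot> id y)"
    using pentagon[of J J x y] by (simp add: ten_cmp_tail)
  then have "id J \<boxdot> (l (x \<boxtimes> y) \<cdot> as J x y) = id J \<boxdot> (l x \<boxdot> id y)"
    by (rule split_epi_cancel[where e' = "(asi J J x \<boxdot> id y) \<cdot> asi J (J \<boxtimes> x) y" and x = "J \<boxtimes> (J \<boxtimes> x) \<boxtimes> y"])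
      (simp_all add: ten_cmp_tail)
  then show ?thesis
    using unit_ten_cancel[of "Ide G B" "l (x \<boxtimes> y) \<cdot> as J x y" "l x \<boxdot> id y"] by simp
qed

lemma r_tensor:
  assumes xy: "x \<in> Obj E" "y \<in> Obj E" "ao x = B" "ao y = B"
  shows "(id x \<boxdot> r y) \<cdot> as x y (Io B) = r (x \<boxtimes> y)"
proof -
  define J where "J = Io B"
  have B: "B \<in> Obj G" using xy Ar.fob_obj by auto
  have J [simp]: "J \<in> Obj E" "ao J = B" "Io B = J" "Ia (Ide G B) = id J"
    using B by (simp_all add: J_def unit_cmp)
  note xy [simp] B [simp]
  have "as x y J \<cdot> (r (x \<boxtimes> y) \<boxdot> id J) = as x y J \<cdot> (id (x \<boxtimes> y) \<boxdot> l J) \<cdot> as (x \<boxtimes> y) J J"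
    using triangle[of "x \<boxtimes> y" J] by simp
  also have "\<dots> = (as x y J \<cdot> ((id x \<boxdot> id y) \<boxdot> l J)) \<cdot> as (x \<boxtimes> y) J J" by simp
  also have "\<dots> = (id x \<boxdot> (id y \<boxdot> l J)) \<cdot> as x y (J \<boxtimes> J) \<cdot> as (x \<boxtimes> y) J J"
    using as_nat[of "id x" "id y" "l J"] by simp
  also have "\<dots> = (id x \<boxdot> ((id y \<boxdot> l J) \<cdot> as y J J)) \<cdot> as x (y \<boxtimes> J) J \<cdot> (as x y J \<boxdot> id J)"
    using pentagon[of x y J J] by (simp add: ten_cmp_tail)
  also have "\<dots> = ((id x \<boxdot> (r y \<boxdot> id J)) \<cdot> as x (y \<boxtimes> J) J) \<cdot> (as x y J \<boxdot> id J)"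
    using triangle[of y J] by simp
  also have "\<dots> = as x y J \<cdot> (((id x \<boxdot> r y) \<cdot> as x y J) \<boxdot> id J)"
    using as_nat[of "id x" "r y" "id J", symmetric] by (simp add: ten_cmp)
  finally have "r (x \<boxtimes> y) \<boxdot> id J = ((id x \<boxdot> r y) \<cdot> as x y J) \<boxdot> id J"
    by (rule split_mono_cancel[where e' = "asi x y J" and x = "(x \<boxtimes> y) \<boxtimes> J"]) simp_all
  then show ?thesis
    using ten_unit_cancel[of "r (x \<boxtimes> y)" "Ide G B" "(id x \<boxdot> r y) \<cdot> as x y J"] by simp
qed

end


section \<open>Colimits of chains and coequalizers that are stable under tensoring\<close>

text \<open>
  Colimits of diagrams on the ordered set of natural numbers depend only on the objects and the
  successive transition arrows of the diagram, and are handled in this form.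
\<close>

definition is_seq_colimit ::
  "('o, 'a, 'z) cat_scheme \<Rightarrow> (nat \<Rightarrow> 'o) \<Rightarrow> (nat \<Rightarrow> 'a) \<Rightarrow> 'o \<Rightarrow> (nat \<Rightarrow> 'a) \<Rightarrow> bool" where
  "is_seq_colimit K X c Z \<kappa> \<longleftrightarrow> Z \<in> Obj K \<and> (\<forall>n. \<kappa> n \<in> hom K (X n) Z) \<and>
     (\<forall>n. \<kappa> (Suc n) \<cdot>\<^bsub>K\<^esub> c n = \<kappa> n) \<and>
     (\<forall>W h. W \<in> Obj K \<and> (\<forall>n. h n \<in> hom K (X n) W) \<and> (\<forall>n. h (Suc n) \<cdot>\<^bsub>K\<^esub> c n = h n) \<longrightarrow>
        (\<exists>!k. k \<in> hom K Z W \<and> (\<forall>n. k \<cdot>\<^bsub>K\<^esub> \<kappa> n = h n)))"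

lemma nat_cocone_iff:
  assumes D: "is_functor nat_cat K D"
  shows "is_cocone nat_cat K D Z \<kappa> \<longleftrightarrow> Z \<in> Obj K \<and> (\<forall>n. \<kappa> n \<in> hom K (Fob D n) Z) \<and>
    (\<forall>n. \<kappa> (Suc n) \<cdot>\<^bsub>K\<^esub> Far D (n, Suc n) = \<kappa> n)"
proof -
  interpret D: is_functor nat_cat K D by (rule D)
  have far: "Far D (m, n) \<in> hom K (Fob D m) (Fob D n)" if "m \<le> n" for m n
    using D.far_hom[of "(m, n)" m n] that by (simp add: nat_cat_def hom_def)
  have "\<kappa> n \<cdot>\<^bsub>K\<^esub> Far D (m, n) = \<kappa> m"
    if \<kappa>: "\<And>n. \<kappa> n \<in> hom K (Fob D n) Z" "\<And>n. \<kappa> (Suc n) \<cdot>\<^bsub>K\<^esub> Far D (n, Suc n) = \<kappa> n"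
      and "m \<le> n" for m n
    using \<open>m \<le> n\<close>
  proof (induction n rule: dec_induct)
    case base
    have "Far D (m, m) = Ide K (Fob D m)" using D.far_ide[of m] by (simp add: nat_cat_def)
    then show ?case using D.D.cmp_ide_right[OF \<kappa>(1)] by simp
  next
    case (step n)
    have "Far D (m, Suc n) = Far D (n, Suc n) \<cdot>\<^bsub>K\<^esub> Far D (m, n)"
      using D.far_cmp[of "(m, n)" m n "(n, Suc n)" "Suc n"] step(1) by (simp add: nat_cat_def hom_def)
    then show ?case
      using D.D.cmp_assoc[OF far[OF step(1)] far[of n "Suc n"] \<kappa>(1)] \<kappa>(2) step by simp
  qed
  then show ?thesis
    using D by (auto simp: is_cocone_def nat_cat_def)
qed

lemma nat_colimit_iff:
  assumes D: "is_functor nat_cat K D"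
  shows "is_colimit nat_cat K D Z \<kappa> \<longleftrightarrow>
    is_seq_colimit K (Fob D) (\<lambda>n. Far D (n, Suc n)) Z \<kappa>"
  unfolding is_colimit_def is_seq_colimit_def nat_cocone_iff[OF D] by (simp add: nat_cat_def)

primrec chain_composite :: "('o, 'a, 'z) cat_scheme \<Rightarrow> (nat \<Rightarrow> 'o) \<Rightarrow> (nat \<Rightarrow> 'a) \<Rightarrow> nat \<Rightarrow> nat \<Rightarrow> 'a" where
  "chain_composite K X c m 0 = Ide K (X m)"
| "chain_composite K X c m (Suc k) = c (m + k) \<cdot>\<^bsub>K\<^esub> chain_composite K X c m k"

text \<open>
  A sequence of composable arrows extends to a functor by composing along intervals; this is what
  allows the assumptions on functors to be applied to chains that are built step by step.
\<close>

lemma nat_functor_of_sequence: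
  assumes K: "category K" and X: "\<And>n. X n \<in> Obj K" and c: "\<And>n. c n \<in> hom K (X n) (X (Suc n))"
  shows "\<exists>D. is_functor nat_cat K D \<and> Fob D = X \<and> (\<lambda>n. Far D (n, Suc n)) = c"
proof -
  interpret K: category K by (rule K)
  let ?p = "chain_composite K X c"
  have hom: "?p m k \<in> hom K (X m) (X (m + k))" for m k
    by (induction k) (auto intro: K.ide_hom X K.cmp_hom c)
  have add: "?p m (j + k) = ?p (m + j) k \<cdot>\<^bsub>K\<^esub> ?p m j" for m j k
  proof (induction k)
    case 0
    show ?case using K.cmp_ide_left[OF hom] by simp
  next
    case (Suc k)
    then show ?case
      using K.cmp_assoc[OF hom[of m j] hom[of "m + j" k] c[of "m + j + k"]] by (simp add: add.assoc)
  qed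
  define D where "D = \<lparr>Fob = X, Far = (\<lambda>(m, n). ?p m (n - m))\<rparr>"
  have "category nat_cat"
    by unfold_locales (auto simp: nat_cat_def hom_def)
  then have "is_functor nat_cat K D"
  proof (intro is_functor.intro is_functor_axioms.intro K)
    show "Far D (g \<cdot>\<^bsub>nat_cat\<^esub> f) = Far D g \<cdot>\<^bsub>K\<^esub> Far D f"
      if "f \<in> hom nat_cat x y" "g \<in> hom nat_cat y z" for f g x y z
      using that add[of x "y - x" "z - y"] by (auto simp: nat_cat_def hom_def D_def)
    show "Far D f \<in> hom K (Fob D x) (Fob D y)" if "f \<in> hom nat_cat x y" for f x y
      using that hom[of x "y - x"] by (auto simp: nat_cat_def hom_def D_def)
  qed (auto simp: nat_cat_def D_def X)
  moreover have "(\<lambda>n. Far D (n, Suc n)) = c"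
    using K.cmp_ide_right[OF c] by (simp add: D_def)
  ultimately show ?thesis by (auto simp: D_def)
qed

lemma has_seq_colimit:
  assumes "has_colimits nat_cat K" "category K"
    "\<And>n. X n \<in> Obj K" "\<And>n. c n \<in> hom K (X n) (X (Suc n))"
  shows "\<exists>Z \<kappa>. is_seq_colimit K X c Z \<kappa>"
  using nat_functor_of_sequence[of K X c] assms nat_colimit_iff[of K]
  unfolding has_colimits_def by metis

lemma preserves_seq_colimit:
  assumes F: "preserves_colimits nat_cat K K' F" and "category K"
    "\<And>n. X n \<in> Obj K" "\<And>n. c n \<in> hom K (X n) (X (Suc n))"
    and Z: "is_seq_colimit K X c Z \<kappa>"
  shows "is_seq_colimit K' (\<lambda>n. Fob F (X n)) (\<lambda>n. Far F (c n)) (Fob F Z) (\<lambda>n. Far F (\<kappa> n))"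
proof -
  obtain D where D: "is_functor nat_cat K D" "Fob D = X" "(\<lambda>n. Far D (n, Suc n)) = c"
    using nat_functor_of_sequence[of K X c] assms by metis
  have col: "is_colimit nat_cat K' (F \<circ>\<^sub>F D) (Fob F Z) (\<lambda>n. Far F (\<kappa> n))"
    using F Z D nat_colimit_iff[OF D(1)] by (simp add: preserves_colimits_def)
  then have "is_functor nat_cat K' (F \<circ>\<^sub>F D)"
    by (simp add: is_colimit_def is_cocone_def)
  from nat_colimit_iff[OF this] col
  have "is_seq_colimit K' (Fob (F \<circ>\<^sub>F D)) (\<lambda>n. Far (F \<circ>\<^sub>F D) (n, Suc n)) (Fob F Z) (\<lambda>n. Far F (\<kappa> n))"
    by (rule iffD1)
  then show ?thesis using D(2,3) by (auto simp: comp_ftor_def fun_eq_iff)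
qed

lemma seq_colimit_factor:
  assumes "is_seq_colimit K X c Z \<kappa>" "W \<in> Obj K"
    "\<And>n. h n \<in> Arr K" "\<And>n. Dom K (h n) = X n" "\<And>n. Cod K (h n) = W"
    "\<And>n. h (Suc n) \<cdot>\<^bsub>K\<^esub> c n = h n"
  obtains k where "k \<in> Arr K" "Dom K k = Z" "Cod K k = W" "\<And>n. k \<cdot>\<^bsub>K\<^esub> \<kappa> n = h n"
proof -
  have "\<exists>!k. k \<in> hom K Z W \<and> (\<forall>n. k \<cdot>\<^bsub>K\<^esub> \<kappa> n = h n)"
    using assms unfolding is_seq_colimit_def by (simp add: hom_def)
  then show thesis using that by (auto simp: hom_def)
qed

lemma (in category) seq_colimit_epi:
  assumes Z: "is_seq_colimit C X c Z \<kappa>" and c: "\<And>n. c n \<in> hom C (X n) (X (Suc n))"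
    and f: "f \<in> Arr C" "Dom C f = Z" and g: "g \<in> Arr C" "Dom C g = Z"
    and eq: "\<And>n. f \<cdot> \<kappa> n = g \<cdot> \<kappa> n"
  shows "f = g"
proof -
  have \<kappa>: "\<kappa> n \<in> hom C (X n) Z" "\<kappa> (Suc n) \<cdot> c n = \<kappa> n" for n
    using Z by (auto simp: is_seq_colimit_def)
  have cod: "Cod C g = Cod C f"
    using eq[of 0] \<kappa>(1)[of 0] cmp_arr(3)[of "\<kappa> 0" f] cmp_arr(3)[of "\<kappa> 0" g] f g by (simp add: hom_def)
  have hom: "f \<in> hom C Z (Cod C f)" "g \<in> hom C Z (Cod C f)" using f g cod by (auto simp: hom_def)
  have "(f \<cdot> \<kappa> (Suc n)) \<cdot> c n = f \<cdot> \<kappa> n" for n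
    using cmp_assoc[OF c \<kappa>(1) hom(1)] \<kappa>(2) by simp
  then have "\<exists>!k. k \<in> hom C Z (Cod C f) \<and> (\<forall>n. k \<cdot> \<kappa> n = f \<cdot> \<kappa> n)"
    using Z \<kappa> hom(1) cod_obj[OF f(1)] cmp_hom[OF \<kappa>(1) hom(1)] unfolding is_seq_colimit_def by auto
  then show ?thesis using hom eq by metis
qed

lemma coequalizer_factor:
  assumes "is_coequalizer K f g q" "h \<in> Arr K" "Dom K h = Cod K f" "h \<cdot>\<^bsub>K\<^esub> f = h \<cdot>\<^bsub>K\<^esub> g"
  obtains k where "k \<in> Arr K" "Dom K k = Cod K q" "Cod K k = Cod K h" "k \<cdot>\<^bsub>K\<^esub> q = h"
proof -
  have "cofork K f g h" using assms by (auto simp: is_coequalizer_def cofork_def hom_def)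
  then have "\<exists>!k. k \<in> hom K (Cod K q) (Cod K h) \<and> k \<cdot>\<^bsub>K\<^esub> q = h"
    using assms(1) by (simp add: is_coequalizer_def)
  then show thesis using that by (auto simp: hom_def)
qed

lemma (in category) coequalizer_epi:
  assumes q: "is_coequalizer C f g q"
    and h: "h \<in> Arr C" "Dom C h = Cod C q" and k: "k \<in> Arr C" "Dom C k = Cod C q"
    and eq: "h \<cdot> q = k \<cdot> q"
  shows "h = k"
proof -
  have f: "f \<in> Arr C" "g \<in> Arr C" "Dom C f = Dom C g" "Cod C f = Cod C g" "q \<in> Arr C"
    "Dom C q = Cod C g" "q \<cdot> f = q \<cdot> g"
    using q by (auto simp: is_coequalizer_def cofork_def hom_def)
  have cod: "Cod C (h \<cdot> q) = Cod C h" "Cod C (k \<cdot> q) = Cod C k" "h \<cdot> q \<in> Arr C" "Dom C (h \<cdot> q) = Cod C g"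
    using cmp_arr f h k by auto
  have "(h \<cdot> q) \<cdot> f = (h \<cdot> q) \<cdot> g"
    using assoc_law[of f q h] assoc_law[of g q h] f h by simp
  then have "cofork C f g (h \<cdot> q)"
    using f cod by (auto simp: cofork_def hom_def)
  then have "\<exists>!j. j \<in> hom C (Cod C q) (Cod C (h \<cdot> q)) \<and> j \<cdot> q = h \<cdot> q"
    using q by (simp add: is_coequalizer_def)
  then show ?thesis using h k cod eq by (auto simp: hom_def)
qed

lemma fiber_sel [simp]:
  "Obj (fiber G E B) = {x \<in> Obj E. Fob (Arity E) x = B}"
  "Arr (fiber G E B) = {f \<in> Arr E. Far (Arity E) f = Ide G B}"
  "Dom (fiber G E B) = Dom E" "Cod (fiber G E B) = Cod E"
  "Ide (fiber G E B) = Ide E" "Cmp (fiber G E B) = Cmp E"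
  by (simp_all add: fiber_def)

lemma fiber_moncat_sel [simp]:
  "Obj (fiber_moncat G E B) = {x \<in> Obj E. Fob (Arity E) x = B}"
  "Arr (fiber_moncat G E B) = {f \<in> Arr E. Far (Arity E) f = Ide G B}"
  "Dom (fiber_moncat G E B) = Dom E" "Cod (fiber_moncat G E B) = Cod E"
  "Ide (fiber_moncat G E B) = Ide E" "Cmp (fiber_moncat G E B) = Cmp E"
  "tensor (fiber_moncat G E B) = Tensor E" "unity (fiber_moncat G E B) = Fob (Unit E) B"
  "lunit (fiber_moncat G E B) = ul E" "runit (fiber_moncat G E B) = ur E"
  "assctr (fiber_moncat G E B) = aso E"
  by (simp_all add: fiber_moncat_def fiber_def cat.defs moncat.defs)

lemma fiber_moncat_hom: "hom (fiber_moncat G E B) = hom (fiber G E B)"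
  by (intro ext) (simp add: hom_def)

lemma fiber_moncat_colimits:
  "is_coequalizer (fiber_moncat G E B) = is_coequalizer (fiber G E B)"
  "is_seq_colimit (fiber_moncat G E B) = is_seq_colimit (fiber G E B)"
  by (intro ext, simp add: is_coequalizer_def cofork_def is_seq_colimit_def hom_def)+

locale liberal = surmonoidal +
  assumes liberal: "liberal_surmonoidal G E"
begin

context
  fixes B
  assumes B: "B \<in> Obj G"
begin

abbreviation "Fib \<equiv> fiber_moncat G E B"

lemma fiber_liberal:
  "category Fib" "has_colimits nat_cat Fib" "has_coequalizers Fib"
  "Y \<in> Obj Fib \<Longrightarrow> preserves_colimits nat_cat Fib Fib (tensor_with_right Fib Y)"
  "Y \<in> Obj Fib \<Longrightarrow> preserves_colimits nat_cat Fib Fib (tensor_with_left Fib Y)"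
  "Y \<in> Obj Fib \<Longrightarrow> preserves_coequalizers Fib Fib (tensor_with_right Fib Y)"
  "preserves_coequalizers (fiber G E B) E id_ftor"
  "preserves_colimits nat_cat (fiber G E B) E id_ftor"
  using liberal B
  by (auto simp: liberal_surmonoidal_def liberal_monoidal_def monoidal_category_def)

lemma fiber_category: "category (fiber G E B)"
  using fiber_liberal(1) by (simp add: category_def hom_def)

text \<open>
  Tensoring on the right stays inside the fiber and preserves its coequalizers, and the inclusion of
  the fiber preserves them as well.  So a coequalizer of the fiber remains one among arrows of
  arbitrary arity, even after tensoring.
\<close>

lemma stable_coequalizer:
  assumes "f \<in> Arr E" "g \<in> Arr E" "Dom E f = Dom E g" "Cod E f = Cod E g"
    "ar f = Ide G B" "ar g = Ide G B"
  shows "\<exists>q. q \<in> Arr E \<and> Dom E q = Cod E g \<and> ar q = Ide G B \<and> q \<cdot> f = q \<cdot> g \<and>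
    (\<forall>Y \<in> Obj E. ao Y = B \<longrightarrow> is_coequalizer E (f \<boxdot> id Y) (g \<boxdot> id Y) (q \<boxdot> id Y))"
proof -
  have "\<exists>q. is_coequalizer Fib f g q"
    using fiber_liberal(3) assms by (auto simp: has_coequalizers_def hom_def)
  then obtain q where q: "is_coequalizer Fib f g q" ..
  have "is_coequalizer E (f \<boxdot> id Y) (g \<boxdot> id Y) (q \<boxdot> id Y)" if "Y \<in> Obj E" "ao Y = B" for Y
  proof -
    have "is_coequalizer Fib (f \<boxdot> id Y) (g \<boxdot> id Y) (q \<boxdot> id Y)"
      using fiber_liberal(6)[of Y] that q by (simp add: preserves_coequalizers_def tensor_with_right_def)
    then show ?thesis using fiber_liberal(7)
      by (simp add: preserves_coequalizers_def fiber_moncat_colimits id_ftor_def)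
  qed
  moreover have "q \<in> Arr E \<and> Dom E q = Cod E g \<and> ar q = Ide G B \<and> q \<cdot> f = q \<cdot> g"
    using q by (auto simp: is_coequalizer_def cofork_def hom_def)
  ultimately show ?thesis by blast
qed

text \<open>
  The analogue for chains.  The versions tensored on the left and on both sides make two arrows out
  of \<open>W \<otimes> Z\<close> or \<open>(W \<otimes> Z) \<otimes> Y\<close> equal as soon as they agree on the stages of the chain.
\<close>

lemma stable_colimit:
  assumes X: "\<And>n. X n \<in> Obj E" "\<And>n. ao (X n) = B"
    and c: "\<And>n. c n \<in> Arr E" "\<And>n. Dom E (c n) = X n" "\<And>n. Cod E (c n) = X (Suc n)"
      "\<And>n. ar (c n) = Ide G B"
  shows "\<exists>Z \<kappa>. Z \<in> Obj E \<and> ao Z = B \<and>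
    (\<forall>n. \<kappa> n \<in> Arr E \<and> Dom E (\<kappa> n) = X n \<and> Cod E (\<kappa> n) = Z \<and> ar (\<kappa> n) = Ide G B \<and>
      \<kappa> (Suc n) \<cdot> c n = \<kappa> n) \<and>
    is_seq_colimit E X c Z \<kappa> \<and>
    (\<forall>W \<in> Obj E. ao W = B \<longrightarrow>
      is_seq_colimit E (\<lambda>n. W \<boxtimes> X n) (\<lambda>n. id W \<boxdot> c n) (W \<boxtimes> Z) (\<lambda>n. id W \<boxdot> \<kappa> n)) \<and>
    (\<forall>Y \<in> Obj E. ao Y = B \<longrightarrow>
      is_seq_colimit E (\<lambda>n. X n \<boxtimes> Y) (\<lambda>n. c n \<boxdot> id Y) (Z \<boxtimes> Y) (\<lambda>n. \<kappa> n \<boxdot> id Y)) \<and>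
    (\<forall>W \<in> Obj E. \<forall>Y \<in> Obj E. ao W = B \<longrightarrow> ao Y = B \<longrightarrow>
      is_seq_colimit E (\<lambda>n. (W \<boxtimes> X n) \<boxtimes> Y) (\<lambda>n. (id W \<boxdot> c n) \<boxdot> id Y)
        ((W \<boxtimes> Z) \<boxtimes> Y) (\<lambda>n. (id W \<boxdot> \<kappa> n) \<boxdot> id Y))"
proof -
  have XF: "X n \<in> Obj Fib" and cF: "c n \<in> hom Fib (X n) (X (Suc n))" for n
    using X c by (auto simp: hom_def)
  obtain Z \<kappa> where Z: "is_seq_colimit Fib X c Z \<kappa>"
    using has_seq_colimit[OF fiber_liberal(2,1), of X c] XF cF by metis
  have into: "is_seq_colimit E X' c' Z' \<kappa>'"
    if "is_seq_colimit Fib X' c' Z' \<kappa>'" "\<And>n. X' n \<in> Obj Fib" "\<And>n. c' n \<in> hom Fib (X' n) (X' (Suc n))"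
    for X' c' Z' \<kappa>'
    using preserves_seq_colimit[OF fiber_liberal(8) fiber_category, of X' c' Z' \<kappa>']
      that[unfolded fiber_moncat_colimits fiber_moncat_hom]
    by (simp add: id_ftor_def)
  have left: "is_seq_colimit Fib (\<lambda>n. W \<boxtimes> X n) (\<lambda>n. id W \<boxdot> c n) (W \<boxtimes> Z) (\<lambda>n. id W \<boxdot> \<kappa> n)"
    "\<And>n. W \<boxtimes> X n \<in> Obj Fib" "\<And>n. id W \<boxdot> c n \<in> hom Fib (W \<boxtimes> X n) (W \<boxtimes> X (Suc n))"
    if "W \<in> Obj E" "ao W = B" for W
    using preserves_seq_colimit[OF fiber_liberal(5)[of W] fiber_liberal(1) XF cF Z] that X c
    by (auto simp: tensor_with_left_def hom_def)
  have right: "is_seq_colimit Fib (\<lambda>n. X' n \<boxtimes> Y) (\<lambda>n. c' n \<boxdot> id Y) (Z' \<boxtimes> Y) (\<lambda>n. \<kappa>' n \<boxdot> id Y)"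
    "\<And>n. X' n \<boxtimes> Y \<in> Obj Fib" "\<And>n. c' n \<boxdot> id Y \<in> hom Fib (X' n \<boxtimes> Y) (X' (Suc n) \<boxtimes> Y)"
    if "is_seq_colimit Fib X' c' Z' \<kappa>'" "\<And>n. X' n \<in> Obj Fib" "\<And>n. c' n \<in> hom Fib (X' n) (X' (Suc n))"
      "Y \<in> Obj E" "ao Y = B" for X' c' Z' \<kappa>' Y
    using preserves_seq_colimit[OF fiber_liberal(4)[of Y] fiber_liberal(1) that(2,3,1)] that(2-)
    by (auto simp: tensor_with_right_def hom_def)
  have \<kappa>: "Z \<in> Obj E" "ao Z = B" "\<kappa> n \<in> Arr E" "Dom E (\<kappa> n) = X n" "Cod E (\<kappa> n) = Z"
    "ar (\<kappa> n) = Ide G B" "\<kappa> (Suc n) \<cdot> c n = \<kappa> n" for n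
    using Z by (simp_all add: is_seq_colimit_def hom_def)
  show ?thesis
    by (intro exI[of _ Z] exI[of _ \<kappa>] conjI allI ballI impI \<kappa> into[OF Z XF cF] into[OF left]
      into[OF right[OF Z XF cF]] into[OF right[OF left]])
qed

end
end


section \<open>Pointed actions\<close>

locale initial_unit = liberal +
  assumes unit_initial: "B \<in> Obj G \<Longrightarrow> is_initial (fiber G E B) (Fob (Unit E) B)"
    and unit_arrow_initial: "b \<in> Arr G \<Longrightarrow> is_initial (arrow_fiber G E b) (Far (Unit E) b)"
begin

text \<open>
  The point through which every object becomes a pointed object of its fiber.
\<close>

definition u where "u x = (THE f. f \<in> hom (fiber G E (ao x)) (Io (ao x)) x)"

lemma u_ex1: "x \<in> Obj E \<Longrightarrow> \<exists>!f. f \<in> hom (fiber G E (ao x)) (Io (ao x)) x"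
  using unit_initial[of "ao x"] by (simp add: is_initial_def)

lemma u_arr [simp]:
  assumes "x \<in> Obj E"
  shows "u x \<in> Arr E" "Dom E (u x) = Io (ao x)" "Cod E (u x) = x" "ar (u x) = Ide G (ao x)"
  using theI'[OF u_ex1[OF assms]] unfolding u_def[symmetric] by (auto simp: hom_def)

lemma u_unique:
  assumes "f \<in> Arr E" "Dom E f = Io B" "Cod E f = x" "ar f = Ide G B" "ao x = B"
  shows "f = u x"
proof -
  have x: "x \<in> Obj E" using assms by auto
  have "f \<in> hom (fiber G E (ao x)) (Io (ao x)) x" "u x \<in> hom (fiber G E (ao x)) (Io (ao x)) x"
    using assms x by (simp_all add: hom_def)
  then show ?thesis using u_ex1[OF x] by blast
qed

text \<open>
  Arrows of arbitrary arity preserve points.  Initiality in the fibers of objects gives this only for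
  arrows with identity arity; the initiality of \<open>I b\<close> in the fiber of \<open>b\<close> supplies the general case.
\<close>

lemma u_nat:
  assumes f: "f \<in> Arr E" "Dom E f = x" "Cod E f = y"
  shows "f \<cdot> u x = u y \<cdot> Ia (ar f)"
proof -
  define b where "b = ar f"
  have b: "b \<in> Arr G" "Dom G b = ao x" "Cod G b = ao y" using f by (auto simp: b_def)
  have "f \<in> Obj (arrow_fiber G E b)" using f by (simp add: arrow_fiber_def b_def)
  then obtain s where "s \<in> hom (arrow_fiber G E b) (Ia b) f"
    using unit_arrow_initial[OF b(1)] unfolding is_initial_def by blast
  then obtain p q where pq: "p \<in> Arr E" "Dom E p = Io (ao x)" "Cod E p = x" "ar p = Ide G (ao x)"
    "q \<in> Arr E" "Dom E q = Io (ao y)" "Cod E q = y" "ar q = Ide G (ao y)" "q \<cdot> Ia b = f \<cdot> p"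
    using b f by (auto simp: hom_def arrow_fiber_def)
  \<comment> \<open>The initial morphism \<open>I b \<rightarrow> f\<close> is a pair of arrows out of units, hence the pair of points.\<close>
  have "p = u x" "q = u y" using u_unique[of p] u_unique[of q] pq by auto
  then show ?thesis using pq(9) by (simp add: b_def)
qed

lemma l_unit_eq_r_unit:
  assumes B: "B \<in> Obj G"
  shows "l (Io B) = r (Io B)"
proof -
  \<comment> \<open>Both composites with the inverse of \<open>r\<close> are endomorphisms of the initial object \<open>I B\<close>.\<close>
  have "l (Io B) \<cdot> ri (Io B) = id (Io B)"
    using B u_unique[of "l (Io B) \<cdot> ri (Io B)" B "Io B"] u_unique[of "id (Io B)" B "Io B"] by simp
  also have "\<dots> = r (Io B) \<cdot> ri (Io B)" using B by simp
  finally show ?thesis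
    by (rule split_epi_cancel[where e' = "r (Io B)" and x = "Io B \<boxtimes> Io B"]) (use B in simp_all)
qed

lemma li_nat:
  assumes f: "f \<in> Arr E" "Dom E f = x" "Cod E f = y"
  shows "(Ia (ar f) \<boxdot> f) \<cdot> li x = li y \<cdot> f"
proof -
  have x: "x \<in> Obj E" "y \<in> Obj E" using f by auto
  have "l y \<cdot> ((Ia (ar f) \<boxdot> f) \<cdot> li x) = (l y \<cdot> (Ia (ar f) \<boxdot> f)) \<cdot> li x"
    using f x by simp
  also have "\<dots> = l y \<cdot> (li y \<cdot> f)"
    using l_nat[OF f(1)] f x assoc(1)[of f "li y" "l y"] by simp
  finally show ?thesis
    by (rule split_mono_cancel[where e' = "li y" and x = "Io (ao y) \<boxtimes> y"]) (use f x in simp_all)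
qed

text \<open>
  The arrow \<open>P \<cong> I \<otimes> P \<rightarrow> X \<otimes> P\<close> that inserts the point of \<open>X\<close> on the left.
\<close>

definition pt where "pt X P = (u X \<boxdot> id P) \<cdot> li P"

lemma pt_arr [simp]:
  assumes "X \<in> Obj E" "P \<in> Obj E" "ao P = ao X"
  shows "pt X P \<in> Arr E" "Dom E (pt X P) = P" "Cod E (pt X P) = X \<boxtimes> P" "ar (pt X P) = Ide G (ao X)"
  using assms by (simp_all add: pt_def)

lemma pt_nat:
  assumes "\<phi> \<in> Arr E" "Dom E \<phi> = X" "Cod E \<phi> = X'" "f \<in> Arr E" "Dom E f = P" "Cod E f = Q" "ar \<phi> = ar f"
  shows "(\<phi> \<boxdot> f) \<cdot> pt X P = pt X' Q \<cdot> f"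
proof -
  have [simp]: "X \<in> Obj E" "X' \<in> Obj E" "P \<in> Obj E" "Q \<in> Obj E" "ao P = ao X" "ao Q = ao X'"
    using assms Ar.far_arr(2,3)[of \<phi>] Ar.far_arr(2,3)[of f] by auto
  have "(\<phi> \<boxdot> f) \<cdot> pt X P = ((\<phi> \<cdot> u X) \<boxdot> f) \<cdot> li P"
    using assms by (simp add: pt_def ten_cmp_tail)
  also have "\<dots> = ((u X' \<cdot> Ia (ar f)) \<boxdot> f) \<cdot> li P"
    using u_nat[of \<phi> X X'] assms by simp
  also have "\<dots> = (u X' \<boxdot> id Q) \<cdot> ((Ia (ar f) \<boxdot> f) \<cdot> li P)"
    using assms by (simp add: ten_cmp_tail)
  also have "\<dots> = pt X' Q \<cdot> f"
    using li_nat[of f P Q] assms by (simp add: pt_def)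
  finally show ?thesis .
qed

text \<open>
  Inserting a point at the far left does not interact with a factor on the right.  This rests on the
  derived coherence law for \<open>l\<close>.
\<close>

lemma pt_tensor:
  assumes [simp]: "X \<in> Obj E" "P \<in> Obj E" "Y \<in> Obj E" "ao P = ao X" "ao Y = ao X"
  shows "as X P Y \<cdot> (pt X P \<boxdot> id Y) = pt X (P \<boxtimes> Y)"
proof -
  let ?I = "Io (ao X)"
  have "l (P \<boxtimes> Y) \<cdot> (as ?I P Y \<cdot> (li P \<boxdot> id Y)) = (l (P \<boxtimes> Y) \<cdot> as ?I P Y) \<cdot> (li P \<boxdot> id Y)"
    by simp
  also have "\<dots> = l (P \<boxtimes> Y) \<cdot> li (P \<boxtimes> Y)"
    using l_tensor[of P Y "ao X"] by (simp add: ten_cmp)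
  finally have li: "as ?I P Y \<cdot> (li P \<boxdot> id Y) = li (P \<boxtimes> Y)"
    by (rule split_mono_cancel[where e' = "li (P \<boxtimes> Y)" and x = "?I \<boxtimes> P \<boxtimes> Y"]) simp_all
  have "as X P Y \<cdot> (pt X P \<boxdot> id Y) = (as X P Y \<cdot> ((u X \<boxdot> id P) \<boxdot> id Y)) \<cdot> (li P \<boxdot> id Y)"
    by (simp add: pt_def ten_cmp)
  also have "\<dots> = (u X \<boxdot> id (P \<boxtimes> Y)) \<cdot> (as ?I P Y \<cdot> (li P \<boxdot> id Y))"
    using as_nat[of "u X" "id P" "id Y"] by simp
  finally show ?thesis by (simp add: li pt_def)
qed

text \<open>
  Actions \<open>a : X \<otimes> A \<rightarrow> A\<close> of the pointed object \<open>X\<close>: no associativity is imposed, only that the point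
  acts as the identity.
\<close>

definition action where
  "action X A a \<longleftrightarrow> X \<in> Obj E \<and> A \<in> Obj E \<and> ao A = ao X \<and> a \<in> Arr E \<and> Dom E a = X \<boxtimes> A \<and>
     Cod E a = A \<and> ar a = Ide G (ao X) \<and> a \<cdot> pt X A = id A"

text \<open>
  The identity behind all compatibility checks for the chain: acting along \<open>\<phi>\<close> on a freshly inserted
  point changes nothing, whatever the arity of \<open>\<phi>\<close>.
\<close>

lemma action_pt:
  assumes a: "action X' A a" and "\<phi> \<in> Arr E" "Dom E \<phi> = X" "Cod E \<phi> = X'"
    "f \<in> Arr E" "Dom E f = P" "Cod E f = A" "ar \<phi> = ar f"
  shows "a \<cdot> (\<phi> \<boxdot> f) \<cdot> pt X P = f"
proof -
  have [simp]: "X \<in> Obj E" "X' \<in> Obj E" "P \<in> Obj E" "A \<in> Obj E" "ao P = ao X"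
    using assms Ar.far_arr(2,3)[of \<phi>] Ar.far_arr(2,3)[of f] by (auto simp: action_def)
  have "a \<cdot> (\<phi> \<boxdot> f) \<cdot> pt X P = a \<cdot> pt X' A \<cdot> f"
    using assms pt_nat[of \<phi> X X' f P A] by simp
  also have "\<dots> = (a \<cdot> pt X' A) \<cdot> f"
    using assms by (intro assoc(1)[symmetric]) (simp_all add: action_def)
  also have "\<dots> = f" using assms by (simp add: action_def)
  finally show ?thesis .
qed

lemma as_nat_right:
  assumes "\<phi> \<in> Arr E" "Dom E \<phi> = X" "Cod E \<phi> = X'" "f \<in> Arr E" "Dom E f = Q \<boxtimes> Y"
    "ar \<phi> = ar f" "c \<in> Arr E" "Dom E c = P" "Cod E c = Q" "ar c = Ide G (ao X)" 
    "X \<in> Obj E" "Y \<in> Obj E" "P \<in> Obj E" "Q \<in> Obj E" "ao P = ao X" "ao Q = ao X" "ao Y = ao X"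
  shows "(\<phi> \<boxdot> f) \<cdot> as X Q Y \<cdot> ((id X \<boxdot> c) \<boxdot> id Y) = (\<phi> \<boxdot> (f \<cdot> (c \<boxdot> id Y))) \<cdot> as X P Y"
  using assms as_nat[of "id X" c "id Y"] by (simp add: ten_cmp_tail)

text \<open>
  The universal property says that \<open>C \<otimes> Y\<close> is the free pointed action on \<open>Y\<close>, for all \<open>Y\<close> at once and
  also along changes \<open>\<phi>\<close> of the acting object.  The generality in \<open>Y\<close> is what later makes \<open>C\<close> a monoid
  (\<open>Y = C\<close> and \<open>Y = C \<otimes> C\<close>), the generality in \<open>\<phi>\<close> is what makes this monoid free over every arity.
\<close>

definition free_action where
  "free_action X C \<alpha> \<longleftrightarrow> action X C \<alpha> \<and>
    (\<forall>Y X' A a \<phi> g. Y \<in> Obj E \<longrightarrow> ao Y = ao X \<longrightarrow> action X' A a \<longrightarrow>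
       \<phi> \<in> Arr E \<longrightarrow> Dom E \<phi> = X \<longrightarrow> Cod E \<phi> = X' \<longrightarrow>
       g \<in> Arr E \<longrightarrow> Dom E g = Y \<longrightarrow> Cod E g = A \<longrightarrow> ar g = ar \<phi> \<longrightarrow>
       (\<exists>!f. f \<in> Arr E \<and> Dom E f = C \<boxtimes> Y \<and> Cod E f = A \<and> ar f = ar \<phi> \<and>
          f \<cdot> (u C \<boxdot> id Y) = g \<cdot> l Y \<and> f \<cdot> (\<alpha> \<boxdot> id Y) = a \<cdot> (\<phi> \<boxdot> f) \<cdot> as X C Y))"

end

section \<open>The free pointed action as the colimit of a chain\<close>

text \<open>
  The stage \<open>P n\<close> plays the role of the words of length at most \<open>n\<close> in \<open>X\<close>, with the point as a neutral letter,
  and \<open>x n : X \<otimes> P n \<rightarrow> P (n + 1)\<close> puts a letter in front of a word.  The coequalizer identifies the words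
  obtained by inserting the point after the first letter and in front of it.
\<close>

locale action_chain = initial_unit +
  fixes X P x
  assumes X [simp]: "X \<in> Obj E"
    and P [simp]: "P n \<in> Obj E" "ao (P n) = ao X"
    and x [simp]: "x n \<in> Arr E" "Dom E (x n) = X \<boxtimes> P n" "Cod E (x n) = P (Suc n)" "ar (x n) = Ide G (ao X)"
    and P_0: "P 0 = Io (ao X)" and x_0: "x 0 = id (X \<boxtimes> P 0)"
    and x_rel: "x (Suc n) \<cdot> (id X \<boxdot> (x n \<cdot> pt X (P n))) = x (Suc n) \<cdot> pt X (P (Suc n)) \<cdot> x n"
    and x_coequalizer: "\<lbrakk>Y \<in> Obj E; ao Y = ao X\<rbrakk> \<Longrightarrow>
      is_coequalizer E ((id X \<boxdot> (x n \<cdot> pt X (P n))) \<boxdot> id Y) ((pt X (P (Suc n)) \<cdot> x n) \<boxdot> id Y)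
        (x (Suc n) \<boxdot> id Y)"

lemma (in initial_unit) action_chain_exists:
  assumes X [simp]: "X \<in> Obj E"
  shows "\<exists>P x. action_chain G E X P x"
proof -
  \<comment> \<open>A state is a stage \<open>p\<close> with its arrow \<open>x : X \<otimes> p \<rightarrow> p'\<close>; the next stage \<open>p'\<close> is only recorded as the codomain.\<close>
  define good where "good n s \<longleftrightarrow> (case s of (p, x) \<Rightarrow> p \<in> Obj E \<and> ao p = ao X \<and> x \<in> Arr E \<and>
    Dom E x = X \<boxtimes> p \<and> ar x = Ide G (ao X) \<and> (n = 0 \<longrightarrow> p = Io (ao X) \<and> x = id (X \<boxtimes> p)))" for n :: nat and s
  define link where "link s s' \<longleftrightarrow> (case (s, s') of ((p, x), (p', x')) \<Rightarrow> p' = Cod E x \<and>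
      x' \<cdot> (id X \<boxdot> (x \<cdot> pt X p)) = x' \<cdot> pt X p' \<cdot> x \<and>
      (\<forall>Y \<in> Obj E. ao Y = ao X \<longrightarrow>
        is_coequalizer E ((id X \<boxdot> (x \<cdot> pt X p)) \<boxdot> id Y) ((pt X p' \<cdot> x) \<boxdot> id Y) (x' \<boxdot> id Y)))" for s s'
  have "\<exists>s. \<forall>n. good n (s n) \<and> link (s n) (s (Suc n))"
  proof (rule dependent_nat_choice)
    show "\<exists>s. good 0 s"
      by (rule exI[of _ "(Io (ao X), id (X \<boxtimes> Io (ao X)))"]) (simp add: good_def)
  next
    fix s n assume s: "good n s"
    obtain p x where px: "s = (p, x)" by (cases s)
    have [simp]: "p \<in> Obj E" "ao p = ao X" "x \<in> Arr E" "Dom E x = X \<boxtimes> p" "ar x = Ide G (ao X)"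
      using s by (auto simp: good_def px)
    have [simp]: "ao (Cod E x) = ao X"
      using Ar.far_arr(3)[of x] by simp
    obtain q where "q \<in> Arr E" "Dom E q = Cod E (pt X (Cod E x) \<cdot> x)" "ar q = Ide G (ao X)"
      "q \<cdot> (id X \<boxdot> (x \<cdot> pt X p)) = q \<cdot> (pt X (Cod E x) \<cdot> x)"
      "\<forall>Y \<in> Obj E. ao Y = ao X \<longrightarrow> is_coequalizer E ((id X \<boxdot> (x \<cdot> pt X p)) \<boxdot> id Y)
         ((pt X (Cod E x) \<cdot> x) \<boxdot> id Y) (q \<boxdot> id Y)"
      using stable_coequalizer[of "ao X" "id X \<boxdot> (x \<cdot> pt X p)" "pt X (Cod E x) \<cdot> x"] by auto
    then show "\<exists>s'. good (Suc n) s' \<and> link s s'"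
      by (intro exI[of _ "(Cod E x, q)"]) (simp add: good_def link_def px)
  qed
  then obtain s where s: "\<And>n. good n (s n)" "\<And>n. link (s n) (s (Suc n))" by blast
  have "action_chain G E X (\<lambda>n. fst (s n)) (\<lambda>n. snd (s n))"
  proof unfold_locales
    fix n Y
    show "fst (s n) \<in> Obj E" "ao (fst (s n)) = ao X" "snd (s n) \<in> Arr E"
      "Dom E (snd (s n)) = X \<boxtimes> fst (s n)" "Cod E (snd (s n)) = fst (s (Suc n))"
      "ar (snd (s n)) = Ide G (ao X)" "fst (s 0) = Io (ao X)" "snd (s 0) = id (X \<boxtimes> fst (s 0))"
      using s(1)[of n] s(2)[of n] s(1)[of 0] by (auto simp: good_def link_def split: prod.splits)
    show "snd (s (Suc n)) \<cdot> (id X \<boxdot> (snd (s n) \<cdot> pt X (fst (s n)))) =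
        snd (s (Suc n)) \<cdot> pt X (fst (s (Suc n))) \<cdot> snd (s n)"
      using s(2)[of n] by (auto simp: link_def split: prod.splits)
    show "is_coequalizer E ((id X \<boxdot> (snd (s n) \<cdot> pt X (fst (s n)))) \<boxdot> id Y)
        ((pt X (fst (s (Suc n))) \<cdot> snd (s n)) \<boxdot> id Y) (snd (s (Suc n)) \<boxdot> id Y)"
      if "Y \<in> Obj E" "ao Y = ao X"
      using s(2)[of n] that by (auto simp: link_def split: prod.splits)
  qed simp
  then show ?thesis by blast
qed

context action_chain
begin

definition shift where "shift n = x n \<cdot> pt X (P n)"

lemma shift [simp]: "shift n \<in> Arr E" "Dom E (shift n) = P n" "Cod E (shift n) = P (Suc n)" "ar (shift n) = Ide G (ao X)"
  by (simp_all add: shift_def)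

text \<open>
  For \<open>n = 0\<close> the arrow \<open>x n\<close> is an identity, afterwards a coequalizer that is stable under tensoring.
\<close>

lemma x_epi:
  assumes "Y \<in> Obj E" "ao Y = ao X" "f \<in> Arr E" "Dom E f = P (Suc n) \<boxtimes> Y" "g \<in> Arr E" "Dom E g = P (Suc n) \<boxtimes> Y"
    and eq: "f \<cdot> (x n \<boxdot> id Y) = g \<cdot> (x n \<boxdot> id Y)"
  shows "f = g"
proof (cases n)
  case 0
  have "P (Suc 0) = X \<boxtimes> P 0" using x(3)[of 0] by (simp add: x_0)
  then show ?thesis using 0 assms by (simp add: x_0)
next
  case (Suc m)
  show ?thesis
    by (rule Ar.C.coequalizer_epi[OF x_coequalizer[OF assms(1,2), of m]]) (use Suc assms in simp_all)
qed

text \<open>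
  The extension of \<open>g\<close> to the stages of the chain is forced: \<open>f (n + 1)\<close> must send a letter followed by a
  word to the action of the letter on the value of the word.  This factors through the coequalizer
  because both ways of inserting a point lead back to the value on the shorter word.
\<close>

lemma extend_along_chain:
  assumes Y [simp]: "Y \<in> Obj E" "ao Y = ao X" and a: "action X' A a"
    and \<phi> [simp]: "\<phi> \<in> Arr E" "Dom E \<phi> = X" "Cod E \<phi> = X'"
    and g [simp]: "g \<in> Arr E" "Dom E g = Y" "Cod E g = A" "ar g = ar \<phi>"
  shows "\<exists>f. f 0 = g \<cdot> l Y \<and> (\<forall>n. f n \<in> Arr E \<and> Dom E (f n) = P n \<boxtimes> Y \<and> Cod E (f n) = A \<and>
    ar (f n) = ar \<phi> \<and> f (Suc n) \<cdot> (shift n \<boxdot> id Y) = f n \<and>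
    f (Suc n) \<cdot> (x n \<boxdot> id Y) = a \<cdot> (\<phi> \<boxdot> f n) \<cdot> as X (P n) Y)"
proof -
  have A [simp]: "X' \<in> Obj E" "A \<in> Obj E" "ao A = ao X'" "a \<in> Arr E" "Dom E a = X' \<boxtimes> A"
    "Cod E a = A" "ar a = Ide G (ao X')"
    using a by (auto simp: action_def)
  have b [simp]: "Dom G (ar \<phi>) = ao X" "Cod G (ar \<phi>) = ao X'" using \<phi> by auto
  let ?step = "\<lambda>n f. a \<cdot> (\<phi> \<boxdot> f) \<cdot> as X (P n) Y"
  \<comment> \<open>The last clause says that the restriction of \<open>f\<close> to the previous stage is the arrow it was built from; this is what makes the next extension coequalize.\<close>
  define good where "good n f \<longleftrightarrow> f \<in> Arr E \<and> Dom E f = P n \<boxtimes> Y \<and> Cod E f = A \<and> ar f = ar \<phi> \<and>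
    (n = 0 \<longrightarrow> f = g \<cdot> l Y) \<and>
    (\<forall>m. n = Suc m \<longrightarrow> f \<cdot> (x m \<boxdot> id Y) = ?step m (f \<cdot> (shift m \<boxdot> id Y)))" for n f
  have step_pt: "?step n f \<cdot> (pt X (P n) \<boxdot> id Y) = f"
    if [simp]: "f \<in> Arr E" "Dom E f = P n \<boxtimes> Y" "Cod E f = A" "ar f = ar \<phi>" for n f
    using action_pt[OF a, of \<phi> X f "P n \<boxtimes> Y"] pt_tensor[of X "P n" Y] by simp
  have shift_Y: "shift n \<boxdot> id Y = (x n \<boxdot> id Y) \<cdot> (pt X (P n) \<boxdot> id Y)" for n
    by (simp add: shift_def ten_cmp)
  have "\<exists>f. \<forall>n. good n (f n) \<and> f (Suc n) \<cdot> (x n \<boxdot> id Y) = ?step n (f n)"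
  proof (rule dependent_nat_choice)
    show "\<exists>f. good 0 f"
      by (rule exI[of _ "g \<cdot> l Y"]) (simp add: good_def P_0)
  next
    fix f n assume f: "good n f"
    have [simp]: "f \<in> Arr E" "Dom E f = P n \<boxtimes> Y" "Cod E f = A" "ar f = ar \<phi>"
      using f by (auto simp: good_def)
    have "\<exists>f'. f' \<in> Arr E \<and> Dom E f' = P (Suc n) \<boxtimes> Y \<and> Cod E f' = A \<and> f' \<cdot> (x n \<boxdot> id Y) = ?step n f"
    proof (cases n)
      case 0
      have "P (Suc 0) = X \<boxtimes> P 0" using x(3)[of 0] by (simp add: x_0)
      then show ?thesis using 0 by (intro exI[of _ "?step n f"]) (simp add: x_0)
    next
      case (Suc m)
      note [simp] = Suc
      have "?step n f \<cdot> ((id X \<boxdot> shift m) \<boxdot> id Y) = a \<cdot> (\<phi> \<boxdot> (f \<cdot> (shift m \<boxdot> id Y))) \<cdot> as X (P m) Y"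
        using as_nat_right[of \<phi> X X' f "P n" Y "shift m" "P m"] by simp
      also have "\<dots> = f \<cdot> (x m \<boxdot> id Y)" using f by (simp add: good_def)
      also have "\<dots> = (?step n f \<cdot> (pt X (P n) \<boxdot> id Y)) \<cdot> (x m \<boxdot> id Y)"
        using step_pt[of f n] by simp
      also have "\<dots> = ?step n f \<cdot> ((pt X (P n) \<cdot> x m) \<boxdot> id Y)"
        by (simp add: ten_cmp)
      finally have eq: "?step n f \<cdot> ((id X \<boxdot> shift m) \<boxdot> id Y) = ?step n f \<cdot> ((pt X (P n) \<cdot> x m) \<boxdot> id Y)" .
      obtain k where "k \<in> Arr E" "Dom E k = Cod E (x n \<boxdot> id Y)" "Cod E k = Cod E (?step n f)"
        "k \<cdot> (x n \<boxdot> id Y) = ?step n f"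
        using coequalizer_factor[OF x_coequalizer[OF Y, of m], of "?step n f"] eq
        unfolding shift_def[symmetric] by (auto simp del: assoc)
      then show ?thesis by (intro exI[of _ k]) simp
    qed
    then obtain f' where f' [simp]: "f' \<in> Arr E" "Dom E f' = P (Suc n) \<boxtimes> Y" "Cod E f' = A"
      and eq: "f' \<cdot> (x n \<boxdot> id Y) = ?step n f" by blast
    have "f' \<cdot> (shift n \<boxdot> id Y) = (f' \<cdot> (x n \<boxdot> id Y)) \<cdot> (pt X (P n) \<boxdot> id Y)"
      by (simp add: shift_Y)
    also have "\<dots> = f" by (simp only: eq) (rule step_pt, simp_all)
    finally have shift: "f' \<cdot> (shift n \<boxdot> id Y) = f" .
    have "ar (f' \<cdot> (shift n \<boxdot> id Y)) = ar f'" using Ar.far_arr(2)[of f'] by simp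
    then have "ar f' = ar \<phi>" by (simp add: shift)
    then have "good (Suc n) f'" by (simp add: good_def shift eq)
    then show "\<exists>f'. good (Suc n) f' \<and> f' \<cdot> (x n \<boxdot> id Y) = ?step n f" using eq by blast
  qed
  then obtain f where f: "\<And>n. good n (f n)" "\<And>n. f (Suc n) \<cdot> (x n \<boxdot> id Y) = ?step n (f n)" by blast
  have f_arr [simp]: "f n \<in> Arr E" "Dom E (f n) = P n \<boxtimes> Y" "Cod E (f n) = A" "ar (f n) = ar \<phi>" for n
    using f(1)[of n] by (auto simp: good_def)
  have "f (Suc n) \<cdot> (shift n \<boxdot> id Y) = f n" for n
  proof -
    have "f (Suc n) \<cdot> (shift n \<boxdot> id Y) = (f (Suc n) \<cdot> (x n \<boxdot> id Y)) \<cdot> (pt X (P n) \<boxdot> id Y)"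
      by (simp add: shift_Y)
    also have "\<dots> = f n" by (simp only: f(2)) (rule step_pt, simp_all)
    finally show ?thesis .
  qed
  then show ?thesis using f by (intro exI[of _ f]) (auto simp: good_def)
qed

text \<open>
  The free pointed action is the colimit of the chain.  Both the colimit and the coequalizers survive
  tensoring with \<open>Y\<close>, so extensions along the chain determine extensions along \<open>C \<otimes> Y\<close> and conversely.
\<close>

lemma free_action_exists: "\<exists>C \<alpha>. free_action X C \<alpha>"
proof -
  obtain C \<kappa> where C: "C \<in> Obj E" "ao C = ao X"
    and \<kappa>: "\<forall>n. \<kappa> n \<in> Arr E \<and> Dom E (\<kappa> n) = P n \<and> Cod E (\<kappa> n) = C \<and> ar (\<kappa> n) = Ide G (ao X) \<and>
      \<kappa> (Suc n) \<cdot> shift n = \<kappa> n"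
    and col: "is_seq_colimit E P shift C \<kappa>"
    and col_left: "\<forall>W \<in> Obj E. ao W = ao X \<longrightarrow>
      is_seq_colimit E (\<lambda>n. W \<boxtimes> P n) (\<lambda>n. id W \<boxdot> shift n) (W \<boxtimes> C) (\<lambda>n. id W \<boxdot> \<kappa> n)"
    and col_right: "\<forall>Y \<in> Obj E. ao Y = ao X \<longrightarrow>
      is_seq_colimit E (\<lambda>n. P n \<boxtimes> Y) (\<lambda>n. shift n \<boxdot> id Y) (C \<boxtimes> Y) (\<lambda>n. \<kappa> n \<boxdot> id Y)"
    and col_both: "\<forall>W \<in> Obj E. \<forall>Y \<in> Obj E. ao W = ao X \<longrightarrow> ao Y = ao X \<longrightarrow>
      is_seq_colimit E (\<lambda>n. (W \<boxtimes> P n) \<boxtimes> Y) (\<lambda>n. (id W \<boxdot> shift n) \<boxdot> id Y)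
        ((W \<boxtimes> C) \<boxtimes> Y) (\<lambda>n. (id W \<boxdot> \<kappa> n) \<boxdot> id Y)"
    using stable_colimit[of "ao X" P shift, OF Ar.fob_obj[OF X] P shift] by (elim exE conjE) (rule that)
  note colX = col_left[rule_format, OF X refl] and colY = col_right[rule_format]
    and colXY = col_both[rule_format, OF X _ refl]
  note C [simp]
  have \<kappa>_arr [simp]: "\<kappa> n \<in> Arr E" "Dom E (\<kappa> n) = P n" "Cod E (\<kappa> n) = C" "ar (\<kappa> n) = Ide G (ao X)"
    and \<kappa>_shift: "\<kappa> (Suc n) \<cdot> shift n = \<kappa> n" for n
    using \<kappa> by auto
  \<comment> \<open>The chain starts at the unit object, so its first leg is the point of \<open>C\<close>.\<close>
  have \<kappa>_0: "\<kappa> 0 = u C" by (rule u_unique) (simp_all add: P_0)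
  have x_shift: "x (Suc n) \<cdot> (id X \<boxdot> shift n) = shift (Suc n) \<cdot> x n" for n
    using x_rel[of n] by (simp add: shift_def)
  \<comment> \<open>The arrows \<open>x n\<close> commute with the transition maps of the chain, so they induce the action on the colimit.\<close>
  have compat: "(\<kappa> (Suc (Suc n)) \<cdot> x (Suc n)) \<cdot> (id X \<boxdot> shift n) = \<kappa> (Suc n) \<cdot> x n" for n
  proof -
    have "(\<kappa> (Suc (Suc n)) \<cdot> x (Suc n)) \<cdot> (id X \<boxdot> shift n) = (\<kappa> (Suc (Suc n)) \<cdot> shift (Suc n)) \<cdot> x n"
      using x_shift[of n] by simp
    then show ?thesis by (simp only: \<kappa>_shift)
  qed
  obtain \<alpha> where \<alpha> [simp]: "\<alpha> \<in> Arr E" "Dom E \<alpha> = X \<boxtimes> C" "Cod E \<alpha> = C"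
    and \<alpha>_\<kappa>: "\<And>n. \<alpha> \<cdot> (id X \<boxdot> \<kappa> n) = \<kappa> (Suc n) \<cdot> x n"
    using seq_colimit_factor[OF colX, of C "\<lambda>n. \<kappa> (Suc n) \<cdot> x n"] compat C by (auto simp del: assoc)
  have \<alpha>_ar [simp]: "ar \<alpha> = Ide G (ao X)"
  proof -
    have "ar (\<alpha> \<cdot> (id X \<boxdot> \<kappa> 0)) = ar \<alpha>" using Ar.far_arr(2)[of \<alpha>] by simp
    then show ?thesis by (simp add: \<alpha>_\<kappa>)
  qed
  have "\<alpha> \<cdot> pt X C = id C"
  proof (rule Ar.C.seq_colimit_epi[OF col])
    fix n
    have "(\<alpha> \<cdot> pt X C) \<cdot> \<kappa> n = (\<alpha> \<cdot> (id X \<boxdot> \<kappa> n)) \<cdot> pt X (P n)"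
      using pt_nat[of "id X" X X "\<kappa> n" "P n" C] by simp
    also have "\<dots> = \<kappa> (Suc n) \<cdot> shift n" by (simp add: \<alpha>_\<kappa> shift_def)
    finally show "(\<alpha> \<cdot> pt X C) \<cdot> \<kappa> n = id C \<cdot> \<kappa> n" by (simp add: \<kappa>_shift)
  qed (simp_all add: hom_def)
  then have act: "action X C \<alpha>" by (simp add: action_def)
  have \<alpha>_Y: "f \<cdot> (\<alpha> \<boxdot> id Y) \<cdot> ((id X \<boxdot> \<kappa> n) \<boxdot> id Y) = f \<cdot> (\<kappa> (Suc n) \<boxdot> id Y) \<cdot> (x n \<boxdot> id Y)"
    if [simp]: "Y \<in> Obj E" "ao Y = ao X" for f Y n
    by (simp add: ten_cmp \<alpha>_\<kappa>)
  have "\<exists>!f. f \<in> Arr E \<and> Dom E f = C \<boxtimes> Y \<and> Cod E f = A \<and> ar f = ar \<phi> \<and>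
          f \<cdot> (u C \<boxdot> id Y) = g \<cdot> l Y \<and> f \<cdot> (\<alpha> \<boxdot> id Y) = a \<cdot> (\<phi> \<boxdot> f) \<cdot> as X C Y"
    if Y [simp]: "Y \<in> Obj E" "ao Y = ao X" and a: "action X' A a"
      and \<phi> [simp]: "\<phi> \<in> Arr E" "Dom E \<phi> = X" "Cod E \<phi> = X'"
      and g [simp]: "g \<in> Arr E" "Dom E g = Y" "Cod E g = A" "ar g = ar \<phi>" for Y X' A a \<phi> g
  proof -
    have A [simp]: "X' \<in> Obj E" "A \<in> Obj E" "ao A = ao X'" "a \<in> Arr E" "Dom E a = X' \<boxtimes> A"
      "Cod E a = A" "ar a = Ide G (ao X')"
      using a by (auto simp: action_def)
    have b [simp]: "Dom G (ar \<phi>) = ao X" "Cod G (ar \<phi>) = ao X'" using \<phi> by auto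
    have step: "(a \<cdot> (\<phi> \<boxdot> f) \<cdot> as X C Y) \<cdot> ((id X \<boxdot> \<kappa> n) \<boxdot> id Y) =
        a \<cdot> (\<phi> \<boxdot> (f \<cdot> (\<kappa> n \<boxdot> id Y))) \<cdot> as X (P n) Y"
      if [simp]: "f \<in> Arr E" "Dom E f = C \<boxtimes> Y" "Cod E f = A" "ar f = ar \<phi>" for f n
      using as_nat_right[of \<phi> X X' f C Y "\<kappa> n" "P n"] by simp
    obtain h where h0: "h 0 = g \<cdot> l Y"
      and h: "\<And>n. h n \<in> Arr E \<and> Dom E (h n) = P n \<boxtimes> Y \<and> Cod E (h n) = A \<and>
        ar (h n) = ar \<phi> \<and> h (Suc n) \<cdot> (shift n \<boxdot> id Y) = h n \<and>
        h (Suc n) \<cdot> (x n \<boxdot> id Y) = a \<cdot> (\<phi> \<boxdot> h n) \<cdot> as X (P n) Y"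
      using extend_along_chain[OF Y a \<phi> g] by blast
    obtain f where f [simp]: "f \<in> Arr E" "Dom E f = C \<boxtimes> Y" "Cod E f = A"
      and f_\<kappa>: "\<And>n. f \<cdot> (\<kappa> n \<boxdot> id Y) = h n"
      using seq_colimit_factor[OF colY[OF Y], of A h] h by auto
    have f_ar [simp]: "ar f = ar \<phi>"
    proof -
      have "ar (f \<cdot> (\<kappa> 0 \<boxdot> id Y)) = ar f" using Ar.far_arr(2)[of f] by simp
      then show ?thesis using h by (simp add: f_\<kappa>)
    qed
    have "f \<cdot> (\<alpha> \<boxdot> id Y) = a \<cdot> (\<phi> \<boxdot> f) \<cdot> as X C Y"
    proof (rule Ar.C.seq_colimit_epi[OF colXY[OF Y]])
      fix n
      have "(f \<cdot> (\<alpha> \<boxdot> id Y)) \<cdot> ((id X \<boxdot> \<kappa> n) \<boxdot> id Y) = (f \<cdot> (\<kappa> (Suc n) \<boxdot> id Y)) \<cdot> (x n \<boxdot> id Y)"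
        using \<alpha>_Y[OF Y, of f n] by simp
      also have "\<dots> = (a \<cdot> (\<phi> \<boxdot> f) \<cdot> as X C Y) \<cdot> ((id X \<boxdot> \<kappa> n) \<boxdot> id Y)"
        unfolding step[OF f f_ar] f_\<kappa> using h by simp
      finally show "(f \<cdot> (\<alpha> \<boxdot> id Y)) \<cdot> ((id X \<boxdot> \<kappa> n) \<boxdot> id Y) =
        (a \<cdot> (\<phi> \<boxdot> f) \<cdot> as X C Y) \<cdot> ((id X \<boxdot> \<kappa> n) \<boxdot> id Y)" .
    qed (simp_all add: hom_def)
    moreover have "f \<cdot> (u C \<boxdot> id Y) = g \<cdot> l Y" using f_\<kappa>[of 0] by (simp add: \<kappa>_0 h0)
    moreover have "f = f'"
      if f' [simp]: "f' \<in> Arr E" "Dom E f' = C \<boxtimes> Y" "Cod E f' = A" "ar f' = ar \<phi>"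
        and base: "f' \<cdot> (u C \<boxdot> id Y) = g \<cdot> l Y" and eq: "f' \<cdot> (\<alpha> \<boxdot> id Y) = a \<cdot> (\<phi> \<boxdot> f') \<cdot> as X C Y" for f'
    proof (rule Ar.C.seq_colimit_epi[OF colY[OF Y]])
      fix n
      have "f' \<cdot> (\<kappa> n \<boxdot> id Y) = h n"
      proof (induction n)
        case 0
        show ?case using base by (simp add: \<kappa>_0 h0)
      next
        case (Suc n)
        have "(f' \<cdot> (\<kappa> (Suc n) \<boxdot> id Y)) \<cdot> (x n \<boxdot> id Y) = (f' \<cdot> (\<alpha> \<boxdot> id Y)) \<cdot> ((id X \<boxdot> \<kappa> n) \<boxdot> id Y)"
          using \<alpha>_Y[OF Y, of f' n] by simp
        also have "\<dots> = h (Suc n) \<cdot> (x n \<boxdot> id Y)"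
          unfolding eq step[OF f'] Suc using h by simp
        finally show ?case
          by (rule x_epi[OF Y, rotated -1]) (use h in simp_all)
      qed
      then show "f \<cdot> (\<kappa> n \<boxdot> id Y) = f' \<cdot> (\<kappa> n \<boxdot> id Y)" by (simp add: f_\<kappa>)
    qed (simp_all add: hom_def)
    ultimately show ?thesis
      by (intro ex1I[of _ f] conjI f f_ar) (assumption | (elim conjE, metis))+
  qed
  then show ?thesis using act unfolding free_action_def by blast
qed

end


section \<open>The free monoid\<close>

context surmonoidal
begin

abbreviation monoid where "monoid B c m e \<equiv> is_monoid (fiber_moncat G E B) c m e"

lemma monoid_iff:
  "monoid B c m e \<longleftrightarrow> c \<in> Obj E \<and> ao c = B \<and> m \<in> Arr E \<and> Dom E m = c \<boxtimes> c \<and> Cod E m = c \<and> ar m = Ide G B \<and>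
     e \<in> Arr E \<and> Dom E e = Io B \<and> Cod E e = c \<and> ar e = Ide G B \<and>
     m \<cdot> (m \<boxdot> id c) = m \<cdot> (id c \<boxdot> m) \<cdot> as c c c \<and> m \<cdot> (e \<boxdot> id c) = l c \<and> m \<cdot> (id c \<boxdot> e) = r c"
  by (auto simp: is_monoid_def hom_def Let_def)

lemma asi_nat:
  assumes "f \<in> Arr E" "g \<in> Arr E" "h \<in> Arr E" "ar f = ar g" "ar g = ar h"
    "Dom E f = x" "Dom E g = y" "Dom E h = z" "Cod E f = x'" "Cod E g = y'" "Cod E h = z'"
  shows "asi x' y' z' \<cdot> (f \<boxdot> g \<boxdot> h) = ((f \<boxdot> g) \<boxdot> h) \<cdot> asi x y z"
proof -
  have [simp]: "x \<in> Obj E" "y \<in> Obj E" "z \<in> Obj E" "x' \<in> Obj E" "y' \<in> Obj E" "z' \<in> Obj E"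
    "ao x = ao z" "ao y = ao z" "ao x' = ao z'" "ao y' = ao z'"
    using assms Ar.far_arr(2,3)[of f] Ar.far_arr(2,3)[of g] Ar.far_arr(2,3)[of h] by auto
  have "as x' y' z' \<cdot> asi x' y' z' \<cdot> (f \<boxdot> g \<boxdot> h) = (as x' y' z' \<cdot> asi x' y' z') \<cdot> (f \<boxdot> g \<boxdot> h)"
    using assms by (intro assoc(1)[symmetric]) simp_all
  also have "\<dots> = (f \<boxdot> g \<boxdot> h) \<cdot> (as x y z \<cdot> asi x y z)"
    using assms by simp
  also have "\<dots> = ((f \<boxdot> g \<boxdot> h) \<cdot> as x y z) \<cdot> asi x y z"
    using assms by (intro assoc(1)[symmetric]) simp_all
  also have "\<dots> = as x' y' z' \<cdot> ((f \<boxdot> g) \<boxdot> h) \<cdot> asi x y z"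
    using as_nat[of f g h] assms assoc(1)[of "asi x y z" "(f \<boxdot> g) \<boxdot> h" "as x' y' z'"] by simp
  finally show ?thesis
    by (rule split_mono_cancel[where e' = "asi x' y' z'" and x = "(x' \<boxtimes> y') \<boxtimes> z'"]) (use assms in simp_all)
qed

text \<open>
  The pentagon in the form needed when associativity is compared on \<open>C \<otimes> (C \<otimes> C)\<close>.
\<close>

lemma pentagon_inverse:
  assumes [simp]: "w \<in> Obj E" "x \<in> Obj E" "y \<in> Obj E" "z \<in> Obj E" "ao w = ao z" "ao x = ao z" "ao y = ao z"
  shows "as w (x \<boxtimes> y) z \<cdot> (as w x y \<boxdot> id z) \<cdot> asi (w \<boxtimes> x) y z = (id w \<boxdot> asi x y z) \<cdot> as w x (y \<boxtimes> z)"
proof -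
  have "(id w \<boxdot> as x y z) \<cdot> (as w (x \<boxtimes> y) z \<cdot> (as w x y \<boxdot> id z) \<cdot> asi (w \<boxtimes> x) y z)
      = ((id w \<boxdot> as x y z) \<cdot> as w (x \<boxtimes> y) z \<cdot> (as w x y \<boxdot> id z)) \<cdot> asi (w \<boxtimes> x) y z" by simp
  also have "\<dots> = (as w x (y \<boxtimes> z) \<cdot> as (w \<boxtimes> x) y z) \<cdot> asi (w \<boxtimes> x) y z"
    using pentagon[of w x y z] by simp
  also have "\<dots> = (id w \<boxdot> as x y z) \<cdot> ((id w \<boxdot> asi x y z) \<cdot> as w x (y \<boxtimes> z))"
    by (simp add: ten_cmp_tail)
  finally show ?thesis
    by (rule split_mono_cancel[where e' = "id w \<boxdot> asi x y z" and x = "w \<boxtimes> ((x \<boxtimes> y) \<boxtimes> z)"]) (simp_all add: ten_cmp)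
qed

end

context initial_unit
begin

text \<open>
  Units of monoids carry no information, since the unit object is initial in the fiber.
\<close>

lemma monoid_unit: "monoid B c m e \<Longrightarrow> e = u c"
  by (rule u_unique[of e B c]) (auto simp: monoid_iff)

lemma monoid_action:
  assumes "monoid B c m e"
  shows "action c c m"
proof -
  have m: "c \<in> Obj E" "ao c = B" "m \<in> Arr E" "Dom E m = c \<boxtimes> c" "Cod E m = c" "ar m = Ide G B"
    "m \<cdot> (u c \<boxdot> id c) = l c"
    using assms monoid_unit[OF assms] by (auto simp: monoid_iff)
  have "m \<cdot> pt c c = (m \<cdot> (u c \<boxdot> id c)) \<cdot> li c"
    using m(1-6) by (simp add: pt_def)
  then show ?thesis using m by (simp add: action_def)
qed

end

locale free_monoid = initial_unit +
  fixes X C \<alpha>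
  assumes free: "free_action X C \<alpha>"
begin

lemma C_simps [simp]: "X \<in> Obj E" "C \<in> Obj E" "ao C = ao X" "\<alpha> \<in> Arr E" "Dom E \<alpha> = X \<boxtimes> C"
    "Cod E \<alpha> = C" "ar \<alpha> = Ide G (ao X)"
  and act: "action X C \<alpha>"
  using free by (auto simp: free_action_def action_def)

lemma Ia_ide [simp]: "Ia (Ide G (ao X)) = id (Io (ao X))" by (simp add: unit_cmp)

lemma free_ex1:
  "\<lbrakk>Y \<in> Obj E; ao Y = ao X; action X' A a; \<phi> \<in> Arr E; Dom E \<phi> = X; Cod E \<phi> = X';
    g \<in> Arr E; Dom E g = Y; Cod E g = A; ar g = ar \<phi>\<rbrakk> \<Longrightarrow>
   \<exists>!f. f \<in> Arr E \<and> Dom E f = C \<boxtimes> Y \<and> Cod E f = A \<and> ar f = ar \<phi> \<and>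
      f \<cdot> (u C \<boxdot> id Y) = g \<cdot> l Y \<and> f \<cdot> (\<alpha> \<boxdot> id Y) = a \<cdot> (\<phi> \<boxdot> f) \<cdot> as X C Y"
  using free unfolding free_action_def by blast

text \<open>
  The uniqueness half of freeness, without mention of the arrow that is extended.  Every law of the free
  monoid is an instance.
\<close>

lemma free_eq:
  assumes Y [simp]: "Y \<in> Obj E" "ao Y = ao X" and a: "action X' A a"
    and \<phi>: "\<phi> \<in> Arr E" "Dom E \<phi> = X" "Cod E \<phi> = X'"
    and f [simp]: "f \<in> Arr E" "Dom E f = C \<boxtimes> Y" "Cod E f = A" "ar f = ar \<phi>"
    and h [simp]: "h \<in> Arr E" "Dom E h = C \<boxtimes> Y" "Cod E h = A" "ar h = ar \<phi>"
    and unit: "f \<cdot> (u C \<boxdot> id Y) = h \<cdot> (u C \<boxdot> id Y)"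
    and equi: "f \<cdot> (\<alpha> \<boxdot> id Y) = a \<cdot> (\<phi> \<boxdot> f) \<cdot> as X C Y" "h \<cdot> (\<alpha> \<boxdot> id Y) = a \<cdot> (\<phi> \<boxdot> h) \<cdot> as X C Y"
  shows "f = h"
proof -
  \<comment> \<open>Every arrow out of \<open>C \<otimes> Y\<close> restricts to some \<open>g\<close> on \<open>Y\<close>, so the extension of \<open>g\<close> may be compared with it.\<close>
  define g where "g = f \<cdot> (u C \<boxdot> id Y) \<cdot> li Y"
  have b: "ar \<phi> \<in> Arr G" "Dom G (ar \<phi>) = ao X" using \<phi> by auto
  have g: "g \<in> Arr E" "Dom E g = Y" "Cod E g = A" "ar g = ar \<phi>"
    using b by (simp_all add: g_def)
  have g_l: "g \<cdot> l Y = f \<cdot> (u C \<boxdot> id Y)" by (simp add: g_def)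
  show ?thesis
    using free_ex1[OF Y a \<phi> g] f h equi unit unfolding g_l by metis
qed

text \<open>
  Multiplication is the equivariant extension of the identity of \<open>C\<close> along the point, with \<open>Y = C\<close>.
\<close>

definition mul where
  "mul = (THE f. f \<in> Arr E \<and> Dom E f = C \<boxtimes> C \<and> Cod E f = C \<and> ar f = ar (id X) \<and>
     f \<cdot> (u C \<boxdot> id C) = id C \<cdot> l C \<and> f \<cdot> (\<alpha> \<boxdot> id C) = \<alpha> \<cdot> (id X \<boxdot> f) \<cdot> as X C C)"

lemma mul:
  shows mul_arr [simp]: "mul \<in> Arr E" "Dom E mul = C \<boxtimes> C" "Cod E mul = C" "ar mul = Ide G (ao X)"
    and mul_unit: "mul \<cdot> (u C \<boxdot> id C) = l C"
    and mul_\<alpha>: "mul \<cdot> (\<alpha> \<boxdot> id C) = \<alpha> \<cdot> (id X \<boxdot> mul) \<cdot> as X C C"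
  using theI'[OF free_ex1[of C X C \<alpha> "id X" "id C"]] act unfolding mul_def[symmetric] by auto

text \<open>
  Rewriting with \<open>f g = h\<close> when further arrows follow on the right.
\<close>

lemma cmp_tail:
  assumes "f \<cdot> g = h" "f \<in> Arr E" "g \<in> Arr E" "k \<in> Arr E" "Dom E f = Cod E g" "Dom E g = Cod E k"
  shows "f \<cdot> g \<cdot> k = h \<cdot> k"
  using assms(2-) assoc(1)[of k g f] unfolding assms(1)[symmetric] by simp

text \<open>
  Both sides are equivariant on \<open>C \<otimes> I\<close> and agree at the point; the latter amounts to \<open>l = r\<close> at the unit
  object.
\<close>

lemma mul_right_unit: "mul \<cdot> (id C \<boxdot> u C) = r C"
proof (rule free_eq[of "Io (ao X)" X C \<alpha> "id X"])
  let ?I = "Io (ao X)"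
  have "(mul \<cdot> (id C \<boxdot> u C)) \<cdot> (u C \<boxdot> id ?I) = (mul \<cdot> (u C \<boxdot> id C)) \<cdot> (id ?I \<boxdot> u C)"
    by (simp add: ten_cmp)
  also have "\<dots> = u C \<cdot> l ?I" using l_nat[of "u C"] by (simp add: mul_unit)
  also have "\<dots> = r C \<cdot> (u C \<boxdot> id ?I)" using r_nat[of "u C"] by (simp add: l_unit_eq_r_unit)
  finally show "(mul \<cdot> (id C \<boxdot> u C)) \<cdot> (u C \<boxdot> id ?I) = r C \<cdot> (u C \<boxdot> id ?I)" .
  have "(mul \<cdot> (id C \<boxdot> u C)) \<cdot> (\<alpha> \<boxdot> id ?I) = (mul \<cdot> (\<alpha> \<boxdot> id C)) \<cdot> (id (X \<boxtimes> C) \<boxdot> u C)"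
    by (simp add: ten_cmp)
  also have "\<dots> = \<alpha> \<cdot> (id X \<boxdot> mul) \<cdot> (as X C C \<cdot> ((id X \<boxdot> id C) \<boxdot> u C))"
    by (simp add: mul_\<alpha>)
  also have "\<dots> = \<alpha> \<cdot> (id X \<boxdot> mul) \<cdot> (id X \<boxdot> (id C \<boxdot> u C)) \<cdot> as X C ?I"
    using as_nat[of "id X" "id C" "u C"] by simp
  finally show "(mul \<cdot> (id C \<boxdot> u C)) \<cdot> (\<alpha> \<boxdot> id ?I) = \<alpha> \<cdot> (id X \<boxdot> (mul \<cdot> (id C \<boxdot> u C))) \<cdot> as X C ?I"
    by (simp add: ten_cmp_tail)
  show "r C \<cdot> (\<alpha> \<boxdot> id ?I) = \<alpha> \<cdot> (id X \<boxdot> r C) \<cdot> as X C ?I"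
    using r_nat[of \<alpha>] r_tensor[of X C "ao X"] by simp
qed (simp_all add: act)

text \<open>
  Both sides are equivariant extensions of the multiplication from \<open>C \<otimes> C\<close> to \<open>C \<otimes> (C \<otimes> C)\<close>.
\<close>

lemma mul_assoc: "mul \<cdot> (mul \<boxdot> id C) = mul \<cdot> (id C \<boxdot> mul) \<cdot> as C C C"
proof -
  let ?CC = "C \<boxtimes> C"
  have "mul \<cdot> (mul \<boxdot> id C) \<cdot> asi C C C = mul \<cdot> (id C \<boxdot> mul)"
  proof (rule free_eq[of ?CC X C \<alpha> "id X"])
    \<comment> \<open>Associativity is compared on \<open>C \<otimes> (C \<otimes> C)\<close>, where the left factor is free.\<close>
    have l: "(l C \<boxdot> id C) \<cdot> asi (Io (ao X)) C C = l ?CC"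
      using l_tensor[of C C "ao X", symmetric] by simp
    have "(mul \<cdot> (mul \<boxdot> id C) \<cdot> asi C C C) \<cdot> (u C \<boxdot> id ?CC) =
        mul \<cdot> (mul \<boxdot> id C) \<cdot> (asi C C C \<cdot> (u C \<boxdot> id C \<boxdot> id C))" by simp
    also have "\<dots> = mul \<cdot> ((mul \<boxdot> id C) \<cdot> ((u C \<boxdot> id C) \<boxdot> id C)) \<cdot> asi (Io (ao X)) C C"
      by (subst asi_nat[of "u C" "id C" "id C" "Io (ao X)" C C C C C]) simp_all
    also have "\<dots> = mul \<cdot> l ?CC"
      by (simp add: ten_cmp mul_unit l)
    also have "\<dots> = l C \<cdot> (id (Io (ao X)) \<boxdot> mul)" using l_nat[of mul] by simp
    also have "\<dots> = (mul \<cdot> (u C \<boxdot> id C)) \<cdot> (id (Io (ao X)) \<boxdot> mul)" by (simp add: mul_unit)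
    also have "\<dots> = (mul \<cdot> (id C \<boxdot> mul)) \<cdot> (u C \<boxdot> id ?CC)" by (simp add: ten_cmp)
    finally show "(mul \<cdot> (mul \<boxdot> id C) \<cdot> asi C C C) \<cdot> (u C \<boxdot> id ?CC) = (mul \<cdot> (id C \<boxdot> mul)) \<cdot> (u C \<boxdot> id ?CC)" .
    have "(mul \<cdot> (mul \<boxdot> id C) \<cdot> asi C C C) \<cdot> (\<alpha> \<boxdot> id ?CC) =
        mul \<cdot> (mul \<boxdot> id C) \<cdot> (asi C C C \<cdot> (\<alpha> \<boxdot> id C \<boxdot> id C))" by simp
    also have "\<dots> = mul \<cdot> ((mul \<cdot> (\<alpha> \<boxdot> id C)) \<boxdot> id C) \<cdot> asi (X \<boxtimes> C) C C"
      by (subst asi_nat[of \<alpha> "id C" "id C" "X \<boxtimes> C" C C C C C]) (simp_all add: ten_cmp_tail)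
    also have "\<dots> = (mul \<cdot> (\<alpha> \<boxdot> id C)) \<cdot> ((id X \<boxdot> mul) \<boxdot> id C) \<cdot> (as X C C \<boxdot> id C) \<cdot> asi (X \<boxtimes> C) C C"
      unfolding mul_\<alpha> by (simp add: ten_cmp_tail mul_\<alpha>[symmetric])
    also have "\<dots> = \<alpha> \<cdot> (id X \<boxdot> mul) \<cdot> (as X C C \<cdot> ((id X \<boxdot> mul) \<boxdot> id C)) \<cdot> (as X C C \<boxdot> id C) \<cdot> asi (X \<boxtimes> C) C C"
      unfolding mul_\<alpha> by simp
    also have "\<dots> = \<alpha> \<cdot> (id X \<boxdot> mul) \<cdot> (id X \<boxdot> (mul \<boxdot> id C)) \<cdot>
        (as X ?CC C \<cdot> (as X C C \<boxdot> id C) \<cdot> asi (X \<boxtimes> C) C C)"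
      using as_nat[of "id X" mul "id C"] by simp
    also have "\<dots> = \<alpha> \<cdot> (id X \<boxdot> (mul \<cdot> (mul \<boxdot> id C) \<cdot> asi C C C)) \<cdot> as X C ?CC"
      by (subst pentagon_inverse) (simp_all add: ten_cmp_tail)
    finally show "(mul \<cdot> (mul \<boxdot> id C) \<cdot> asi C C C) \<cdot> (\<alpha> \<boxdot> id ?CC) = \<dots>" .
    have "(mul \<cdot> (id C \<boxdot> mul)) \<cdot> (\<alpha> \<boxdot> id ?CC) = (mul \<cdot> (\<alpha> \<boxdot> id C)) \<cdot> ((id X \<boxdot> id C) \<boxdot> mul)"
      by (simp add: ten_cmp)
    also have "\<dots> = \<alpha> \<cdot> (id X \<boxdot> mul) \<cdot> (as X C C \<cdot> ((id X \<boxdot> id C) \<boxdot> mul))"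
      unfolding mul_\<alpha> by simp
    also have "\<dots> = \<alpha> \<cdot> (id X \<boxdot> (mul \<cdot> (id C \<boxdot> mul))) \<cdot> as X C ?CC"
      using as_nat[of "id X" "id C" mul] by (simp add: ten_cmp_tail)
    finally show "(mul \<cdot> (id C \<boxdot> mul)) \<cdot> (\<alpha> \<boxdot> id ?CC) = \<dots>" .
  qed (simp_all add: act)
  then have "(mul \<cdot> (mul \<boxdot> id C) \<cdot> asi C C C) \<cdot> as C C C = (mul \<cdot> (id C \<boxdot> mul)) \<cdot> as C C C" by (simp only:)
  then show ?thesis by simp
qed

lemma free_is_monoid: "monoid (ao X) C mul (u C)"
  by (simp add: monoid_iff mul_assoc mul_unit mul_right_unit)

text \<open>
  A letter is sent to its action on the empty word.
\<close>

definition eta where "eta = \<alpha> \<cdot> (id X \<boxdot> u C) \<cdot> ri X"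

lemma eta_arr [simp]: "eta \<in> Arr E" "Dom E eta = X" "Cod E eta = C" "ar eta = Ide G (ao X)"
  by (simp_all add: eta_def)

text \<open>
  The action is recovered from the monoid structure, so equivariance and multiplicativity can be traded
  for each other.
\<close>

lemma mul_eta: "mul \<cdot> (eta \<boxdot> id C) = \<alpha>"
proof -
  have tri: "(id X \<boxdot> l C) \<cdot> as X (Io (ao X)) C \<cdot> (ri X \<boxdot> id C) = id (X \<boxtimes> C)"
    using cmp_tail[OF triangle[of X C], of "ri X \<boxdot> id C"] by (simp add: ten_cmp)
  have "mul \<cdot> (eta \<boxdot> id C) = (mul \<cdot> (\<alpha> \<boxdot> id C)) \<cdot> ((id X \<boxdot> u C) \<boxdot> id C) \<cdot> (ri X \<boxdot> id C)"
    by (simp add: eta_def ten_cmp)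
  also have "\<dots> = \<alpha> \<cdot> (id X \<boxdot> mul) \<cdot> (as X C C \<cdot> ((id X \<boxdot> u C) \<boxdot> id C)) \<cdot> (ri X \<boxdot> id C)"
    unfolding mul_\<alpha> by simp
  also have "\<dots> = \<alpha> \<cdot> (id X \<boxdot> (mul \<cdot> (u C \<boxdot> id C))) \<cdot> as X (Io (ao X)) C \<cdot> (ri X \<boxdot> id C)"
    using as_nat[of "id X" "u C" "id C"] by (simp add: ten_cmp_tail)
  also have "\<dots> = \<alpha>" by (simp add: mul_unit tri)
  finally show ?thesis .
qed

text \<open>
  The case \<open>Y = I\<close> of freeness, transported along the right unit constraint, says that \<open>C\<close> is initial among
  pointed actions.  The condition at the point disappears because all arrows preserve points.
\<close>

lemma action_morphism_unique:
  assumes a: "action X' A a" and \<phi> [simp]: "\<phi> \<in> Arr E" "Dom E \<phi> = X" "Cod E \<phi> = X'"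
    and f [simp]: "f \<in> Arr E" "Dom E f = C" "Cod E f = A" "ar f = ar \<phi>" "f \<cdot> \<alpha> = a \<cdot> (\<phi> \<boxdot> f)"
    and h [simp]: "h \<in> Arr E" "Dom E h = C" "Cod E h = A" "ar h = ar \<phi>" "h \<cdot> \<alpha> = a \<cdot> (\<phi> \<boxdot> h)"
  shows "f = h"
proof -
  let ?I = "Io (ao X)"
  have A [simp]: "X' \<in> Obj E" "A \<in> Obj E" "ao A = ao X'" "a \<in> Arr E" "Dom E a = X' \<boxtimes> A"
    "Cod E a = A" "ar a = Ide G (ao X')"
    using a by (auto simp: action_def)
  have b [simp]: "Dom G (ar \<phi>) = ao X" "Cod G (ar \<phi>) = ao X'" using \<phi> by auto
  have equi: "(k \<cdot> r C) \<cdot> (\<alpha> \<boxdot> id ?I) = a \<cdot> (\<phi> \<boxdot> (k \<cdot> r C)) \<cdot> as X C ?I"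
    if [simp]: "k \<in> Arr E" "Dom E k = C" "Cod E k = A" "ar k = ar \<phi>" and eq: "k \<cdot> \<alpha> = a \<cdot> (\<phi> \<boxdot> k)" for k
  proof -
    have "(k \<cdot> r C) \<cdot> (\<alpha> \<boxdot> id ?I) = (k \<cdot> \<alpha>) \<cdot> r (X \<boxtimes> C)" using r_nat[of \<alpha>] by simp
    also have "\<dots> = a \<cdot> (\<phi> \<boxdot> k) \<cdot> ((id X \<boxdot> r C) \<cdot> as X C ?I)"
      unfolding eq using r_tensor[of X C "ao X"] by simp
    also have "\<dots> = a \<cdot> (\<phi> \<boxdot> (k \<cdot> r C)) \<cdot> as X C ?I" by (simp add: ten_cmp_tail)
    finally show ?thesis .
  qed
  have unit: "(k \<cdot> r C) \<cdot> (u C \<boxdot> id ?I) = (u A \<cdot> Ia (ar \<phi>)) \<cdot> r ?I"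
    if [simp]: "k \<in> Arr E" "Dom E k = C" "Cod E k = A" "ar k = ar \<phi>" for k
  proof -
    have "(k \<cdot> r C) \<cdot> (u C \<boxdot> id ?I) = (k \<cdot> u C) \<cdot> r ?I" using r_nat[of "u C"] by simp
    then show ?thesis using u_nat[of k C A] by simp
  qed
  have "f \<cdot> r C = h \<cdot> r C"
    by (rule free_eq[of ?I X' A a \<phi>, OF _ _ a \<phi>])
      (simp_all add: equi[OF f] equi[OF h] unit[OF f(1-4)] unit[OF h(1-4)] del: assoc)
  then show ?thesis
    by (rule split_epi_cancel[where e' = "ri C" and x = C]) simp_all
qed

lemma action_morphism_exists:
  assumes a: "action X' A a" and \<phi> [simp]: "\<phi> \<in> Arr E" "Dom E \<phi> = X" "Cod E \<phi> = X'"
  shows "\<exists>f. f \<in> Arr E \<and> Dom E f = C \<and> Cod E f = A \<and> ar f = ar \<phi> \<and> f \<cdot> \<alpha> = a \<cdot> (\<phi> \<boxdot> f)"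
proof -
  let ?I = "Io (ao X)"
  have A [simp]: "X' \<in> Obj E" "A \<in> Obj E" "ao A = ao X'" "a \<in> Arr E" "Dom E a = X' \<boxtimes> A"
    "Cod E a = A" "ar a = Ide G (ao X')"
    using a by (auto simp: action_def)
  have b [simp]: "Dom G (ar \<phi>) = ao X" "Cod G (ar \<phi>) = ao X'" using \<phi> by auto
  obtain k where k [simp]: "k \<in> Arr E" "Dom E k = C \<boxtimes> ?I" "Cod E k = A" "ar k = ar \<phi>"
    and eq: "k \<cdot> (\<alpha> \<boxdot> id ?I) = a \<cdot> (\<phi> \<boxdot> k) \<cdot> as X C ?I"
    using free_ex1[of ?I X' A a \<phi> "u A \<cdot> Ia (ar \<phi>)"] a by auto
  have ri: "(id X \<boxdot> r C) \<cdot> as X C ?I \<cdot> ri (X \<boxtimes> C) = id (X \<boxtimes> C)"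
    using cmp_tail[OF r_tensor[of X C "ao X"], of "ri (X \<boxtimes> C)"] by simp
  have rC: "(\<alpha> \<boxdot> id ?I) \<cdot> ri (X \<boxtimes> C) = ri C \<cdot> \<alpha>"
  proof -
    have "r C \<cdot> ((\<alpha> \<boxdot> id ?I) \<cdot> ri (X \<boxtimes> C)) = (r C \<cdot> (\<alpha> \<boxdot> id ?I)) \<cdot> ri (X \<boxtimes> C)" by simp
    also have "\<dots> = r C \<cdot> (ri C \<cdot> \<alpha>)"
      using r_nat[of \<alpha>] assoc(1)[of \<alpha> "ri C" "r C"] by simp
    finally show ?thesis
      by (rule split_mono_cancel[where e' = "ri C" and x = "C \<boxtimes> ?I"]) simp_all
  qed
  have asX: "as X C ?I \<cdot> ri (X \<boxtimes> C) = id X \<boxdot> ri C"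
  proof -
    have "(id X \<boxdot> r C) \<cdot> (as X C ?I \<cdot> ri (X \<boxtimes> C)) = (id X \<boxdot> r C) \<cdot> (id X \<boxdot> ri C)"
      using ri by (simp add: ten_cmp)
    then show ?thesis
      by (rule split_mono_cancel[where e' = "id X \<boxdot> ri C" and x = "X \<boxtimes> (C \<boxtimes> ?I)"]) (simp_all add: ten_cmp)
  qed
  have "(k \<cdot> ri C) \<cdot> \<alpha> = (k \<cdot> (\<alpha> \<boxdot> id ?I)) \<cdot> ri (X \<boxtimes> C)" by (simp add: rC)
  also have "\<dots> = a \<cdot> (\<phi> \<boxdot> k) \<cdot> (as X C ?I \<cdot> ri (X \<boxtimes> C))" by (simp add: eq)
  also have "\<dots> = a \<cdot> (\<phi> \<boxdot> (k \<cdot> ri C))" by (simp add: asX ten_cmp)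
  finally show ?thesis by (intro exI[of _ "k \<cdot> ri C"]) simp
qed

text \<open>
  A monoid \<open>D\<close> acts on itself by multiplication, so \<open>f : X \<rightarrow> D\<close> induces a unique equivariant arrow \<open>C \<rightarrow> D\<close>.
  It is multiplicative by uniqueness of extensions from \<open>C\<close> to \<open>C \<otimes> C\<close>.
\<close>

lemma free_monoid_universal:
  assumes D: "monoid B D m e" and f [simp]: "f \<in> Arr E" "Dom E f = X" "Cod E f = D"
  shows "\<exists>!h. h \<in> Arr E \<and> Dom E h = C \<and> Cod E h = D \<and> h \<cdot> mul = m \<cdot> (h \<boxdot> h) \<and>
    h \<cdot> u C = e \<cdot> Ia (ar h) \<and> h \<cdot> eta = f"
proof -
  let ?I = "Io (ao X)"
  have D' [simp]: "D \<in> Obj E" "ao D = B" "m \<in> Arr E" "Dom E m = D \<boxtimes> D" "Cod E m = D" "ar m = Ide G B"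
    and assocD: "m \<cdot> (m \<boxdot> id D) = m \<cdot> (id D \<boxdot> m) \<cdot> as D D D"
    and unitD: "m \<cdot> (u D \<boxdot> id D) = l D" "m \<cdot> (id D \<boxdot> u D) = r D"
    and e: "e = u D"
    using D monoid_unit[OF D] by (auto simp: monoid_iff)
  have b [simp]: "Dom G (ar f) = ao X" "Cod G (ar f) = B" using f by auto
  have B [simp]: "B \<in> Obj G" using Ar.fob_obj[of D] by simp
  note act_D = monoid_action[OF D]
  obtain h where h [simp]: "h \<in> Arr E" "Dom E h = C" "Cod E h = D" "ar h = ar f"
    and h_\<alpha>: "h \<cdot> \<alpha> = m \<cdot> (f \<boxdot> h)"
    using action_morphism_exists[OF act_D f] by blast
  have h_u: "h \<cdot> u C = u D \<cdot> Ia (ar f)" using u_nat[of h C D] by simp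
  have "h \<cdot> eta = (h \<cdot> \<alpha>) \<cdot> (id X \<boxdot> u C) \<cdot> ri X" by (simp add: eta_def)
  also have "\<dots> = m \<cdot> (f \<boxdot> (h \<cdot> u C)) \<cdot> ri X" unfolding h_\<alpha> by (simp add: ten_cmp_tail)
  also have "\<dots> = (m \<cdot> (id D \<boxdot> u D)) \<cdot> (f \<boxdot> Ia (ar f)) \<cdot> ri X"
    unfolding h_u by (simp add: ten_cmp_tail)
  also have "\<dots> = f \<cdot> r X \<cdot> ri X"
    unfolding unitD using cmp_tail[OF r_nat[OF f(1)], of "ri X"] by simp
  finally have h_eta: "h \<cdot> eta = f" by simp
  \<comment> \<open>Both sides extend \<open>h\<close> equivariantly from \<open>C\<close> to \<open>C \<otimes> C\<close>.\<close>
  have "h \<cdot> mul = m \<cdot> (h \<boxdot> h)"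
  proof (rule free_eq[OF C_simps(2,3) act_D f])
    have "(h \<cdot> mul) \<cdot> (u C \<boxdot> id C) = h \<cdot> l C" by (simp add: mul_unit)
    also have "\<dots> = (m \<cdot> (u D \<boxdot> id D)) \<cdot> (Ia (ar f) \<boxdot> h)" unfolding unitD using l_nat[of h] by simp
    also have "\<dots> = m \<cdot> ((h \<cdot> u C) \<boxdot> h)" unfolding h_u by (simp add: ten_cmp)
    also have "\<dots> = (m \<cdot> (h \<boxdot> h)) \<cdot> (u C \<boxdot> id C)" by (simp add: ten_cmp)
    finally show "(h \<cdot> mul) \<cdot> (u C \<boxdot> id C) = (m \<cdot> (h \<boxdot> h)) \<cdot> (u C \<boxdot> id C)" .
    have "(h \<cdot> mul) \<cdot> (\<alpha> \<boxdot> id C) = (h \<cdot> \<alpha>) \<cdot> (id X \<boxdot> mul) \<cdot> as X C C" by (simp add: mul_\<alpha>)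
    also have "\<dots> = m \<cdot> (f \<boxdot> (h \<cdot> mul)) \<cdot> as X C C" unfolding h_\<alpha> by (simp add: ten_cmp_tail)
    finally show "(h \<cdot> mul) \<cdot> (\<alpha> \<boxdot> id C) = m \<cdot> (f \<boxdot> (h \<cdot> mul)) \<cdot> as X C C" .
    have "(m \<cdot> (h \<boxdot> h)) \<cdot> (\<alpha> \<boxdot> id C) = m \<cdot> ((h \<cdot> \<alpha>) \<boxdot> h)" by (simp add: ten_cmp)
    also have "\<dots> = (m \<cdot> (m \<boxdot> id D)) \<cdot> ((f \<boxdot> h) \<boxdot> h)" unfolding h_\<alpha> by (simp add: ten_cmp)
    also have "\<dots> = m \<cdot> (id D \<boxdot> m) \<cdot> (as D D D \<cdot> ((f \<boxdot> h) \<boxdot> h))" unfolding assocD by simp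
    also have "\<dots> = m \<cdot> (f \<boxdot> (m \<cdot> (h \<boxdot> h))) \<cdot> as X C C"
      using as_nat[of f h h] by (simp add: ten_cmp_tail)
    finally show "(m \<cdot> (h \<boxdot> h)) \<cdot> (\<alpha> \<boxdot> id C) = m \<cdot> (f \<boxdot> (m \<cdot> (h \<boxdot> h))) \<cdot> as X C C" .
  qed simp_all
  moreover have "h' = h"
    if h' [simp]: "h' \<in> Arr E" "Dom E h' = C" "Cod E h' = D"
      and mult: "h' \<cdot> mul = m \<cdot> (h' \<boxdot> h')" and eta: "h' \<cdot> eta = f" for h'
  proof (rule action_morphism_unique[OF act_D f])
    have "ar (h' \<cdot> eta) = ar h'" using Ar.far_arr(2)[of h'] by simp
    then show ar [simp]: "ar h' = ar f" by (simp add: eta)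
    \<comment> \<open>A monoid morphism is equivariant, because the action is multiplication by \<open>eta\<close>.\<close>
    have "h' \<cdot> \<alpha> = (h' \<cdot> mul) \<cdot> (eta \<boxdot> id C)" by (simp add: mul_eta)
    also have "\<dots> = m \<cdot> ((h' \<cdot> eta) \<boxdot> h')" unfolding mult by (simp add: ten_cmp)
    finally show "h' \<cdot> \<alpha> = m \<cdot> (f \<boxdot> h')" by (simp add: eta)
  qed (simp_all add: h_\<alpha>)
  ultimately show ?thesis
    by (intro ex1I[of _ h] conjI h(1-3) h_eta) (simp add: h_u e | elim conjE, metis)+
qed

end

theorem (in initial_unit) free_monoid_exists:
  assumes X: "X \<in> Obj E"
  shows "\<exists>C m e \<eta>. monoid (ao X) C m e \<and> \<eta> \<in> hom E X C \<and> ar \<eta> = Ide G (ao X) \<and>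
    (\<forall>B D m' e' f. monoid B D m' e' \<and> f \<in> hom E X D \<longrightarrow>
       (\<exists>!h. h \<in> hom E C D \<and> h \<cdot> m = m' \<cdot> (h \<boxdot> h) \<and> h \<cdot> e = e' \<cdot> Ia (ar h) \<and> h \<cdot> \<eta> = f))"
proof -
  obtain P x where "action_chain G E X P x" using action_chain_exists[OF X] by blast
  from action_chain.free_action_exists[OF this] obtain C \<alpha> where "free_action X C \<alpha>" by blast
  then interpret free_monoid G E X C \<alpha> by unfold_locales
  have "\<exists>!h. h \<in> hom E C D \<and> h \<cdot> mul = m' \<cdot> (h \<boxdot> h) \<and> h \<cdot> u C = e' \<cdot> Ia (ar h) \<and> h \<cdot> eta = f"
    if "monoid B D m' e'" "f \<in> hom E X D" for B D m' e' f
    using free_monoid_universal[OF that(1), of f] that(2) by (simp add: hom_def conj_assoc)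
  moreover have "eta \<in> hom E X C" by (simp add: hom_def)
  ultimately show ?thesis using free_is_monoid eta_arr(4) by blast
qed


section \<open>Surmonoids as a surcategory\<close>

context surmonoidal
begin

lemma Mon_sel [simp]:
  "Dom (Mon G E) = (\<lambda>(s, f, t). s)" "Cod (Mon G E) = (\<lambda>(s, f, t). t)"
  "Fob (Arity (Mon G E)) = (\<lambda>(c, m, e, B). B)" "Far (Arity (Mon G E)) = (\<lambda>(s, (f, b), t). b)"
  "Ide (Mon G E) = (\<lambda>(c, m, e, B). ((c, m, e, B), (id c, Ide G B), (c, m, e, B)))"
  "Cmp (Mon G E) = (\<lambda>(_, (g, c), u) (s, (f, b), _). (s, (g \<cdot> f, c \<cdot>\<^bsub>G\<^esub> b), u))"
  by (simp_all add: Mon_def)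

lemma Mon_obj: "(c, m, e, B) \<in> Obj (Mon G E) \<longleftrightarrow> monoid B c m e"
  by (auto simp: Mon_def surmonoids_def monoid_iff)

lemma Mon_arr:
  "((c, m, e, B), (f, b), (c', m', e', B')) \<in> Arr (Mon G E) \<longleftrightarrow>
    monoid B c m e \<and> monoid B' c' m' e' \<and> f \<in> Arr E \<and> Dom E f = c \<and> Cod E f = c' \<and> ar f = b \<and>
    f \<cdot> m = m' \<cdot> (f \<boxdot> f) \<and> f \<cdot> e = e' \<cdot> Ia b"
  by (auto simp: Mon_def surmonoids_def monoid_iff hom_def)

text \<open>
  The second component of a morphism of surmonoids is determined by the first.
\<close>

lemma Mon_cases:
  assumes "g \<in> Arr (Mon G E)"
  obtains c m e B f c' m' e' B' where "g = ((c, m, e, B), (f, ar f), (c', m', e', B'))"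
    "monoid B c m e" "monoid B' c' m' e'" "f \<in> Arr E" "Dom E f = c" "Cod E f = c'"
    "f \<cdot> m = m' \<cdot> (f \<boxdot> f)" "f \<cdot> e = e' \<cdot> Ia (ar f)"
proof -
  obtain c m e B f b c' m' e' B' where g: "g = ((c, m, e, B), (f, b), (c', m', e', B'))"
    by (metis surj_pair)
  then show thesis using assms that Mon_arr by metis
qed

lemma Mon_category: "category (Mon G E)"
proof (rule category.intro)
  fix f assume "f \<in> Arr (Mon G E)"
  then show "Dom (Mon G E) f \<in> Obj (Mon G E)" "Cod (Mon G E) f \<in> Obj (Mon G E)"
    by (auto elim!: Mon_cases simp: Mon_obj)
next
  fix x assume x: "x \<in> Obj (Mon G E)"
  obtain c m e B where [simp]: "x = (c, m, e, B)" by (metis surj_pair)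
  have m: "monoid B c m e" using x by (simp add: Mon_obj)
  then have "B \<in> Obj G" using Ar.fob_obj[of c] by (auto simp: monoid_iff)
  then show "Ide (Mon G E) x \<in> hom (Mon G E) x x"
    using m by (auto simp: hom_def Mon_arr monoid_iff unit_cmp)
next
  fix f g x y z assume "f \<in> hom (Mon G E) x y" "g \<in> hom (Mon G E) y z"
  then have fg: "f \<in> Arr (Mon G E)" "g \<in> Arr (Mon G E)" "fst f = x" "snd (snd f) = y" "fst g = y"
    "snd (snd g) = z"
    by (auto simp: hom_def split: prod.splits)
  obtain c m e B h c' m' e' B' where f: "f = ((c, m, e, B), (h, ar h), (c', m', e', B'))"
    and mon: "monoid B c m e" "monoid B' c' m' e'"
    and h: "h \<in> Arr E" "Dom E h = c" "Cod E h = c'" "h \<cdot> m = m' \<cdot> (h \<boxdot> h)" "h \<cdot> e = e' \<cdot> Ia (ar h)"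
    using fg(1) by (rule Mon_cases)
  obtain k c'' m'' e'' B'' where g: "g = ((c', m', e', B'), (k, ar k), (c'', m'', e'', B''))"
    and mon': "monoid B'' c'' m'' e''"
    and k: "k \<in> Arr E" "Dom E k = c'" "Cod E k = c''" "k \<cdot> m' = m'' \<cdot> (k \<boxdot> k)" "k \<cdot> e' = e'' \<cdot> Ia (ar k)"
    using fg(2,4,5) by (auto elim!: Mon_cases simp: f)
  note [simp] = mon[unfolded monoid_iff] mon'[unfolded monoid_iff] h(1-3) k(1-3)
  have "(k \<cdot> h) \<cdot> m = (k \<cdot> m') \<cdot> (h \<boxdot> h)" using h(4) by simp
  also have "\<dots> = m'' \<cdot> ((k \<cdot> h) \<boxdot> (k \<cdot> h))" unfolding k(4) by (simp add: ten_cmp)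
  finally have mult: "(k \<cdot> h) \<cdot> m = m'' \<cdot> ((k \<cdot> h) \<boxdot> (k \<cdot> h))" .
  have "(k \<cdot> h) \<cdot> e = (k \<cdot> e') \<cdot> Ia (ar h)" using h(5) by simp
  also have "\<dots> = e'' \<cdot> Ia (ar k) \<cdot> Ia (ar h)" unfolding k(5) by simp
  finally have "(k \<cdot> h) \<cdot> e = e'' \<cdot> Ia (ar k \<cdot>\<^bsub>G\<^esub> ar h)" by (simp add: unit_cmp)
  then have "((c, m, e, B), (k \<cdot> h, ar k \<cdot>\<^bsub>G\<^esub> ar h), (c'', m'', e'', B'')) \<in> Arr (Mon G E)"
    using mult mon mon' unfolding Mon_arr by simp
  then show "g \<cdot>\<^bsub>Mon G E\<^esub> f \<in> hom (Mon G E) x z"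
    using fg by (auto simp: f g hom_def)
qed (auto simp: hom_def monoid_iff Ar.D.assoc_law elim!: Mon_cases)

lemma Mon_surcategory: "surcategory G (Mon G E)"
  unfolding surcategory_def
proof (intro is_functor.intro is_functor_axioms.intro Mon_category Ar.D.category_axioms)
  fix f x y assume "f \<in> hom (Mon G E) x y"
  then show "Far (Arity (Mon G E)) f \<in> hom G (Fob (Arity (Mon G E)) x) (Fob (Arity (Mon G E)) y)"
    by (auto simp: hom_def monoid_iff elim!: Mon_cases)
next
  fix x assume "x \<in> Obj (Mon G E)"
  then show "Fob (Arity (Mon G E)) x \<in> Obj G"
    by (cases x) (auto simp: Mon_obj monoid_iff)
qed (auto simp: Mon_def)

lemma Mon_forget_surfunctor: "surfunctor G (Mon G E) E Mon_forget"
  unfolding surfunctor_def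
proof (intro conjI Mon_surcategory)
  show "surcategory G E" by (simp add: surcategory_def Ar.is_functor_axioms)
  show "is_functor (Mon G E) E Mon_forget"
  proof (intro is_functor.intro is_functor_axioms.intro Mon_category Ar.C.category_axioms)
    fix f x y assume "f \<in> hom (Mon G E) x y"
    then show "Far Mon_forget f \<in> hom E (Fob Mon_forget x) (Fob Mon_forget y)"
      by (auto simp: hom_def Mon_forget_def elim!: Mon_cases)
  next
    fix x assume "x \<in> Obj (Mon G E)"
    then show "Fob Mon_forget x \<in> Obj E"
      by (cases x) (auto simp: Mon_obj monoid_iff Mon_forget_def)
  qed (auto simp: Mon_forget_def)
  show "ftor_eq (Mon G E) (Arity E \<circ>\<^sub>F Mon_forget) (Arity (Mon G E))"
    by (auto simp: ftor_eq_def comp_ftor_def Mon_forget_def Mon_obj monoid_iff elim!: Mon_cases)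
qed

end

section \<open>Suradjunctions from universal arrows\<close>

lemma surfunctor_id: "surcategory G X \<Longrightarrow> surfunctor G X X id_ftor"
  by (auto simp: surfunctor_def surcategory_def is_functor_def is_functor_axioms_def ftor_eq_def
      comp_ftor_def id_ftor_def)

lemma surfunctor_comp:
  assumes "surfunctor G X Y F" "surfunctor G Y Z H"
  shows "surfunctor G X Z (H \<circ>\<^sub>F F)"
proof -
  interpret F: is_functor X Y F using assms by (simp add: surfunctor_def)
  show ?thesis
    using assms functor_comp[of X Y F Z H] F.fob_obj F.far_arr(1)
    by (auto simp: surfunctor_def ftor_eq_def comp_ftor_def)
qed

text \<open>
  The usual construction of an adjunction from universal arrows.  Only the units are required to have
  identity arity; that the left adjoint and the counit live over the base is then automatic.
\<close>

lemma suradjunction_of_universal_arrows: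
  assumes U: "surfunctor G Y X U"
    and univ: "\<And>x. x \<in> Obj X \<Longrightarrow> \<exists>y n. y \<in> Obj Y \<and> n \<in> hom X x (Fob U y) \<and>
      Far (Arity X) n = Ide G (Fob (Arity X) x) \<and>
      (\<forall>z \<in> Obj Y. \<forall>f \<in> hom X x (Fob U z). \<exists>!g. g \<in> hom Y y z \<and> Far U g \<cdot>\<^bsub>X\<^esub> n = f)"
  shows "\<exists>F \<eta> \<epsilon>. suradjunction G X Y F U \<eta> \<epsilon>"
proof -
  interpret U: is_functor Y X U using U by (simp add: surfunctor_def)
  interpret AX: is_functor X G "Arity X" using U by (simp add: surfunctor_def surcategory_def)
  interpret AY: is_functor Y G "Arity Y" using U by (simp add: surfunctor_def surcategory_def)
  have AU: "y \<in> Obj Y \<Longrightarrow> Fob (Arity X) (Fob U y) = Fob (Arity Y) y"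
    "g \<in> Arr Y \<Longrightarrow> Far (Arity X) (Far U g) = Far (Arity Y) g" for y g
    using U by (auto simp: surfunctor_def ftor_eq_def comp_ftor_def)
  let ?universal = "\<lambda>x p. fst p \<in> Obj Y \<and> snd p \<in> hom X x (Fob U (fst p)) \<and>
      Far (Arity X) (snd p) = Ide G (Fob (Arity X) x) \<and>
      (\<forall>z \<in> Obj Y. \<forall>f \<in> hom X x (Fob U z). \<exists>!g. g \<in> hom Y (fst p) z \<and> Far U g \<cdot>\<^bsub>X\<^esub> snd p = f)"
  have "\<forall>x \<in> Obj X. \<exists>p. ?universal x p"
  proof
    fix x assume "x \<in> Obj X"
    from univ[OF this] obtain y n where "?universal x (y, n)" unfolding fst_conv snd_conv by blast
    then show "\<exists>p. ?universal x p" ..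
  qed
  from bchoice[OF this] obtain p where p: "\<forall>x \<in> Obj X. ?universal x (p x)" ..
  define \<Phi> where "\<Phi> x = fst (p x)" for x
  define \<eta> where "\<eta> x = snd (p x)" for x
  note p = p[folded \<Phi>_def \<eta>_def]
  have \<Phi>: "\<Phi> x \<in> Obj Y" and \<eta>: "\<eta> x \<in> hom X x (Fob U (\<Phi> x))"
    and \<eta>_ar: "Far (Arity X) (\<eta> x) = Ide G (Fob (Arity X) x)" if "x \<in> Obj X" for x
    using p that by blast+
  have ex1: "\<exists>!g. g \<in> hom Y (\<Phi> x) z \<and> Far U g \<cdot>\<^bsub>X\<^esub> \<eta> x = f"
    if "x \<in> Obj X" "z \<in> Obj Y" "f \<in> hom X x (Fob U z)" for x z f
    using p that by blast
  have hom_obj: "x \<in> Obj X \<and> x' \<in> Obj X" if "f \<in> hom X x x'" for f x x'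
    using that U.D.dom_obj U.D.cod_obj by (auto simp: hom_def)
  have homY_obj: "y \<in> Obj Y \<and> y' \<in> Obj Y" if "g \<in> hom Y y y'" for g y y'
    using that U.C.dom_obj U.C.cod_obj by (auto simp: hom_def)
  have unique: "g = g'" if "x \<in> Obj X" "g \<in> hom Y (\<Phi> x) z" "g' \<in> hom Y (\<Phi> x) z"
      "Far U g \<cdot>\<^bsub>X\<^esub> \<eta> x = Far U g' \<cdot>\<^bsub>X\<^esub> \<eta> x" for x z g g'
  proof -
    have "Far U g' \<cdot>\<^bsub>X\<^esub> \<eta> x \<in> hom X x (Fob U z)"
      using U.D.cmp_hom[OF \<eta> U.far_hom] that by blast
    then show ?thesis using ex1[of x z "Far U g' \<cdot>\<^bsub>X\<^esub> \<eta> x"] that homY_obj[OF that(2)] by blast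
  qed
  define ext where "ext x z f = (THE g. g \<in> hom Y (\<Phi> x) z \<and> Far U g \<cdot>\<^bsub>X\<^esub> \<eta> x = f)" for x z f
  have ext: "ext x z f \<in> hom Y (\<Phi> x) z" "Far U (ext x z f) \<cdot>\<^bsub>X\<^esub> \<eta> x = f"
    if "x \<in> Obj X" "z \<in> Obj Y" "f \<in> hom X x (Fob U z)" for x z f
    using theI'[OF ex1[OF that]] by (auto simp: ext_def)
  \<comment> \<open>As the unit \<open>\<eta>\<close> has identity arity, an extension inherits the arity of the arrow it extends.\<close>
  have ext_ar: "Far (Arity Y) (ext x z f) = Far (Arity X) f"
    if x: "x \<in> Obj X" and z: "z \<in> Obj Y" and f: "f \<in> hom X x (Fob U z)" for x z f
  proof -
    note e = ext[OF that]
    have Ue: "Far U (ext x z f) \<in> hom X (Fob U (\<Phi> x)) (Fob U z)" using U.far_hom e by blast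
    have "Far (Arity X) f = Far (Arity X) (Far U (ext x z f)) \<cdot>\<^bsub>G\<^esub> Ide G (Fob (Arity X) x)"
      using AX.far_cmp[OF \<eta>[OF x] Ue] by (simp add: e \<eta>_ar[OF x])
    also have "\<dots> = Far (Arity X) (Far U (ext x z f))"
    proof (rule AX.D.unit_law(2))
      have "Far (Arity X) (\<eta> x) \<in> hom G (Fob (Arity X) x) (Fob (Arity X) (Fob U (\<Phi> x)))"
        using AX.far_hom[OF \<eta>[OF x]] .
      then have "Fob (Arity X) (Fob U (\<Phi> x)) = Fob (Arity X) x"
        using AX.D.ide_hom[OF AX.fob_obj[OF x]] by (simp add: \<eta>_ar[OF x] hom_def)
      then show "Far (Arity X) (Far U (ext x z f)) \<in> Arr G"
        "Dom G (Far (Arity X) (Far U (ext x z f))) = Fob (Arity X) x"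
        using AX.far_hom[OF Ue] by (auto simp: hom_def)
    qed
    finally show ?thesis using AU(2) e(1) by (simp add: hom_def)
  qed
  have \<Phi>_ar: "Fob (Arity Y) (\<Phi> x) = Fob (Arity X) x" if x: "x \<in> Obj X" for x
  proof -
    have "Far (Arity X) (\<eta> x) \<in> hom G (Fob (Arity X) x) (Fob (Arity X) (Fob U (\<Phi> x)))"
      using AX.far_hom[OF \<eta>[OF x]] .
    then show ?thesis
      using AX.D.ide_hom[OF AX.fob_obj[OF x]] AU(1)[OF \<Phi>[OF x]] by (simp add: \<eta>_ar[OF x] hom_def)
  qed
  have post: "f' \<cdot>\<^bsub>X\<^esub> f \<in> hom X x z" if "f \<in> hom X x y" "f' \<in> hom X y z" for f f' x y z
    using U.D.cmp_hom that by blast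
  define F where "F = \<lparr>Fob = \<Phi>, Far = (\<lambda>f. ext (Dom X f) (\<Phi> (Cod X f)) (\<eta> (Cod X f) \<cdot>\<^bsub>X\<^esub> f))\<rparr>"
  define \<epsilon> where "\<epsilon> = (\<lambda>y. ext (Fob U y) y (Ide X (Fob U y)))"
  have F_hom: "Far F f \<in> hom Y (\<Phi> x) (\<Phi> x')" and F_eta: "Far U (Far F f) \<cdot>\<^bsub>X\<^esub> \<eta> x = \<eta> x' \<cdot>\<^bsub>X\<^esub> f"
    and F_ar: "Far (Arity Y) (Far F f) = Far (Arity X) f"
    if f: "f \<in> hom X x x'" for f x x'
  proof -
    have x: "x \<in> Obj X" "x' \<in> Obj X" using hom_obj[OF f] by auto
    have eq: "Far F f = ext x (\<Phi> x') (\<eta> x' \<cdot>\<^bsub>X\<^esub> f)" using f by (simp add: F_def hom_def)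
    note c = post[OF f \<eta>[OF x(2)]]
    show "Far F f \<in> hom Y (\<Phi> x) (\<Phi> x')" "Far U (Far F f) \<cdot>\<^bsub>X\<^esub> \<eta> x = \<eta> x' \<cdot>\<^bsub>X\<^esub> f"
      using ext[OF x(1) \<Phi>[OF x(2)] c] by (simp_all add: eq)
    have "Far (Arity X) (\<eta> x' \<cdot>\<^bsub>X\<^esub> f) = Far (Arity X) f"
      using AX.far_cmp[OF f \<eta>[OF x(2)]] AX.D.cmp_ide_left[OF AX.far_hom[OF f]] by (simp add: \<eta>_ar[OF x(2)])
    then show "Far (Arity Y) (Far F f) = Far (Arity X) f"
      using ext_ar[OF x(1) \<Phi>[OF x(2)] c] by (simp add: eq)
  qed
  have F_comp_eta: "Far U (g \<cdot>\<^bsub>Y\<^esub> Far F f) \<cdot>\<^bsub>X\<^esub> \<eta> x = (Far U g \<cdot>\<^bsub>X\<^esub> \<eta> x') \<cdot>\<^bsub>X\<^esub> f"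
    if f: "f \<in> hom X x x'" and g: "g \<in> hom Y (\<Phi> x') z" for f g x x' z
  proof -
    have x: "x \<in> Obj X" "x' \<in> Obj X" using hom_obj[OF f] by auto
    show ?thesis
      using U.far_cmp[OF F_hom[OF f] g] F_eta[OF f]
        U.D.cmp_assoc[OF \<eta>[OF x(1)] U.far_hom[OF F_hom[OF f]] U.far_hom[OF g]]
        U.D.cmp_assoc[OF f \<eta>[OF x(2)] U.far_hom[OF g]] by simp
  qed
  have F: "is_functor X Y F"
  proof (intro is_functor.intro is_functor_axioms.intro U.D.category_axioms U.C.category_axioms)
    fix x assume x: "x \<in> Obj X"
    show "Fob F x \<in> Obj Y" using \<Phi>[OF x] by (simp add: F_def)
    show "Far F (Ide X x) = Ide Y (Fob F x)"
      using unique[OF x F_hom[OF U.D.ide_hom[OF x]] U.C.ide_hom[OF \<Phi>[OF x]]]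
        F_eta[OF U.D.ide_hom[OF x]] U.far_ide[OF \<Phi>[OF x]]
        U.D.cmp_ide_left[OF \<eta>[OF x]] U.D.cmp_ide_right[OF \<eta>[OF x]] by (simp add: F_def)
  next
    fix f x y assume "f \<in> hom X x y"
    then show "Far F f \<in> hom Y (Fob F x) (Fob F y)" using F_hom by (simp add: F_def)
  next
    fix f g x y z assume f: "f \<in> hom X x y" and g: "g \<in> hom X y z"
    have x: "x \<in> Obj X" "z \<in> Obj X" using hom_obj[OF f] hom_obj[OF g] by auto
    have "Far U (Far F g \<cdot>\<^bsub>Y\<^esub> Far F f) \<cdot>\<^bsub>X\<^esub> \<eta> x = \<eta> z \<cdot>\<^bsub>X\<^esub> (g \<cdot>\<^bsub>X\<^esub> f)"
      using F_comp_eta[OF f F_hom[OF g]] F_eta[OF g] U.D.cmp_assoc[OF f g \<eta>[OF x(2)]] by simp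
    then show "Far F (g \<cdot>\<^bsub>X\<^esub> f) = Far F g \<cdot>\<^bsub>Y\<^esub> Far F f"
      using unique[OF x(1) F_hom[OF post[OF f g]] U.C.cmp_hom[OF F_hom[OF f] F_hom[OF g]]]
        F_eta[OF post[OF f g]] by simp
  qed
  have FS: "surfunctor G X Y F"
    unfolding surfunctor_def ftor_eq_def comp_ftor_def
    using U F \<Phi>_ar F_ar[OF arr_hom] by (simp add: surfunctor_def) (simp add: F_def)
  have XX: "surcategory G X" "surcategory G Y" using U by (auto simp: surfunctor_def)
  have \<epsilon>: "\<epsilon> y \<in> hom Y (\<Phi> (Fob U y)) y" "Far U (\<epsilon> y) \<cdot>\<^bsub>X\<^esub> \<eta> (Fob U y) = Ide X (Fob U y)"
    "Far (Arity Y) (\<epsilon> y) = Ide G (Fob (Arity Y) y)" if y: "y \<in> Obj Y" for y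
    using ext[OF U.fob_obj[OF y] y U.D.ide_hom[OF U.fob_obj[OF y]]]
      ext_ar[OF U.fob_obj[OF y] y U.D.ide_hom[OF U.fob_obj[OF y]]] AX.far_ide[OF U.fob_obj[OF y]] AU(1)[OF y]
    by (simp_all add: \<epsilon>_def)
  have \<epsilon>_nat: "g \<cdot>\<^bsub>Y\<^esub> \<epsilon> y = \<epsilon> z \<cdot>\<^bsub>Y\<^esub> Far F (Far U g)" if g: "g \<in> hom Y y z" for g y z
  proof -
    have y: "y \<in> Obj Y" "z \<in> Obj Y" using homY_obj[OF g] by auto
    note Uy = U.fob_obj[OF y(1)] and Ug = U.far_hom[OF g]
    have "Far U (g \<cdot>\<^bsub>Y\<^esub> \<epsilon> y) \<cdot>\<^bsub>X\<^esub> \<eta> (Fob U y) = Far U g"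
      using U.far_cmp[OF \<epsilon>(1)[OF y(1)] g] \<epsilon>(2)[OF y(1)] U.D.cmp_ide_right[OF Ug]
        U.D.cmp_assoc[OF \<eta>[OF Uy] U.far_hom[OF \<epsilon>(1)[OF y(1)]] Ug] by simp
    moreover have "Far U (\<epsilon> z \<cdot>\<^bsub>Y\<^esub> Far F (Far U g)) \<cdot>\<^bsub>X\<^esub> \<eta> (Fob U y) = Far U g"
      using F_comp_eta[OF Ug \<epsilon>(1)[OF y(2)]] \<epsilon>(2)[OF y(2)] U.D.cmp_ide_left[OF Ug] by simp
    ultimately show ?thesis
      using unique[OF Uy U.C.cmp_hom[OF \<epsilon>(1)[OF y(1)] g] U.C.cmp_hom[OF F_hom[OF Ug] \<epsilon>(1)[OF y(2)]]]
      by simp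
  qed
  have Fob_F: "Fob F = \<Phi>" by (simp add: F_def)
  have UF: "surfunctor G X X (U \<circ>\<^sub>F F)" and FU: "surfunctor G Y Y (F \<circ>\<^sub>F U)"
    by (rule surfunctor_comp[OF FS U] surfunctor_comp[OF U FS])+
  have "sur_trans G X X id_ftor (U \<circ>\<^sub>F F) \<eta>"
    using surfunctor_id[OF XX(1)] UF \<eta> \<eta>_ar F_eta[OF arr_hom]
    by (simp add: sur_trans_def nat_trans_def surfunctor_def) (simp add: id_ftor_def comp_ftor_def Fob_F)
  moreover have "sur_trans G Y Y (F \<circ>\<^sub>F U) id_ftor \<epsilon>"
    using surfunctor_id[OF XX(2)] FU \<epsilon> \<epsilon>_nat[OF arr_hom]
    by (simp add: sur_trans_def nat_trans_def surfunctor_def) (simp add: id_ftor_def comp_ftor_def Fob_F)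
  moreover have "\<epsilon> (Fob F x) \<cdot>\<^bsub>Y\<^esub> Far F (\<eta> x) = Ide Y (Fob F x)" if x: "x \<in> Obj X" for x
  proof -
    note c = F_comp_eta[OF \<eta>[OF x] \<epsilon>(1)[OF \<Phi>[OF x]]]
    show ?thesis unfolding Fob_F
      by (rule unique[OF x U.C.cmp_hom[OF F_hom[OF \<eta>[OF x]] \<epsilon>(1)[OF \<Phi>[OF x]]] U.C.ide_hom[OF \<Phi>[OF x]]])
        (simp add: c \<epsilon>(2)[OF \<Phi>[OF x]] U.far_ide[OF \<Phi>[OF x]])
  qed
  ultimately have "suradjunction G X Y F U \<eta> \<epsilon>"
    using FS U \<epsilon>(2) by (simp add: suradjunction_def)
  then show ?thesis by blast
qed


section \<open>Eilenberg--Moore algebras and surmonoids\<close>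

lemma EM_sel [simp]:
  "Dom (EM X S) = (\<lambda>(s, f, t). s)" "Cod (EM X S) = (\<lambda>(s, f, t). t)"
  "Ide (EM X S) = (\<lambda>(x, h). ((x, h), Ide X x, (x, h)))"
  "Cmp (EM X S) = (\<lambda>(_, g, u) (s, f, _). (s, g \<cdot>\<^bsub>X\<^esub> f, u))"
  "Fob (Arity (EM X S)) = (\<lambda>(x, h). Fob (Arity X) x)" "Far (Arity (EM X S)) = (\<lambda>(s, f, t). Far (Arity X) f)"
  by (simp_all add: EM_def Let_def)

lemma EM_obj:
  "(x, h) \<in> Obj (EM X S) \<longleftrightarrow> x \<in> Obj X \<and> h \<in> hom X (Fob (endo S) x) x \<and>
     h \<cdot>\<^bsub>X\<^esub> munit S x = Ide X x \<and> h \<cdot>\<^bsub>X\<^esub> Far (endo S) h = h \<cdot>\<^bsub>X\<^esub> mmult S x"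
  by (simp add: EM_def Let_def)

lemma EM_arr:
  "((x, h), f, (x', h')) \<in> Arr (EM X S) \<longleftrightarrow> (x, h) \<in> Obj (EM X S) \<and> (x', h') \<in> Obj (EM X S) \<and>
     f \<in> hom X x x' \<and> f \<cdot>\<^bsub>X\<^esub> h = h' \<cdot>\<^bsub>X\<^esub> Far (endo S) f"
  by (simp add: EM_def Let_def)

lemma EM_cases:
  assumes "g \<in> Arr (EM X S)"
  obtains x h f x' h' where "g = ((x, h), f, (x', h'))" "(x, h) \<in> Obj (EM X S)" "(x', h') \<in> Obj (EM X S)"
    "f \<in> hom X x x'" "f \<cdot>\<^bsub>X\<^esub> h = h' \<cdot>\<^bsub>X\<^esub> Far (endo S) f"
proof -
  obtain x h f x' h' where g: "g = ((x, h), f, (x', h'))" by (metis surj_pair)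
  then show thesis using assms that EM_arr by metis
qed

lemma EM_surcategory:
  assumes S: "surmonad G X S"
  shows "surcategory G (EM X S)"
proof -
  interpret S: is_functor X X "endo S" using S by (simp add: surmonad_def surfunctor_def)
  interpret A: is_functor X G "Arity X" using S by (simp add: surmonad_def surfunctor_def surcategory_def)
  have "category (EM X S)"
  proof (rule category.intro)
    fix f assume "f \<in> Arr (EM X S)"
    then show "Dom (EM X S) f \<in> Obj (EM X S)" "Cod (EM X S) f \<in> Obj (EM X S)"
      by (auto elim!: EM_cases)
  next
    fix a assume a: "a \<in> Obj (EM X S)"
    obtain x h where [simp]: "a = (x, h)" by fastforce
    have "x \<in> Obj X" "h \<in> hom X (Fob (endo S) x) x" using a by (auto simp: EM_obj)
    then show "Ide (EM X S) a \<in> hom (EM X S) a a"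
      using a S.C.cmp_ide_left[of h] S.C.cmp_ide_right[of h]
      by (simp add: hom_def[of "EM X S"] EM_arr S.C.ide_hom S.far_ide)
  next
    fix f g a b c assume f: "f \<in> hom (EM X S) a b" and g: "g \<in> hom (EM X S) b c"
    obtain x h f' x' h' where f': "f = ((x, h), f', (x', h'))" "a = (x, h)" "b = (x', h')"
      "(x, h) \<in> Obj (EM X S)" "f' \<in> hom X x x'" "f' \<cdot>\<^bsub>X\<^esub> h = h' \<cdot>\<^bsub>X\<^esub> Far (endo S) f'"
      using f by (auto simp: hom_def elim!: EM_cases)
    obtain g' x'' h'' where g': "g = ((x', h'), g', (x'', h''))" "c = (x'', h'')" "(x', h') \<in> Obj (EM X S)"
      "(x'', h'') \<in> Obj (EM X S)" "g' \<in> hom X x' x''" "g' \<cdot>\<^bsub>X\<^esub> h' = h'' \<cdot>\<^bsub>X\<^esub> Far (endo S) g'"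
      using g f'(3) by (auto simp: hom_def elim!: EM_cases)
    have h: "h \<in> hom X (Fob (endo S) x) x" "h' \<in> hom X (Fob (endo S) x') x'" "h'' \<in> hom X (Fob (endo S) x'') x''"
      using f' g' by (auto simp: EM_obj)
    have "(g' \<cdot>\<^bsub>X\<^esub> f') \<cdot>\<^bsub>X\<^esub> h = g' \<cdot>\<^bsub>X\<^esub> (h' \<cdot>\<^bsub>X\<^esub> Far (endo S) f')"
      using S.C.cmp_assoc[OF h(1) f'(5) g'(5)] f'(6) by simp
    also have "\<dots> = (g' \<cdot>\<^bsub>X\<^esub> h') \<cdot>\<^bsub>X\<^esub> Far (endo S) f'"
      by (rule S.C.cmp_assoc[OF S.far_hom[OF f'(5)] h(2) g'(5), symmetric])
    also have "\<dots> = h'' \<cdot>\<^bsub>X\<^esub> (Far (endo S) g' \<cdot>\<^bsub>X\<^esub> Far (endo S) f')"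
      unfolding g'(6) by (rule S.C.cmp_assoc[OF S.far_hom[OF f'(5)] S.far_hom[OF g'(5)] h(3)])
    also have "\<dots> = h'' \<cdot>\<^bsub>X\<^esub> Far (endo S) (g' \<cdot>\<^bsub>X\<^esub> f')"
      using S.far_cmp[OF f'(5) g'(5)] by simp
    finally show "g \<cdot>\<^bsub>EM X S\<^esub> f \<in> hom (EM X S) a c"
      using f' g' S.C.cmp_hom[OF f'(5) g'(5)] by (simp add: hom_def[of "EM X S"] EM_arr)
  next
    fix f a b assume "f \<in> hom (EM X S) a b"
    then show "Ide (EM X S) b \<cdot>\<^bsub>EM X S\<^esub> f = f" "f \<cdot>\<^bsub>EM X S\<^esub> Ide (EM X S) a = f"
      by (auto simp: hom_def[of "EM X S"] S.C.cmp_ide_left S.C.cmp_ide_right elim!: EM_cases)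
  next
    fix f g h a b c d
    assume "f \<in> hom (EM X S) a b" "g \<in> hom (EM X S) b c" "h \<in> hom (EM X S) c d"
    then show "(h \<cdot>\<^bsub>EM X S\<^esub> g) \<cdot>\<^bsub>EM X S\<^esub> f = h \<cdot>\<^bsub>EM X S\<^esub> g \<cdot>\<^bsub>EM X S\<^esub> f"
      by (auto simp: hom_def[of "EM X S"] S.C.cmp_assoc elim!: EM_cases)
  qed
  then show ?thesis unfolding surcategory_def
  proof (intro is_functor.intro is_functor_axioms.intro A.D.category_axioms)
    fix f a b assume "f \<in> hom (EM X S) a b"
    then show "Far (Arity (EM X S)) f \<in> hom G (Fob (Arity (EM X S)) a) (Fob (Arity (EM X S)) b)"
      by (auto simp: hom_def[of "EM X S"] A.far_hom elim!: EM_cases)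
  next
    fix f g a b c assume "f \<in> hom (EM X S) a b" "g \<in> hom (EM X S) b c"
    then show "Far (Arity (EM X S)) (g \<cdot>\<^bsub>EM X S\<^esub> f) = Far (Arity (EM X S)) g \<cdot>\<^bsub>G\<^esub> Far (Arity (EM X S)) f"
      by (auto simp: hom_def[of "EM X S"] A.far_cmp elim!: EM_cases)
  next
    fix a assume "a \<in> Obj (EM X S)"
    then show "Fob (Arity (EM X S)) a \<in> Obj G"
      "Far (Arity (EM X S)) (Ide (EM X S) a) = Ide G (Fob (Arity (EM X S)) a)"
      by (cases a; auto simp: EM_obj A.fob_obj A.far_ide)+
  qed
qed

text \<open>
  The counit at \<open>y\<close> is the only arrow whose transpose is the identity.  This recognizes structure maps of
  algebras as counits.
\<close>

lemma counit_unique: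
  assumes adj: "suradjunction G X Y F U \<eta> \<epsilon>" and y: "y \<in> Obj Y"
    and g: "g \<in> hom Y (Fob F (Fob U y)) y" and eq: "Far U g \<cdot>\<^bsub>X\<^esub> \<eta> (Fob U y) = Ide X (Fob U y)"
  shows "g = \<epsilon> y"
proof -
  interpret F: is_functor X Y F using adj by (simp add: suradjunction_def surfunctor_def)
  interpret U: is_functor Y X U using adj by (simp add: suradjunction_def surfunctor_def)
  let ?x = "Fob U y"
  have x: "?x \<in> Obj X" by (rule U.fob_obj[OF y])
  have \<eta>: "\<eta> ?x \<in> hom X ?x (Fob U (Fob F ?x))"
    and \<epsilon>: "\<And>y. y \<in> Obj Y \<Longrightarrow> \<epsilon> y \<in> hom Y (Fob F (Fob U y)) y"
    and nat: "g \<cdot>\<^bsub>Y\<^esub> \<epsilon> (Fob F ?x) = \<epsilon> y \<cdot>\<^bsub>Y\<^esub> Far F (Far U g)"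
    and tri: "\<epsilon> (Fob F ?x) \<cdot>\<^bsub>Y\<^esub> Far F (\<eta> ?x) = Ide Y (Fob F ?x)"
    using adj x g by (auto simp: suradjunction_def sur_trans_def nat_trans_def id_ftor_def comp_ftor_def hom_def)
  note F\<eta> = F.far_hom[OF \<eta>] and \<epsilon>F = \<epsilon>[OF F.fob_obj[OF x]] and FUg = F.far_hom[OF U.far_hom[OF g]]
  have "g = g \<cdot>\<^bsub>Y\<^esub> (\<epsilon> (Fob F ?x) \<cdot>\<^bsub>Y\<^esub> Far F (\<eta> ?x))"
    using F.D.cmp_ide_right[OF g] by (simp add: tri)
  also have "\<dots> = (g \<cdot>\<^bsub>Y\<^esub> \<epsilon> (Fob F ?x)) \<cdot>\<^bsub>Y\<^esub> Far F (\<eta> ?x)"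
    by (rule F.D.cmp_assoc[OF F\<eta> \<epsilon>F g, symmetric])
  also have "\<dots> = \<epsilon> y \<cdot>\<^bsub>Y\<^esub> (Far F (Far U g) \<cdot>\<^bsub>Y\<^esub> Far F (\<eta> ?x))"
    unfolding nat by (rule F.D.cmp_assoc[OF F\<eta> FUg \<epsilon>[OF y]])
  also have "\<dots> = \<epsilon> y \<cdot>\<^bsub>Y\<^esub> Far F (Ide X ?x)"
    using F.far_cmp[OF \<eta> U.far_hom[OF g]] eq by simp
  also have "\<dots> = \<epsilon> y" using F.D.cmp_ide_right[OF \<epsilon>[OF y]] F.far_ide[OF x] by simp
  finally show ?thesis .
qed

text \<open>
  From here on \<open>F\<close> is an arbitrary left suradjoint of the forgetful surfunctor, since surmonadicity
  quantifies over all of them.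
\<close>

locale monoid_suradjunction = surmonoidal G E
  for G :: "('go, 'ga, 'y) cat_scheme"
    and E :: "('o, 'a, 'go, 'ga, 'z) surmoncat_scheme" (structure) +
  fixes F \<eta> \<epsilon>
  assumes adj: "suradjunction G E (Mon G E) F Mon_forget \<eta> \<epsilon>"
begin

abbreviation U :: "('o \<times> 'a \<times> 'a \<times> 'go,
    ('o \<times> 'a \<times> 'a \<times> 'go) \<times> ('a \<times> 'ga) \<times> ('o \<times> 'a \<times> 'a \<times> 'go), 'o, 'a) ftor"
  where "U \<equiv> Mon_forget"
abbreviation "T x \<equiv> Fob U (Fob F x)"
abbreviation "Ta f \<equiv> Far U (Far F f)"
abbreviation "S \<equiv> induced_monad F U \<eta> \<epsilon>"

definition "free_mult x = fst (snd (Fob F x))"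
definition "free_unit x = fst (snd (snd (Fob F x)))"
definition "\<mu> x = Far U (\<epsilon> (Fob F x))"

sublocale F: is_functor E "Mon G E" F using adj by (simp add: suradjunction_def surfunctor_def)
sublocale U: is_functor "Mon G E" E U using adj by (simp add: suradjunction_def surfunctor_def)

lemma F_obj:
  assumes x: "x \<in> Obj E"
  shows "Fob F x = (T x, free_mult x, free_unit x, ao x)"
proof -
  have "Fob (Arity (Mon G E)) (Fob F x) = ao x"
    using adj x by (auto simp: suradjunction_def surfunctor_def ftor_eq_def comp_ftor_def)
  then show ?thesis
    by (cases "Fob F x") (auto simp: Mon_forget_def free_mult_def free_unit_def)
qed

lemma T_monoid: "x \<in> Obj E \<Longrightarrow> monoid (ao x) (T x) (free_mult x) (free_unit x)"
  using F.fob_obj[of x] F_obj[of x] by (metis Mon_obj)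

lemma T_simps [simp]:
  assumes "x \<in> Obj E"
  shows "T x \<in> Obj E" "ao (T x) = ao x" "free_mult x \<in> Arr E" "Dom E (free_mult x) = T x \<boxtimes> T x"
    "Cod E (free_mult x) = T x" "ar (free_mult x) = Ide G (ao x)"
    "free_unit x \<in> Arr E" "Dom E (free_unit x) = Io (ao x)" "Cod E (free_unit x) = T x" "ar (free_unit x) = Ide G (ao x)"
  using T_monoid[OF assms] by (simp_all add: monoid_iff)

lemma F_arr:
  assumes f: "f \<in> Arr E" "Dom E f = x" "Cod E f = x'"
  shows "Far F f = (Fob F x, (Ta f, ar f), Fob F x')" "Ta f \<in> Arr E" "Dom E (Ta f) = T x" "Cod E (Ta f) = T x'"
    "ar (Ta f) = ar f" "Ta f \<cdot> free_mult x = free_mult x' \<cdot> (Ta f \<boxdot> Ta f)" "Ta f \<cdot> free_unit x = free_unit x' \<cdot> Ia (ar f)"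
proof -
  have x: "x \<in> Obj E" "x' \<in> Obj E" using f by auto
  have a: "Far (Arity (Mon G E)) (Far F f) = ar f"
    using adj f by (auto simp: suradjunction_def surfunctor_def ftor_eq_def comp_ftor_def)
  have h: "Far F f \<in> Arr (Mon G E)" "fst (Far F f) = Fob F x" "snd (snd (Far F f)) = Fob F x'"
    using F.far_arr[OF f(1)] f by (auto split: prod.splits)
  then show eq: "Far F f = (Fob F x, (Ta f, ar f), Fob F x')"
    using a by (auto simp: Mon_forget_def split: prod.splits)
  have "((T x, free_mult x, free_unit x, ao x), (Ta f, ar f), (T x', free_mult x', free_unit x', ao x')) \<in> Arr (Mon G E)"
    using h(1) eq F_obj x by metis
  then show "Ta f \<in> Arr E" "Dom E (Ta f) = T x" "Cod E (Ta f) = T x'" "ar (Ta f) = ar f"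
    "Ta f \<cdot> free_mult x = free_mult x' \<cdot> (Ta f \<boxdot> Ta f)" "Ta f \<cdot> free_unit x = free_unit x' \<cdot> Ia (ar f)"
    unfolding Mon_arr by auto
qed

lemma \<eta>_arr [simp]:
  assumes "x \<in> Obj E"
  shows "\<eta> x \<in> Arr E" "Dom E (\<eta> x) = x" "Cod E (\<eta> x) = T x" "ar (\<eta> x) = Ide G (ao x)"
  using adj assms
  by (auto simp: suradjunction_def sur_trans_def nat_trans_def id_ftor_def comp_ftor_def hom_def)

lemma \<eta>_nat: "f \<in> Arr E \<Longrightarrow> Dom E f = x \<Longrightarrow> Cod E f = y \<Longrightarrow> Ta f \<cdot> \<eta> x = \<eta> y \<cdot> f"
  using adj by (auto simp: suradjunction_def sur_trans_def nat_trans_def id_ftor_def comp_ftor_def)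

lemma \<epsilon>_arr:
  assumes y: "monoid B c m e" and k: "k = Far U (\<epsilon> (c, m, e, B))"
  shows "k \<in> Arr E" "Dom E k = T c" "Cod E k = c" "ar k = Ide G B"
    "k \<cdot> free_mult c = m \<cdot> (k \<boxdot> k)" "k \<cdot> free_unit c = e" "k \<cdot> \<eta> c = id c"
proof -
  let ?y = "(c, m, e, B)"
  have y': "?y \<in> Obj (Mon G E)" using y by (simp add: Mon_obj)
  have c: "c \<in> Obj E" "ao c = B" "Fob U ?y = c" using y by (auto simp: monoid_iff Mon_forget_def)
  have B: "B \<in> Obj G" using c Ar.fob_obj[of c] by simp
  have \<epsilon>: "\<epsilon> ?y \<in> hom (Mon G E) (Fob F c) ?y" "Far (Arity (Mon G E)) (\<epsilon> ?y) = Ide G B"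
    and tri: "k \<cdot> \<eta> c = id c"
    using adj y' c(3)
    by (auto simp: suradjunction_def sur_trans_def nat_trans_def id_ftor_def comp_ftor_def k)
  then have "\<epsilon> ?y = (Fob F c, (k, Ide G B), ?y)"
    by (auto simp: hom_def Mon_forget_def k split: prod.splits)
  then have "((T c, free_mult c, free_unit c, ao c), (k, Ide G B), ?y) \<in> Arr (Mon G E)"
    using \<epsilon>(1) F_obj[OF c(1)] by (simp add: hom_def)
  then show "k \<in> Arr E" "Dom E k = T c" "Cod E k = c" "ar k = Ide G B"
    "k \<cdot> free_mult c = m \<cdot> (k \<boxdot> k)" "k \<cdot> free_unit c = e"
    using y B unfolding Mon_arr by (auto simp: monoid_iff unit_cmp)
  show "k \<cdot> \<eta> c = id c" by (rule tri)
qed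

lemma \<epsilon>_nat:
  assumes "g \<in> Arr (Mon G E)" "g = (y, (f, b), y')"
  shows "f \<cdot> Far U (\<epsilon> y) = Far U (\<epsilon> y') \<cdot> Ta f"
proof -
  have g: "g \<in> hom (Mon G E) y y'" using assms by (simp add: hom_def)
  have y: "y \<in> Obj (Mon G E)" "y' \<in> Obj (Mon G E)" 
    using F.D.dom_obj[OF assms(1)] F.D.cod_obj[OF assms(1)] assms(2) by auto
  have f: "Far U g = f" using assms by (simp add: Mon_forget_def)
  have \<epsilon>: "\<epsilon> y \<in> hom (Mon G E) (Fob F (Fob U y)) y" "\<epsilon> y' \<in> hom (Mon G E) (Fob F (Fob U y')) y'"
    and "g \<cdot>\<^bsub>Mon G E\<^esub> \<epsilon> y = \<epsilon> y' \<cdot>\<^bsub>Mon G E\<^esub> Far F f"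
    using adj y assms f by (auto simp: suradjunction_def sur_trans_def nat_trans_def id_ftor_def comp_ftor_def)
  then show ?thesis
    using U.far_cmp[OF \<epsilon>(1) g] U.far_cmp[OF F.far_hom[OF U.far_hom[OF g]] \<epsilon>(2)] by (simp add: f)
qed

lemma \<mu>_arr:
  assumes x: "x \<in> Obj E"
  shows "\<mu> x \<in> Arr E" "Dom E (\<mu> x) = T (T x)" "Cod E (\<mu> x) = T x" "ar (\<mu> x) = Ide G (ao x)"
    "\<mu> x \<cdot> free_mult (T x) = free_mult x \<cdot> (\<mu> x \<boxdot> \<mu> x)" "\<mu> x \<cdot> \<eta> (T x) = id (T x)"
  using \<epsilon>_arr[OF T_monoid[OF x] refl] by (simp_all add: \<mu>_def F_obj[OF x, symmetric])

lemma EM_obj_iff: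
  "(x, h) \<in> Obj (EM E S) \<longleftrightarrow> x \<in> Obj E \<and> h \<in> Arr E \<and> Dom E h = T x \<and> Cod E h = x \<and>
     h \<cdot> \<eta> x = id x \<and> h \<cdot> Ta h = h \<cdot> \<mu> x"
  by (auto simp: EM_obj hom_def induced_monad_def comp_ftor_def \<mu>_def)

text \<open>
  The only candidate for a monoid structure on \<open>x\<close> that makes the split epimorphism \<open>h : T x \<rightarrow> x\<close> a morphism
  of monoids.
\<close>

definition "alg_mult x h = h \<cdot> free_mult x \<cdot> (\<eta> x \<boxdot> \<eta> x)"
definition "alg_unit x h = h \<cdot> free_unit x"

context
  fixes x h
  assumes alg: "(x, h) \<in> Obj (EM E S)"
begin

lemma alg_simps [simp]: "x \<in> Obj E" "h \<in> Arr E" "Dom E h = T x" "Cod E h = x"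
  and alg_laws: "h \<cdot> \<eta> x = id x" "h \<cdot> Ta h = h \<cdot> \<mu> x"
  using alg by (auto simp: EM_obj_iff)

lemma alg_ar [simp]: "ar h = Ide G (ao x)"
proof -
  have "ar (h \<cdot> \<eta> x) = ar h" using Ar.far_arr(2)[of h] by simp
  then show ?thesis by (simp add: alg_laws)
qed

lemma alg_mult_arr [simp]: "alg_mult x h \<in> Arr E" "Dom E (alg_mult x h) = x \<boxtimes> x"
  "Cod E (alg_mult x h) = x" "ar (alg_mult x h) = Ide G (ao x)"
  by (simp_all add: alg_mult_def)

lemma alg_unit_arr [simp]: "alg_unit x h \<in> Arr E" "Dom E (alg_unit x h) = Io (ao x)"
  "Cod E (alg_unit x h) = x" "ar (alg_unit x h) = Ide G (ao x)"
  by (simp_all add: alg_unit_def)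

lemma alg_preserves_mult: "h \<cdot> free_mult x = alg_mult x h \<cdot> (h \<boxdot> h)"
proof -
  note [simp] = F_arr(2-5)[OF alg_simps(2-4)] \<mu>_arr(1-4)
  \<comment> \<open>Naturality of \<open>\<eta>\<close> moves \<open>h\<close> inside the free monoid, and the law \<open>h (T h) = h \<mu>\<close> replaces \<open>T h\<close> by the multiplicative \<open>\<mu>\<close>.\<close>
  have "alg_mult x h \<cdot> (h \<boxdot> h) = h \<cdot> free_mult x \<cdot> ((\<eta> x \<cdot> h) \<boxdot> (\<eta> x \<cdot> h))"
    by (simp add: alg_mult_def ten_cmp)
  also have "\<dots> = h \<cdot> (free_mult x \<cdot> (Ta h \<boxdot> Ta h)) \<cdot> (\<eta> (T x) \<boxdot> \<eta> (T x))"
    by (simp add: ten_cmp \<eta>_nat[symmetric])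
  also have "\<dots> = (h \<cdot> Ta h) \<cdot> free_mult (T x) \<cdot> (\<eta> (T x) \<boxdot> \<eta> (T x))"
    unfolding F_arr(6)[OF alg_simps(2-4), symmetric] by simp
  also have "\<dots> = h \<cdot> (\<mu> x \<cdot> free_mult (T x)) \<cdot> (\<eta> (T x) \<boxdot> \<eta> (T x))"
    unfolding alg_laws by simp
  also have "\<dots> = h \<cdot> free_mult x \<cdot> ((\<mu> x \<cdot> \<eta> (T x)) \<boxdot> (\<mu> x \<cdot> \<eta> (T x)))"
    unfolding \<mu>_arr(5)[OF alg_simps(1)] by (simp add: ten_cmp)
  finally show ?thesis by (simp add: \<mu>_arr(6))
qed

lemma alg_monoid: "monoid (ao x) x (alg_mult x h) (alg_unit x h)"
proof -
  let ?m = "alg_mult x h" and ?e = "alg_unit x h" and ?I = "Io (ao x)"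
  note m = alg_preserves_mult
  have T: "free_mult x \<cdot> (free_mult x \<boxdot> id (T x)) = free_mult x \<cdot> (id (T x) \<boxdot> free_mult x) \<cdot> as (T x) (T x) (T x)"
    "free_mult x \<cdot> (free_unit x \<boxdot> id (T x)) = l (T x)" "free_mult x \<cdot> (id (T x) \<boxdot> free_unit x) = r (T x)"
    using T_monoid[of x] by (auto simp: monoid_iff)
  have [simp]: "Ia (Ide G (ao x)) = id ?I" "ao x \<in> Obj G" by (simp_all add: unit_cmp)
  \<comment> \<open>Each law holds after precomposition with tensor powers of \<open>h\<close>, which are split by those of \<open>\<eta> x\<close>.\<close>
  have "(?m \<cdot> (?m \<boxdot> id x)) \<cdot> ((h \<boxdot> h) \<boxdot> h) = ?m \<cdot> ((?m \<cdot> (h \<boxdot> h)) \<boxdot> h)" by (simp add: ten_cmp)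
  also have "\<dots> = (?m \<cdot> (h \<boxdot> h)) \<cdot> (free_mult x \<boxdot> id (T x))" unfolding m[symmetric] by (simp add: ten_cmp m)
  also have "\<dots> = h \<cdot> free_mult x \<cdot> (free_mult x \<boxdot> id (T x))" unfolding m[symmetric] by simp
  also have "\<dots> = (h \<cdot> free_mult x) \<cdot> (id (T x) \<boxdot> free_mult x) \<cdot> as (T x) (T x) (T x)" unfolding T by simp
  also have "\<dots> = ?m \<cdot> (h \<boxdot> (h \<cdot> free_mult x)) \<cdot> as (T x) (T x) (T x)" unfolding m by (simp add: ten_cmp_tail m)
  also have "\<dots> = ?m \<cdot> (id x \<boxdot> ?m) \<cdot> ((h \<boxdot> h \<boxdot> h) \<cdot> as (T x) (T x) (T x))"
    unfolding m by (simp add: ten_cmp_tail)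
  also have "\<dots> = (?m \<cdot> (id x \<boxdot> ?m) \<cdot> as x x x) \<cdot> ((h \<boxdot> h) \<boxdot> h)"
    using as_nat[of h h h] by simp
  finally have assoc: "?m \<cdot> (?m \<boxdot> id x) = ?m \<cdot> (id x \<boxdot> ?m) \<cdot> as x x x"
    by (rule split_epi_cancel[where e' = "(\<eta> x \<boxdot> \<eta> x) \<boxdot> \<eta> x" and x = "(x \<boxtimes> x) \<boxtimes> x"]) (simp_all add: ten_cmp alg_laws)
  have "(?m \<cdot> (?e \<boxdot> id x)) \<cdot> (id ?I \<boxdot> h) = (?m \<cdot> (h \<boxdot> h)) \<cdot> (free_unit x \<boxdot> id (T x))"
    by (simp add: ten_cmp alg_unit_def)
  also have "\<dots> = h \<cdot> l (T x)" unfolding m[symmetric] using T by simp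
  also have "\<dots> = l x \<cdot> (id ?I \<boxdot> h)" using l_nat[of h] by simp
  finally have left: "?m \<cdot> (?e \<boxdot> id x) = l x"
    by (rule split_epi_cancel[where e' = "id ?I \<boxdot> \<eta> x" and x = "?I \<boxtimes> x"]) (simp_all add: ten_cmp alg_laws)
  have "(?m \<cdot> (id x \<boxdot> ?e)) \<cdot> (h \<boxdot> id ?I) = (?m \<cdot> (h \<boxdot> h)) \<cdot> (id (T x) \<boxdot> free_unit x)"
    by (simp add: ten_cmp alg_unit_def)
  also have "\<dots> = h \<cdot> r (T x)" unfolding m[symmetric] using T by simp
  also have "\<dots> = r x \<cdot> (h \<boxdot> id ?I)" using r_nat[of h] by simp
  finally have right: "?m \<cdot> (id x \<boxdot> ?e) = r x"
    by (rule split_epi_cancel[where e' = "\<eta> x \<boxdot> id ?I" and x = "x \<boxtimes> ?I"]) (simp_all add: ten_cmp alg_laws)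
  show ?thesis by (simp add: monoid_iff assoc left right)
qed

text \<open>
  By the previous lemmas \<open>h\<close> underlies a morphism of surmonoids out of the free one, and it restricts to
  the identity along \<open>\<eta> x\<close>.
\<close>

lemma alg_is_counit: "Far U (\<epsilon> (x, alg_mult x h, alg_unit x h, ao x)) = h"
proof -
  let ?y = "(x, alg_mult x h, alg_unit x h, ao x)" and ?g = "(Fob F x, (h, Ide G (ao x)), (x, alg_mult x h, alg_unit x h, ao x))"
  have unit: "h \<cdot> free_unit x = alg_unit x h \<cdot> Ia (Ide G (ao x))" by (simp add: alg_unit_def unit_cmp)
  have "((T x, free_mult x, free_unit x, ao x), (h, Ide G (ao x)), ?y) \<in> Arr (Mon G E)"
    unfolding Mon_arr by (intro conjI T_monoid alg_monoid alg_preserves_mult unit alg_simps alg_ar)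
  then have "?g \<in> Arr (Mon G E)"
    by (simp only: F_obj[OF alg_simps(1), symmetric])
  then have "?g = \<epsilon> ?y"
    by (intro counit_unique[OF adj]) (auto simp: Mon_obj alg_monoid hom_def Mon_forget_def alg_laws)
  then have "Far U (\<epsilon> ?y) = Far U ?g" by simp
  then show ?thesis by (simp add: Mon_forget_def)
qed

end

text \<open>
  The structure of the source is computed from \<open>h\<close>, and \<open>f h = h' (T f)\<close> passes \<open>f\<close> through \<open>h\<close> to a morphism
  of free monoids.
\<close>

lemma alg_morphism:
  assumes h: "(x, h) \<in> Obj (EM E S)" and h': "(x', h') \<in> Obj (EM E S)"
    and f: "f \<in> Arr E" "Dom E f = x" "Cod E f = x'" "f \<cdot> h = h' \<cdot> Ta f"
  shows "f \<cdot> alg_mult x h = alg_mult x' h' \<cdot> (f \<boxdot> f)" "f \<cdot> alg_unit x h = alg_unit x' h' \<cdot> Ia (ar f)"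
proof -
  note [simp] = alg_simps[OF h] alg_simps[OF h'] alg_ar[OF h] alg_ar[OF h'] f(1-3) F_arr(2-5)[OF f(1-3)]
  have [simp]: "Dom G (ar f) = ao x" "Cod G (ar f) = ao x'" "ar f \<in> Arr G" using f by auto
  have "f \<cdot> alg_mult x h = (f \<cdot> h) \<cdot> free_mult x \<cdot> (\<eta> x \<boxdot> \<eta> x)" by (simp add: alg_mult_def)
  also have "\<dots> = h' \<cdot> (Ta f \<cdot> free_mult x) \<cdot> (\<eta> x \<boxdot> \<eta> x)" unfolding f(4) by simp
  also have "\<dots> = h' \<cdot> free_mult x' \<cdot> ((Ta f \<cdot> \<eta> x) \<boxdot> (Ta f \<cdot> \<eta> x))"
    unfolding F_arr(6)[OF f(1-3)] by (simp add: ten_cmp)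
  also have "\<dots> = alg_mult x' h' \<cdot> (f \<boxdot> f)"
    unfolding \<eta>_nat[OF f(1-3)] by (simp add: alg_mult_def ten_cmp)
  finally show "f \<cdot> alg_mult x h = alg_mult x' h' \<cdot> (f \<boxdot> f)" .
  have "f \<cdot> alg_unit x h = (f \<cdot> h) \<cdot> free_unit x" by (simp add: alg_unit_def)
  also have "\<dots> = h' \<cdot> (Ta f \<cdot> free_unit x)" unfolding f(4) by simp
  also have "\<dots> = alg_unit x' h' \<cdot> Ia (ar f)" unfolding F_arr(7)[OF f(1-3)] by (simp add: alg_unit_def)
  finally show "f \<cdot> alg_unit x h = alg_unit x' h' \<cdot> Ia (ar f)" .
qed

abbreviation "K \<equiv> comparison (Mon G E) U \<epsilon>"

lemma K_sel: "Fob K y = (Fob U y, Far U (\<epsilon> y))" "Far K (y, (f, b), y') = (Fob K y, f, Fob K y')"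
  by (simp_all add: comparison_def Let_def) (simp add: Mon_forget_def)

lemma K_obj:
  assumes y: "monoid B c m e"
  shows "Fob K (c, m, e, B) = (c, Far U (\<epsilon> (c, m, e, B)))" "Fob K (c, m, e, B) \<in> Obj (EM E S)"
proof -
  let ?y = "(c, m, e, B)" and ?k = "Far U (\<epsilon> (c, m, e, B))"
  note k = \<epsilon>_arr[OF y refl]
  have c: "c \<in> Obj E" "ao c = B" using y by (auto simp: monoid_iff)
  have B: "B \<in> Obj G" using c Ar.fob_obj[of c] by simp
  have "e \<in> Arr E" "Dom E e = Io B" using y by (simp_all add: monoid_iff)
  then have unit: "?k \<cdot> free_unit c = e \<cdot> Ia (Ide G B)" using B k(6) by (simp add: unit_cmp)
  show eq: "Fob K ?y = (c, ?k)" by (simp add: K_sel) (simp add: Mon_forget_def)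
  \<comment> \<open>The counit is itself an arrow of surmonoids; its naturality square at that arrow is the associative law of the algebra.\<close>
  have "((T c, free_mult c, free_unit c, ao c), (?k, Ide G B), ?y) \<in> Arr (Mon G E)"
    unfolding Mon_arr by (intro conjI T_monoid c(1) y k(1-5) unit)
  then have "(Fob F c, (?k, Ide G B), ?y) \<in> Arr (Mon G E)"
    by (simp only: F_obj[OF c(1), symmetric])
  from \<epsilon>_nat[OF this refl] show "Fob K ?y \<in> Obj (EM E S)"
    unfolding eq EM_obj_iff using c k by (simp add: \<mu>_def)
qed

lemma K_surfunctor: "surfunctor G (Mon G E) (EM E S) K"
proof -
  have EM: "surcategory G (EM E S)" by (rule EM_surcategory[OF surmonad_induced[OF adj]])
  have "is_functor (Mon G E) (EM E S) K"
  proof (intro is_functor.intro is_functor_axioms.intro Mon_category)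
    show "category (EM E S)" by (rule functorD(1)[OF EM[unfolded surcategory_def]])
  next
    fix y assume y: "y \<in> Obj (Mon G E)"
    obtain c m e B where y': "y = (c, m, e, B)" by (metis surj_pair)
    have mon: "monoid B c m e" using y by (simp add: y' Mon_obj)
    show "Fob K y \<in> Obj (EM E S)" unfolding y' by (rule K_obj(2)[OF mon])
    have "Far K (Ide (Mon G E) y) = (Fob K y, id c, Fob K y)" by (simp add: y' K_sel(2))
    then show "Far K (Ide (Mon G E) y) = Ide (EM E S) (Fob K y)"
      unfolding y' K_obj(1)[OF mon] by simp
  next
    fix g y z assume "g \<in> hom (Mon G E) y z"
    then have g: "g \<in> Arr (Mon G E)" "Dom (Mon G E) g = y" "Cod (Mon G E) g = z" by (auto simp: hom_def)
    obtain c m e B f c' m' e' B' where g': "g = ((c, m, e, B), (f, ar f), (c', m', e', B'))"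
      "monoid B c m e" "monoid B' c' m' e'" "f \<in> Arr E" "Dom E f = c" "Cod E f = c'"
      using g(1) by (rule Mon_cases)
    have "f \<cdot> Far U (\<epsilon> (c, m, e, B)) = Far U (\<epsilon> (c', m', e', B')) \<cdot> Ta f"
      by (rule \<epsilon>_nat[OF g(1) g'(1)])
    then have "((c, Far U (\<epsilon> (c, m, e, B))), f, (c', Far U (\<epsilon> (c', m', e', B')))) \<in> Arr (EM E S)"
      using K_obj[OF g'(2)] K_obj[OF g'(3)] g'(4-6)
      by (simp add: EM_arr hom_def) (simp add: induced_monad_def comp_ftor_def)
    then show "Far K g \<in> hom (EM E S) (Fob K y) (Fob K z)"
      using g g' K_obj(1)[OF g'(2)] K_obj(1)[OF g'(3)] by (auto simp: hom_def K_sel(2))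
  next
    fix g k x y z assume "g \<in> hom (Mon G E) x y" "k \<in> hom (Mon G E) y z"
    then show "Far K (k \<cdot>\<^bsub>Mon G E\<^esub> g) = Far K k \<cdot>\<^bsub>EM E S\<^esub> Far K g"
      by (cases g, cases k) (auto simp: K_sel(2))
  qed
  moreover have "ftor_eq (Mon G E) (Arity (EM E S) \<circ>\<^sub>F K) (Arity (Mon G E))"
    unfolding ftor_eq_def
  proof (intro conjI ballI)
    fix y assume "y \<in> Obj (Mon G E)"
    then show "Fob (Arity (EM E S) \<circ>\<^sub>F K) y = Fob (Arity (Mon G E)) y"
      by (cases y) (auto simp: comp_ftor_def Mon_obj K_obj(1) monoid_iff)
  next
    fix g assume "g \<in> Arr (Mon G E)"
    then show "Far (Arity (EM E S) \<circ>\<^sub>F K) g = Far (Arity (Mon G E)) g"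
      by (auto simp: comp_ftor_def K_sel(2) elim!: Mon_cases)
  qed
  ultimately show ?thesis
    unfolding surfunctor_def using EM Mon_surcategory by blast
qed

text \<open>
  The inverse of the comparison.
\<close>

definition "L = \<lparr>Fob = (\<lambda>(x, h). (x, alg_mult x h, alg_unit x h, ao x)),
  Far = (\<lambda>((x, h), f, (x', h')).
    ((x, alg_mult x h, alg_unit x h, ao x), (f, ar f), (x', alg_mult x' h', alg_unit x' h', ao x')))\<rparr>"

lemma L_surfunctor: "surfunctor G (EM E S) (Mon G E) L"
proof -
  have EM: "surcategory G (EM E S)" by (rule EM_surcategory[OF surmonad_induced[OF adj]])
  have "is_functor (EM E S) (Mon G E) L"
  proof (intro is_functor.intro is_functor_axioms.intro Mon_category)
    show "category (EM E S)" by (rule functorD(1)[OF EM[unfolded surcategory_def]])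
  next
    fix a assume a: "a \<in> Obj (EM E S)"
    obtain x h where a': "a = (x, h)" by fastforce
    have x: "x \<in> Obj E" using a EM_obj_iff unfolding a' by blast
    show "Fob L a \<in> Obj (Mon G E)"
      using alg_monoid[OF a[unfolded a']] by (simp add: a' L_def Mon_obj)
    show "Far L (Ide (EM E S) a) = Ide (Mon G E) (Fob L a)"
      using x by (simp add: a' L_def)
  next
    fix g a b assume g: "g \<in> hom (EM E S) a b"
    then have "g \<in> Arr (EM E S)" by (simp add: hom_def)
    then obtain x h f x' h' where g': "g = ((x, h), f, (x', h'))" "(x, h) \<in> Obj (EM E S)" "(x', h') \<in> Obj (EM E S)"
      "f \<in> hom E x x'" "f \<cdot> h = h' \<cdot> Ta f"
      by (rule EM_cases) (auto simp: induced_monad_def comp_ftor_def)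
    have "Far L g \<in> Arr (Mon G E)"
      using g' alg_monoid[OF g'(2)] alg_monoid[OF g'(3)] alg_morphism[OF g'(2,3) _ _ _ g'(5)]
      by (simp add: L_def Mon_arr hom_def)
    then show "Far L g \<in> hom (Mon G E) (Fob L a) (Fob L b)"
      using g g'(1) by (auto simp: hom_def L_def)
  next
    fix g k a b c assume "g \<in> hom (EM E S) a b" "k \<in> hom (EM E S) b c"
    then show "Far L (k \<cdot>\<^bsub>EM E S\<^esub> g) = Far L k \<cdot>\<^bsub>Mon G E\<^esub> Far L g"
      by (auto simp: hom_def[of "EM E S"] L_def hom_def[of E] elim!: EM_cases)
  qed
  moreover have "ftor_eq (EM E S) (Arity (Mon G E) \<circ>\<^sub>F L) (Arity (EM E S))"
    by (auto simp: ftor_eq_def comp_ftor_def L_def)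
  ultimately show ?thesis
    unfolding surfunctor_def using EM Mon_surcategory by blast
qed

text \<open>
  The counit at a monoid is multiplicative and split by \<open>\<eta>\<close>, so the multiplication of the monoid is
  recovered from that of the free monoid.
\<close>

lemma L_K_obj:
  assumes y: "monoid B c m e"
  shows "Fob L (Fob K (c, m, e, B)) = (c, m, e, B)"
proof -
  let ?k = "Far U (\<epsilon> (c, m, e, B))"
  note k = \<epsilon>_arr[OF y refl]
  have c [simp]: "c \<in> Obj E" "ao c = B" "m \<in> Arr E" "Dom E m = c \<boxtimes> c" "ar m = Ide G B"
    using y by (auto simp: monoid_iff)
  note [simp] = k(1-4)
  have "alg_mult c ?k = (?k \<cdot> free_mult c) \<cdot> (\<eta> c \<boxdot> \<eta> c)" by (simp add: alg_mult_def)
  also have "\<dots> = m" unfolding k(5) by (simp add: ten_cmp k(7))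
  finally show ?thesis
    using k(6) by (simp add: K_obj(1)[OF y] L_def alg_unit_def)
qed

lemma comparison_isomorphism: "sur_isomorphism G (Mon G E) (EM E S) K"
proof -
  have "ftor_eq (Mon G E) (L \<circ>\<^sub>F K) id_ftor"
    unfolding ftor_eq_def
  proof (intro conjI ballI)
    fix y assume "y \<in> Obj (Mon G E)"
    then show "Fob (L \<circ>\<^sub>F K) y = Fob id_ftor y"
      by (cases y) (simp add: comp_ftor_def id_ftor_def Mon_obj L_K_obj)
  next
    fix g assume "g \<in> Arr (Mon G E)"
    then obtain c m e B f c' m' e' B' where g: "g = ((c, m, e, B), (f, ar f), (c', m', e', B'))"
      "monoid B c m e" "monoid B' c' m' e'"
      by (rule Mon_cases)
    have "Far L (a, f, b) = (Fob L a, (f, ar f), Fob L b)" for a b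
      by (cases a; cases b) (simp add: L_def)
    then show "Far (L \<circ>\<^sub>F K) g = Far id_ftor g"
      using g by (simp add: comp_ftor_def id_ftor_def K_sel(2) L_K_obj)
  qed
  moreover have K_L_obj: "Fob K (Fob L a) = a" if "a \<in> Obj (EM E S)" for a
    using that K_obj(1)[OF alg_monoid] by (cases a) (simp add: L_def alg_is_counit)
  have "ftor_eq (EM E S) (K \<circ>\<^sub>F L) id_ftor"
    unfolding ftor_eq_def
  proof (intro conjI ballI)
    fix a assume "a \<in> Obj (EM E S)"
    then show "Fob (K \<circ>\<^sub>F L) a = Fob id_ftor a" by (simp add: comp_ftor_def id_ftor_def K_L_obj)
  next
    fix g assume "g \<in> Arr (EM E S)"
    then obtain x h f x' h' where g: "g = ((x, h), f, (x', h'))" "(x, h) \<in> Obj (EM E S)" "(x', h') \<in> Obj (EM E S)"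
      by (rule EM_cases)
    have "Far L g = (Fob L (x, h), (f, ar f), Fob L (x', h'))" by (simp add: g L_def)
    then show "Far (K \<circ>\<^sub>F L) g = Far id_ftor g"
      using g K_L_obj by (simp add: comp_ftor_def id_ftor_def K_sel(2))
  qed
  ultimately show ?thesis
    unfolding sur_isomorphism_def using K_surfunctor L_surfunctor by blast
qed

end

section \<open>The forgetful surfunctor\<close>

theorem (in initial_unit) Mon_forget_left_suradjoint:
  "\<exists>M \<eta> \<epsilon>. suradjunction G E (Mon G E) M Mon_forget \<eta> \<epsilon>"
proof (rule suradjunction_of_universal_arrows[OF Mon_forget_surfunctor])
  fix x assume x: "x \<in> Obj E"
  obtain C m e n where C: "monoid (ao x) C m e" and n: "n \<in> hom E x C" "ar n = Ide G (ao x)"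
    and univ: "\<And>B D m' e' f. monoid B D m' e' \<and> f \<in> hom E x D \<longrightarrow>
     (\<exists>!h. h \<in> hom E C D \<and> h \<cdot> m = m' \<cdot> (h \<boxdot> h) \<and> h \<cdot> e = e' \<cdot> Ia (ar h) \<and> h \<cdot> n = f)"
    using free_monoid_exists[OF x] by blast
  let ?y = "(C, m, e, ao x)"
  have "\<exists>!g. g \<in> hom (Mon G E) ?y z \<and> Far Mon_forget g \<cdot> n = f"
    if z: "z \<in> Obj (Mon G E)" and f: "f \<in> hom E x (Fob Mon_forget z)" for z f
  proof -
    obtain D m' e' B where z': "z = (D, m', e', B)" by (metis surj_pair)
    have D: "monoid B D m' e'" "f \<in> hom E x D" using z f by (auto simp: z' Mon_obj Mon_forget_def)
    have iff: "g \<in> hom (Mon G E) ?y z \<and> Far Mon_forget g \<cdot> n = f \<longleftrightarrow>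
      (\<exists>h. g = (?y, (h, ar h), z) \<and> h \<in> hom E C D \<and> h \<cdot> m = m' \<cdot> (h \<boxdot> h) \<and> h \<cdot> e = e' \<cdot> Ia (ar h) \<and> h \<cdot> n = f)" for g
    proof
      assume g: "g \<in> hom (Mon G E) ?y z \<and> Far Mon_forget g \<cdot> n = f"
      then have "g \<in> Arr (Mon G E)" by (simp add: hom_def)
      then show "\<exists>h. g = (?y, (h, ar h), z) \<and> h \<in> hom E C D \<and> h \<cdot> m = m' \<cdot> (h \<boxdot> h) \<and> h \<cdot> e = e' \<cdot> Ia (ar h) \<and> h \<cdot> n = f"
        using g by (auto simp: hom_def z' Mon_forget_def elim!: Mon_cases)
    next
      assume "\<exists>h. g = (?y, (h, ar h), z) \<and> h \<in> hom E C D \<and> h \<cdot> m = m' \<cdot> (h \<boxdot> h) \<and> h \<cdot> e = e' \<cdot> Ia (ar h) \<and> h \<cdot> n = f"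
      then show "g \<in> hom (Mon G E) ?y z \<and> Far Mon_forget g \<cdot> n = f"
        using C D by (auto simp: hom_def z' Mon_arr Mon_forget_def)
    qed
    show ?thesis unfolding iff using univ[of B D m' e' f] D by blast
  qed
  then show "\<exists>y n. y \<in> Obj (Mon G E) \<and> n \<in> hom E x (Fob Mon_forget y) \<and>
    ar n = Ide G (ao x) \<and>
    (\<forall>z \<in> Obj (Mon G E). \<forall>f \<in> hom E x (Fob Mon_forget z).
      \<exists>!g. g \<in> hom (Mon G E) y z \<and> Far Mon_forget g \<cdot> n = f)"
    using C n by (intro exI[of _ ?y] exI[of _ n]) (auto simp: Mon_obj Mon_forget_def)
qed

theorem (in surmonoidal) Mon_forget_comparison_isomorphism:
  assumes "suradjunction G E (Mon G E) F Mon_forget \<eta> \<epsilon>"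
  shows "sur_isomorphism G (Mon G E) (EM E (induced_monad F Mon_forget \<eta> \<epsilon>))
    (comparison (Mon G E) Mon_forget \<epsilon>)"
proof -
  interpret monoid_suradjunction G E F \<eta> \<epsilon>
    by (intro monoid_suradjunction.intro monoid_suradjunction_axioms.intro surmonoidal_axioms assms)
  show ?thesis by (rule comparison_isomorphism)
qed

theorem theorem7:
  fixes G :: "('go, 'ga) cat"
    and E :: "('o, 'a, 'go, 'ga) surmoncat"
  assumes "liberal_surmonoidal G E"
    and "\<And>B. B \<in> Obj G \<Longrightarrow> is_initial (fiber G E B) (Fob (Unit E) B)"
    and "\<And>b. b \<in> Arr G \<Longrightarrow> is_initial (arrow_fiber G E b) (Far (Unit E) b)"
  shows "(\<exists>M \<eta> \<epsilon>. suradjunction G E (Mon G E) M Mon_forget \<eta> \<epsilon>) \<and>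
         surmonadic G E (Mon G E) Mon_forget"
proof -
  have "surmonoidal_surcategory G E" using assms(1) by (simp add: liberal_surmonoidal_def)
  then interpret initial_unit G E
    by (intro initial_unit.intro liberal.intro surmonoidal.intro liberal_axioms.intro
      initial_unit_axioms.intro assms)
  show ?thesis
    unfolding surmonadic_def
    using Mon_forget_left_suradjoint Mon_forget_comparison_isomorphism by blast
qed

end
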